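(* Let $n\ge 2$ be even, $\ell=\lfloor\frac{n-2}{2}\rfloor$, $\mathsf{k}$ a field, and $Q=\mathsf{k}[x_1,\dots,x_n]$ (standard graded). Let $f_1,\dots,f_{n+1}\in Q$ be homogeneous of degree $2$ such that $f_1,\dots,f_n$ is a regular sequence and $f_{n+1}\notin J=(f_1,\dots,f_n)$. Let $P=Q/J$ and $R=Q/(f_1,\dots,f_{n+1})$. If $f_{n+1}$ is a maximal rank element of $P$, then $$\beta_{i,j}^Q(R)=\begin{cases}\binom{n+1}{i}, & \text{if } j=2i \text{ and } 0\le i\le \ell,\\ \rho_i(n), & \text{if } j=i+\ell+1 \text{ and } i\ge 0,\\ 0, & \text{otherwise.}\end{cases}$$ Consequently, the sequence $\{\rho_i(n)\}_{i\ge0}$ satisfies: \begin{enumerate} \item[(1)] $\rho_1(n)=0$ when $n\ge 4$, and $\rho_k(n)=0$ when $k>n$; \item[(2)] $\rho_k(n)=\rho_{n-k+2}(n)$ for all $0\le k\le \ell$; \item[(3)] $\rho_n(n)=C_{\ell+2}$ for all $n\ge 2$, and $\rho_2(n)=C_{\ell+2}$ for all $n\ge 6$; \item[(4)] $\rho_{\ell+1}(n)=\rho_{\ell+3}(n)+\binom{n+1}{\ell+1}$. \end{enumerate} In particular, when $n\ge 6$, one has on the strand $j=i+\ell+1$: $\beta^Q_{i,i+\ell+1}(R)=\rho_i(n)$ for $2\le i\le \ell+3$, $\beta^Q_{i,i+\ell+1}(R)=\rho_{n+2-i}(n)$ for $\ell+4\le i\le n$, and $\beta^Q_{i,i+\ell+1}(R)=0$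 for all other $i$.
   Context: $\beta_{i,j}^Q(M)=\dim_{\mathsf{k}}\operatorname{Tor}_i^Q(M,\mathsf{k})_j$. A homogeneous element $f$ of degree $d\ge1$ of $Q$ (identified with its image in $P$) is a maximal rank element of $P$ if for each $i\ge 0$ the multiplication map $P_i\xrightarrow{\cdot f}P_{i+d}$ has maximal rank (is injective or surjective). The Catalan numbers are $C_k=\frac{1}{k+1}\binom{2k}{k}$. With $\ell=\lfloor\frac{n-2}{2}\rfloor$, the sequence $\{\rho_k(n)\}_{k\ge 0}$ is defined by $\rho_0(n)=0$ and, for $k\ge 1$, $$\rho_k(n)=\sum_{i=0}^{k-1}(-1)^{i+k+1}\binom{n+k-i-1}{n-1}\rho_i(n)+\sum_{i=0}^{\ell}(-1)^{i+k+1}\binom{n+k+\ell-2i}{n-1}\binom{n+1}{i}.$$ *)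

theory Defs
  imports
    Complex_Main
    "HOL-Algebra.QuotRing"
    "HOL-Algebra.Module"
    "HOL-Library.Poly_Mapping"
    "HOL-Library.Cardinality"
begin

section \<open>The standard graded polynomial ring\<close>

text \<open>
  The variables are indexed by a type \<open>'n\<close> (finite in all uses), so that the polynomial ring in
  \<open>CARD('n)\<close> variables is a whole type: a polynomial maps exponent vectors to coefficients.
\<close>

type_synonym ('n, 'k) mpoly = "('n \<Rightarrow>\<^sub>0 nat) \<Rightarrow>\<^sub>0 'k"

definition mpoly_ring :: "('n, 'k::field) mpoly ring" where
  "mpoly_ring = \<lparr>carrier = UNIV, monoid.mult = (*), one = 1, ring.zero = 0, add = (+)\<rparr>"

definition monom_deg :: "('n::finite \<Rightarrow>\<^sub>0 nat) \<Rightarrow> nat" where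
  "monom_deg m = (\<Sum>i\<in>UNIV. Poly_Mapping.lookup m i)"

text \<open>The component \<open>Q\<^sub>j\<close>; it contains \<open>0\<close>, and it is \<open>{0}\<close> for \<open>j < 0\<close>.\<close>

definition homog_part :: "int \<Rightarrow> ('n::finite, 'k::field) mpoly set" where
  "homog_part j = {p. \<forall>m\<in>Poly_Mapping.keys p. int (monom_deg m) = j}"

section \<open>Cyclic graded modules, regular sequences, maximal rank elements\<close>

definition quot_part :: "('n::finite, 'k::field) mpoly set \<Rightarrow> int \<Rightarrow> ('n, 'k) mpoly set set" where
  "quot_part I j = (\<lambda>p. I +>\<^bsub>mpoly_ring\<^esub> p) ` homog_part j"

definition quot_module ::
    "('n, 'k::field) mpoly set \<Rightarrow> (('n, 'k) mpoly, ('n, 'k) mpoly set) module" where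
  "quot_module I = ring.extend (mpoly_ring Quot I)
     (module.fields (\<lambda>q X. (I +>\<^bsub>mpoly_ring\<^esub> q) \<otimes>\<^bsub>mpoly_ring Quot I\<^esub> X))"

definition regular_sequence :: "(nat \<Rightarrow> ('n, 'k::field) mpoly) \<Rightarrow> nat \<Rightarrow> bool" where
  "regular_sequence f m \<longleftrightarrow>
     (\<forall>i\<in>{1..m}. \<forall>q. f i * q \<in> Idl\<^bsub>mpoly_ring\<^esub> (f ` {1..<i}) \<longrightarrow> q \<in> Idl\<^bsub>mpoly_ring\<^esub> (f ` {1..<i})) \<and>
     Idl\<^bsub>mpoly_ring\<^esub> (f ` {1..m}) \<noteq> UNIV"

definition max_rank_element ::
    "('n::finite, 'k::field) mpoly set \<Rightarrow> nat \<Rightarrow> ('n, 'k) mpoly \<Rightarrow> bool" where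
  "max_rank_element J d f \<longleftrightarrow> 1 \<le> d \<and> f \<in> homog_part (int d) \<and>
     (\<forall>i::nat. let mul = (\<lambda>X. X \<otimes>\<^bsub>mpoly_ring Quot J\<^esub> (J +>\<^bsub>mpoly_ring\<^esub> f)) in
        inj_on mul (quot_part J (int i)) \<or>
        mul ` quot_part J (int i) = quot_part J (int (i + d)))"

section \<open>Complexes of graded free modules\<close>

text \<open>
  A complex \<open>F\<close> of graded free modules over the polynomial ring is given by the sets \<open>gens F i\<close> of
  basis indices of \<open>F\<^sub>i\<close>, the internal degrees \<open>gdeg F i b\<close> of the basis elements \<open>e\<^sub>b\<close>, that is,
  \<open>F\<^sub>i\<close> is the direct sum of the \<open>Q(-gdeg F i b)\<close>, and the columns \<open>col F i b\<close>, the image of \<open>e\<^sub>b\<close>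
  under the differential from \<open>F\<^sub>i\<close> to \<open>F\<^sub>i\<^sub>-\<^sub>1\<close>. Elements of \<open>F\<^sub>i\<close> are finitely supported vectors.
\<close>

record (overloaded) ('n, 'k) free_complex =
  gens :: "nat \<Rightarrow> nat set"
  gdeg :: "nat \<Rightarrow> nat \<Rightarrow> int"
  col :: "nat \<Rightarrow> nat \<Rightarrow> (nat \<Rightarrow>\<^sub>0 ('n, 'k) mpoly)"

definition vec_scale :: "'r::semiring_0 \<Rightarrow> (nat \<Rightarrow>\<^sub>0 'r) \<Rightarrow> (nat \<Rightarrow>\<^sub>0 'r)" where
  "vec_scale c v = Poly_Mapping.map ((*) c) v"

text \<open>The linear map sending the basis element with index \<open>b\<close> to \<open>D b\<close>.\<close>

definition lin_ext :: "(nat \<Rightarrow> (nat \<Rightarrow>\<^sub>0 'r::semiring_0)) \<Rightarrow> (nat \<Rightarrow>\<^sub>0 'r) \<Rightarrow> (nat \<Rightarrow>\<^sub>0 'r)" where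
  "lin_ext D v = (\<Sum>b\<in>Poly_Mapping.keys v. vec_scale (Poly_Mapping.lookup v b) (D b))"

definition free_mod ::
    "('n, 'k::field) free_complex \<Rightarrow> nat \<Rightarrow> (nat \<Rightarrow>\<^sub>0 ('n, 'k) mpoly) set" where
  "free_mod F i = {v. Poly_Mapping.keys v \<subseteq> gens F i}"

definition free_part ::
    "('n::finite, 'k::field) free_complex \<Rightarrow> nat \<Rightarrow> int \<Rightarrow> (nat \<Rightarrow>\<^sub>0 ('n, 'k) mpoly) set" where
  "free_part F i j = {v \<in> free_mod F i. \<forall>b. Poly_Mapping.lookup v b \<in> homog_part (j - gdeg F i b)}"

text \<open>
  A graded free resolution \<open>\<dots> \<rightarrow> F\<^sub>1 \<rightarrow> F\<^sub>0 \<rightarrow> M \<rightarrow> 0\<close> with augmentation \<open>\<epsilon>\<close> of a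
  module \<open>M\<close> graded by \<open>gr\<close>. Each \<open>F\<^sub>i\<close> has finitely many basis elements in each degree, which holds
  in particular for finitely generated free modules; minimality is not required.
\<close>

definition graded_free_resolution ::
    "(('n::finite, 'k::field) mpoly, 'm) module \<Rightarrow> (int \<Rightarrow> 'm set) \<Rightarrow> ('n, 'k) free_complex \<Rightarrow>
     ((nat \<Rightarrow>\<^sub>0 ('n, 'k) mpoly) \<Rightarrow> 'm) \<Rightarrow> bool" where
  "graded_free_resolution M gr F \<epsilon> \<longleftrightarrow>
     (\<forall>i j. finite {b \<in> gens F i. gdeg F i b = j}) \<and>
     (\<forall>i. \<forall>b\<in>gens F (Suc i). col F (Suc i) b \<in> free_part F i (gdeg F (Suc i) b)) \<and>
     (\<forall>u\<in>free_mod F 0. \<forall>v\<in>free_mod F 0. \<epsilon> (u + v) = \<epsilon> u \<oplus>\<^bsub>M\<^esub> \<epsilon> v) \<and>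
     (\<forall>q. \<forall>v\<in>free_mod F 0. \<epsilon> (vec_scale q v) = q \<odot>\<^bsub>M\<^esub> \<epsilon> v) \<and>
     (\<forall>j. \<epsilon> ` free_part F 0 j \<subseteq> gr j) \<and>
     \<epsilon> ` free_mod F 0 = carrier M \<and>
     {v \<in> free_mod F 0. \<epsilon> v = \<zero>\<^bsub>M\<^esub>} = lin_ext (col F 1) ` free_mod F 1 \<and>
     (\<forall>i. {v \<in> free_mod F (Suc i). lin_ext (col F (Suc i)) v = 0} =
          lin_ext (col F (Suc (Suc i))) ` free_mod F (Suc (Suc i)))"

section \<open>Graded Betti numbers\<close>

text \<open>
  The complex obtained from \<open>F\<close> by applying \<open>\<otimes>\<^sub>Q k\<close>: the module \<open>Q(-a)\<close> becomes \<open>k(-a)\<close>, and the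
  entries of the matrices are reduced modulo the ideal generated by the variables, i.e. replaced by
  their constant coefficients. The differential leaving homological degree \<open>0\<close> is zero.
\<close>

definition red_part :: "('n, 'k::field) free_complex \<Rightarrow> nat \<Rightarrow> int \<Rightarrow> (nat \<Rightarrow>\<^sub>0 'k) set" where
  "red_part F i j = {w. Poly_Mapping.keys w \<subseteq> {b \<in> gens F i. gdeg F i b = j}}"

definition red_diff :: "('n, 'k::field) free_complex \<Rightarrow> nat \<Rightarrow> (nat \<Rightarrow>\<^sub>0 'k) \<Rightarrow> (nat \<Rightarrow>\<^sub>0 'k)" where
  "red_diff F i w =
     (if i = 0 then 0 else lin_ext (\<lambda>b. Poly_Mapping.map (\<lambda>p. Poly_Mapping.lookup p 0) (col F i b)) w)"

definition tor_dim :: "('n, 'k::field) free_complex \<Rightarrow> nat \<Rightarrow> int \<Rightarrow> nat" where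
  "tor_dim F i j =
     vector_space.dim vec_scale {w \<in> red_part F i j. red_diff F i w = 0}
     - vector_space.dim vec_scale (red_diff F (Suc i) ` red_part F (Suc i) j)"

text \<open>
  \<open>\<beta>\<^sub>i\<^sub>,\<^sub>j(M) = dim\<^sub>k Tor\<^sub>i(M, k)\<^sub>j\<close>, where Tor is computed from some graded free resolution of \<open>M\<close>;
  the value does not depend on the choice. It is meaningful for modules having a resolution as
  above, such as finitely generated graded modules.
\<close>

definition betti ::
    "(('n::finite, 'k::field) mpoly, 'm) module \<Rightarrow> (int \<Rightarrow> 'm set) \<Rightarrow> nat \<Rightarrow> int \<Rightarrow> nat" where
  "betti M gr i j = tor_dim (SOME F. \<exists>\<epsilon>. graded_free_resolution M gr F \<epsilon>) i j"

abbreviation betti_quot :: "('n::finite, 'k::field) mpoly set \<Rightarrow> nat \<Rightarrow> int \<Rightarrow> nat" where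
  "betti_quot I \<equiv> betti (quot_module I) (quot_part I)"

section \<open>The numerical sequences\<close>

definition ell :: "nat \<Rightarrow> nat" where
  "ell n = (n - 2) div 2"

text \<open>\<open>rho n k\<close> is \<open>\<rho>\<^sub>k(n)\<close>. For \<open>n \<ge> 2\<close> none of the subtractions of naturals truncates.\<close>

fun rho :: "nat \<Rightarrow> nat \<Rightarrow> int" where
  "rho n k = (if k = 0 then 0 else
     (\<Sum>i<k. (-1) ^ (i + k + 1) * int ((n + k - i - 1) choose (n - 1)) * rho n i) +
     (\<Sum>i\<le>ell n. (-1) ^ (i + k + 1) * int ((n + k + ell n - 2 * i) choose (n - 1))
        * int ((n + 1) choose i)))"

declare rho.simps [simp del]

definition catalan :: "nat \<Rightarrow> rat" where
  "catalan k = 1 / (of_nat k + 1) * of_nat ((2 * k) choose k)"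

end

theory Submission
  imports
    Defs
    "HOL-Library.Function_Algebras"
    "HOL-Library.Nat_Bijection"
    "HOL-Computational_Algebra.Formal_Power_Series"
begin

text \<open>
  The graded Betti numbers of a cyclic module \<open>Q/I\<close> are the dimensions of its Koszul homology with
  respect to the variables (shift dimensions along the syzygies of any resolution; the Koszul complex
  of a free module is acyclic). Passing from \<open>Q/J\<close> to \<open>Q/(J, f)\<close> with \<open>f\<close> a quadric, the long exact
  sequence splits because \<open>f\<close> acts as zero on Koszul homology, as long as \<open>f\<close> is a nonzerodivisor in
  the degrees involved. Along the regular sequence this gives the homology of \<open>P\<close> and its Hilbert series
  \<open>(1 + t)^n\<close>. The maximal rank condition then makes \<open>f\<^sub>n\<^sub>+\<^sub>1\<close> injective on \<open>P\<close> up to degree \<open>\<ell>\<close> and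
  surjective from degree \<open>\<ell>\<close> on, so that the Hilbert series of \<open>R\<close> is \<open>(1 + t)^n (1 - t^2)\<close> truncated
  after degree \<open>\<ell> + 1\<close>. Hence the Betti numbers below the strand \<open>j = i + \<ell> + 1\<close> are those of a complete
  intersection, those above vanish, and those on the strand are given by the Euler characteristic.
  The recursion for \<open>\<rho>\<close> expresses the same Euler characteristic, and the symmetries of \<open>\<rho>\<close> come from
  \<open>(1 + t)^n (1 - t^2)\<close> being antipalindromic.
\<close>

section \<open>The numerical sequence\<close>

text \<open>\<open>betti\<close> picks a resolution by \<open>SOME\<close>; it may be far from
  minimal and have infinitely many generators in all. So existence must be shown, and the comparison
  with Koszul homology must hold for every resolution, one internal degree at a time. Isomorphisms,
  connecting maps included, are therefore linear relations between representatives, and quotients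
  are never formed.

  The constant \<open>ell n\<close> is the turning point of the binomials: for even n, C(n, i) and
  C(n, i + 2) agree at i = ell n, so there the last quadric acts bijectively, and the coefficient of
  t^(ell n + 2) in (1 + t)^n (1 - t^2) is zero. This zero is the centre of the antisymmetry, so the
  truncated series is exactly one half of the full one.

  One internal degree may meet both strands, in different homological degrees. The Euler
  characteristic only yields their alternating sum, so the strand j = 2 i must be known before
  \<open>rho\<close> can be isolated.\<close>

definition multichoose_series :: "nat \<Rightarrow> int fps" where
  "multichoose_series n = Abs_fps (\<lambda>k. int ((n + k - 1) choose (n - 1)))"

text \<open>The series is the Hilbert series of the polynomial ring in n variables. Multiplying by 1
  - X takes first differences of coefficients, and Pascal's rule lowers n by one.\<close>

lemma multichoose_series: "n \<ge> 1 \<Longrightarrow> multichoose_series n * (1 - fps_X) ^ n = 1"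
proof (induction n rule: nat_induct_at_least)
  case base
  show ?case
    by (rule fps_ext) (auto simp: multichoose_series_def algebra_simps)
next
  case (Suc n)
  have "multichoose_series (Suc n) * (1 - fps_X) = multichoose_series n"
  proof (rule fps_ext)
    fix k
    show "fps_nth (multichoose_series (Suc n) * (1 - fps_X)) k = fps_nth (multichoose_series n) k"
    proof (cases k)
      case 0
      then show ?thesis using Suc.hyps by (auto simp: multichoose_series_def right_diff_distrib)
    next
      case (Suc k')
      obtain n' where n': "n = Suc n'" using Suc.hyps by (cases n) auto
      have "(n + k choose n) = (n + k' choose n) + (n' + k choose n')"
        by (simp add: Suc n')
      then show ?thesis by (auto simp: multichoose_series_def right_diff_distrib Suc n')
    qed
  qed
  then show ?case using Suc.IH by (simp add: mult.assoc[symmetric])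
qed

lemma one_minus_fps_X_cancel:
  fixes A B :: "int fps"
  assumes "A * (1 - fps_X) ^ n = B * (1 - fps_X) ^ n"
  shows "A = B"
proof -
  have "fps_nth (1 - fps_X :: int fps) 0 \<noteq> fps_nth 0 0" by simp
  then have "(1 - fps_X :: int fps) \<noteq> 0" by metis
  then show ?thesis using assms by simp
qed

section \<open>Coefficients of powers of 1 + X, 1 - X and 1 - X^2\<close>

lemma fps_nth_one_plus_X_power: "fps_nth ((1 + fps_X) ^ n :: int fps) k = int (n choose k)"
proof (induction n arbitrary: k)
  case 0
  then show ?case by (cases k) auto
next
  case (Suc n)
  then show ?case by (cases k) (auto simp: distrib_right)
qed

lemma fps_nth_one_minus_X_power: "fps_nth ((1 - fps_X) ^ n :: int fps) k = (-1) ^ k * int (n choose k)"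
proof (induction n arbitrary: k)
  case 0
  then show ?case by (cases k) auto
next
  case (Suc n)
  then show ?case by (cases k) (auto simp: left_diff_distrib algebra_simps)
qed

lemma fps_nth_one_minus_X2_power:
  "fps_nth ((1 - fps_X ^ 2) ^ n :: int fps) k =
     (if even k then (-1) ^ (k div 2) * int (n choose (k div 2)) else 0)"
proof (induction n arbitrary: k)
  case 0
  then show ?case by (auto elim!: evenE)
next
  case (Suc n)
  consider "k = 0" | "k = 1" | l where "k = Suc (Suc l)" by (metis One_nat_def not0_implies_Suc)
  then show ?case
  proof cases
    case 3
    have *: "fps_nth ((1 - fps_X ^ 2) ^ Suc n :: int fps) k =
      fps_nth ((1 - fps_X ^ 2) ^ n) k - fps_nth ((1 - fps_X ^ 2) ^ n) l"
      unfolding power_Suc left_diff_distrib fps_sub_nth fps_X_power_mult_nth by (simp add: 3)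
    show ?thesis unfolding * unfolding Suc by (simp add: 3 algebra_simps)
  qed (auto simp: left_diff_distrib fps_X_power_mult_nth Suc)
qed

text \<open>The Hilbert function forced by the maximal rank condition.\<close>

definition hilb :: "nat \<Rightarrow> nat \<Rightarrow> int" where
  "hilb n m = (if m \<le> ell n + 1 then int (n choose m) - (if m < 2 then 0 else int (n choose (m - 2))) else 0)"

text \<open>The signed Betti numbers on the strand j = 2 i, indexed by the internal degree d =
  j.\<close>

definition betti_linear :: "nat \<Rightarrow> nat \<Rightarrow> int" where
  "betti_linear n d = (if even d \<and> d div 2 \<le> ell n then (-1) ^ (d div 2) * int ((n + 1) choose (d div 2)) else 0)"

text \<open>The K-polynomial of the predicted Betti table: the sum of (-1)^i times the Betti number
  at (i, j) times X^j. The shift by \<open>ell n + 1\<close> places \<open>rho n i\<close> in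
  internal degree i + ell n + 1.\<close>

definition K_poly :: "nat \<Rightarrow> int fps" where
  "K_poly n = Abs_fps (betti_linear n) +
     fps_X ^ (ell n + 1) * Abs_fps (\<lambda>k. (-1) ^ k * rho n k)"

lemma rho_0: "rho n 0 = 0" by (simp add: rho.simps)

lemma fps_nth_K_poly:
  "fps_nth (K_poly n) d = betti_linear n d +
     (if ell n + 1 \<le> d then (-1) ^ (d - ell n - 1) * rho n (d - ell n - 1) else 0)"
  unfolding K_poly_def fps_add_nth fps_X_power_mult_nth by auto

lemma sum_even_index:
  fixes g :: "nat \<Rightarrow> int"
  assumes "2 * l \<le> m"
  shows "(\<Sum>i=0..m. if even i \<and> i div 2 \<le> l then g i else 0) = (\<Sum>i\<le>l. g (2 * i))"
proof -
  have "(\<Sum>i=0..m. if even i \<and> i div 2 \<le> l then g i else 0) =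
     (\<Sum>i\<in>{i\<in>{0..m}. even i \<and> i div 2 \<le> l}. g i)"
    by (rule sum.inter_filter[symmetric]) simp
  also have "{i\<in>{0..m}. even i \<and> i div 2 \<le> l} = (*) 2 ` {..l}" using assms by auto
  also have "(\<Sum>i\<in>(*) 2 ` {..l}. g i) = (\<Sum>i\<le>l. g (2 * i))"
    by (subst sum.reindex) (auto simp: inj_on_def)
  finally show ?thesis .
qed

text \<open>The recursion defining \<open>rho\<close> says exactly that the coefficients of \<open>K / (1 - X)^n\<close> in
  degrees above \<open>ell n + 1\<close> vanish.\<close>

lemma K_poly_nth_high:
  assumes "n \<ge> 2" "even n" "k \<ge> 1"
  shows "fps_nth (K_poly n * multichoose_series n) (k + ell n + 1) = 0"
proof -
  let ?l = "ell n"
  let ?U = "multichoose_series n"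
  have n: "2 * ?l + 2 = n" using assms by (auto simp: ell_def elim!: evenE)
  have 1: "fps_nth (Abs_fps (betti_linear n) * ?U) (k + ?l + 1) =
     (\<Sum>i\<le>?l. (-1) ^ i * int ((n + 1) choose i) * int ((n + k + ?l - 2 * i) choose (n - 1)))"
  \<comment> \<open>If k + 1 < ell n, the recursion has terms with 2 i beyond the degree k + ell n +
    1, which do not occur in the product of series. Their binomial has upper entry below n - 1 and
    vanishes.\<close>
  proof (cases "2 * ?l \<le> k + ?l + 1")
    case True
    have "fps_nth (Abs_fps (betti_linear n) * ?U) (k + ?l + 1) =
      (\<Sum>i=0..k+?l+1. if even i \<and> i div 2 \<le> ?l then
         (-1) ^ (i div 2) * int ((n + 1) choose (i div 2)) * int ((n + (k + ?l + 1 - i) - 1) choose (n - 1)) else 0)"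
      by (simp only: fps_mult_nth betti_linear_def multichoose_series_def fps_nth_Abs_fps mult_delta_left)
    also have "\<dots> = (\<Sum>i\<le>?l. (-1) ^ i * int ((n + 1) choose i) * int ((n + (k + ?l + 1 - 2 * i) - 1) choose (n - 1)))"
      by (subst sum_even_index[OF True]) simp
    also have "\<dots> = (\<Sum>i\<le>?l. (-1) ^ i * int ((n + 1) choose i) * int ((n + k + ?l - 2 * i) choose (n - 1)))"
    proof (intro sum.cong refl)
      fix i assume "i \<in> {..?l}"
      then have e: "n + (k + ?l + 1 - 2 * i) - 1 = n + k + ?l - 2 * i" using True n by auto
      show "(-1) ^ i * int ((n + 1) choose i) * int ((n + (k + ?l + 1 - 2 * i) - 1) choose (n - 1)) =
         (-1) ^ i * int ((n + 1) choose i) * int ((n + k + ?l - 2 * i) choose (n - 1))"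
        unfolding e ..
    qed
    finally show ?thesis .
  next
    case False
    have "fps_nth (Abs_fps (betti_linear n) * ?U) (k + ?l + 1) =
      (\<Sum>i=0..k+?l+1. if even i \<and> i div 2 \<le> (k + ?l + 1) div 2 then
         (-1) ^ (i div 2) * int ((n + 1) choose (i div 2)) * int ((n + (k + ?l + 1 - i) - 1) choose (n - 1)) else 0)"
    proof -
      have "i div 2 \<le> ?l \<longleftrightarrow> i div 2 \<le> (k + ?l + 1) div 2" if "i \<in> {0..k + ?l + 1}" for i
        using False that by auto
      then show ?thesis
        by (simp only: fps_mult_nth betti_linear_def multichoose_series_def fps_nth_Abs_fps mult_delta_left
              cong: sum.cong conj_cong)
    qed
    also have "\<dots> = (\<Sum>i\<le>(k+?l+1) div 2. (-1) ^ i * int ((n + 1) choose i) * int ((n + (k + ?l + 1 - 2 * i) - 1) choose (n - 1)))"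
      by (subst sum_even_index) simp_all
    also have "\<dots> = (\<Sum>i\<le>(k+?l+1) div 2. (-1) ^ i * int ((n + 1) choose i) * int ((n + k + ?l - 2 * i) choose (n - 1)))"
    proof (intro sum.cong refl)
      fix i assume "i \<in> {..(k+?l+1) div 2}"
      then have e: "n + (k + ?l + 1 - 2 * i) - 1 = n + k + ?l - 2 * i" using n by auto
      show "(-1) ^ i * int ((n + 1) choose i) * int ((n + (k + ?l + 1 - 2 * i) - 1) choose (n - 1)) =
         (-1) ^ i * int ((n + 1) choose i) * int ((n + k + ?l - 2 * i) choose (n - 1))"
        unfolding e ..
    qed
    also have "\<dots> = (\<Sum>i\<le>?l. (-1) ^ i * int ((n + 1) choose i) * int ((n + k + ?l - 2 * i) choose (n - 1)))"
    proof (intro sum.mono_neutral_left ballI)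
      fix i assume "i \<in> {..?l} - {..(k+?l+1) div 2}"
      then have "n + k + ?l - 2 * i < n - 1" using n by auto
      then show "(-1) ^ i * int ((n + 1) choose i) * int ((n + k + ?l - 2 * i) choose (n - 1)) = 0"
        by (simp add: binomial_eq_0)
    qed (use False in auto)
    finally show ?thesis .
  qed
  have 2: "fps_nth (fps_X ^ (?l + 1) * Abs_fps (\<lambda>k. (-1) ^ k * rho n k) * ?U) (k + ?l + 1) =
      (\<Sum>i<k. (-1) ^ i * rho n i * int ((n + k - i - 1) choose (n - 1))) + (-1) ^ k * rho n k"
  proof -
    have "fps_nth (fps_X ^ (?l + 1) * Abs_fps (\<lambda>k. (-1) ^ k * rho n k) * ?U) (k + ?l + 1) =
       fps_nth (Abs_fps (\<lambda>k. (-1) ^ k * rho n k) * ?U) k"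
      by (simp only: mult.assoc fps_X_power_mult_nth) simp
    also have "\<dots> = (\<Sum>i\<le>k. (-1) ^ i * rho n i * int ((n + (k - i) - 1) choose (n - 1)))"
      by (simp add: fps_mult_nth multichoose_series_def atMost_atLeast0)
    also have "\<dots> = (\<Sum>i<k. (-1) ^ i * rho n i * int ((n + (k - i) - 1) choose (n - 1))) + (-1) ^ k * rho n k"
      by (simp add: lessThan_Suc_atMost[symmetric])
    also have "(\<Sum>i<k. (-1) ^ i * rho n i * int ((n + (k - i) - 1) choose (n - 1))) =
       (\<Sum>i<k. (-1) ^ i * rho n i * int ((n + k - i - 1) choose (n - 1)))"
    proof (intro sum.cong refl)
      fix i assume "i \<in> {..<k}"
      then have e: "n + (k - i) - 1 = n + k - i - 1" by auto
      show "(-1) ^ i * rho n i * int ((n + (k - i) - 1) choose (n - 1)) =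
         (-1) ^ i * rho n i * int ((n + k - i - 1) choose (n - 1))"
        unfolding e ..
    qed
    finally show ?thesis .
  qed
  have s: "(-1) ^ k * ((-1) ^ (i + k + 1) * (x::int)) = - ((-1) ^ i * x)" for i x
    by (auto simp: power_add)
  have "(-1) ^ k * rho n k = (-1) ^ k * (
     (\<Sum>i<k. (-1) ^ (i + k + 1) * (int ((n + k - i - 1) choose (n - 1)) * rho n i)) +
     (\<Sum>i\<le>?l. (-1) ^ (i + k + 1) * (int ((n + k + ?l - 2 * i) choose (n - 1)) * int ((n + 1) choose i))))"
    using assms(3) by (subst rho.simps) (simp add: mult.assoc)
  also have "\<dots> = - (\<Sum>i<k. (-1) ^ i * rho n i * int ((n + k - i - 1) choose (n - 1))) -
       (\<Sum>i\<le>?l. (-1) ^ i * int ((n + 1) choose i) * int ((n + k + ?l - 2 * i) choose (n - 1)))"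
    by (simp only: distrib_left sum_distrib_left s sum_negf) (simp add: mult_ac)
  finally show ?thesis
    using 1 2 by (simp add: K_poly_def distrib_right)
qed

text \<open>Divide by (1 - X)^n. Up to degree ell n + 1 the K-polynomial agrees with (1 - X^2)^(n +
  1), whose quotient is (1 + X)^n (1 - X^2); in higher degrees the quotient vanishes by the
  recursion for \<open>rho\<close>.\<close>

lemma K_poly_eq:
  assumes "n \<ge> 2" "even n"
  shows "K_poly n = Abs_fps (hilb n) * (1 - fps_X) ^ n"
proof -
  let ?l = "ell n"
  let ?U = "multichoose_series n"
  have U: "?U * (1 - fps_X) ^ n = 1" using multichoose_series assms(1) by simp
  have sq: "(1 - fps_X ^ 2 :: int fps) = (1 - fps_X) * (1 + fps_X)"
    by (simp add: algebra_simps power2_eq_square)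
  have "(1 - fps_X ^ 2) ^ (n + 1) * ?U = (1 - fps_X ^ 2) ^ n * (1 - fps_X ^ 2) * ?U" by simp
  also have "\<dots> = (?U * (1 - fps_X) ^ n) * (1 + fps_X) ^ n * (1 - fps_X ^ 2)"
    by (simp only: sq power_mult_distrib) (simp add: mult_ac)
  finally have G: "(1 - fps_X ^ 2) ^ (n + 1) * ?U = (1 + fps_X) ^ n * (1 - fps_X ^ 2)"
    using U by simp
  have "K_poly n * ?U = Abs_fps (hilb n)"
  proof (rule fps_ext)
    fix m
    show "fps_nth (K_poly n * ?U) m = fps_nth (Abs_fps (hilb n)) m"
    proof (cases "m \<le> ?l + 1")
      case True
      have "fps_nth (K_poly n) i = fps_nth ((1 - fps_X ^ 2) ^ (n + 1)) i" if "i \<le> m" for i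
      proof -
        \<comment> \<open>In the boundary degree i = ell n + 1 the second strand contributes
          \<open>rho n 0\<close>, which is 0.\<close>
        have "(-1) ^ (i - ?l - 1) * rho n (i - ?l - 1) = 0" if "?l + 1 \<le> i"
          using that True \<open>i \<le> m\<close> by (simp add: rho_0)
        then show ?thesis
          using True \<open>i \<le> m\<close> unfolding fps_nth_K_poly fps_nth_one_minus_X2_power betti_linear_def by auto
      qed
      then have "fps_nth (K_poly n * ?U) m = fps_nth ((1 - fps_X ^ 2) ^ (n + 1) * ?U) m"
        by (simp only: fps_mult_nth) (intro sum.cong, auto)
      also have "\<dots> = hilb n m"
        using True unfolding G
        by (simp add: right_diff_distrib fps_nth_one_plus_X_power fps_X_power_mult_right_nth hilb_def)
      finally show ?thesis by simp
    next
      case False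
      then obtain k where k: "k \<ge> 1" "m = k + ?l + 1"
        by (intro that[of "m - ?l - 1"]) auto
      show ?thesis using K_poly_nth_high[OF assms k(1)] False by (simp add: k(2) hilb_def)
    qed
  qed
  then show ?thesis using U by (metis mult.assoc mult.right_neutral)
qed

section \<open>Symmetries of the K-polynomial and of \<open>rho\<close>\<close>

lemma fps_nth_mult_one_minus_X_power:
  "fps_nth (A * (1 - fps_X) ^ n :: int fps) d =
    (\<Sum>i\<le>n. (-1) ^ i * int (n choose i) * (if i \<le> d then fps_nth A (d - i) else 0))"
proof -
  have "fps_nth (A * (1 - fps_X) ^ n) d = (\<Sum>i\<le>d. (-1) ^ i * int (n choose i) * fps_nth A (d - i))"
    by (subst mult.commute) (simp add: fps_mult_nth fps_nth_one_minus_X_power atMost_atLeast0)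
  also have "\<dots> = (\<Sum>i\<le>max n d. (-1) ^ i * int (n choose i) * (if i \<le> d then fps_nth A (d - i) else 0))"
    by (intro sum.mono_neutral_cong_left) auto
  also have "\<dots> = (\<Sum>i\<le>n. (-1) ^ i * int (n choose i) * (if i \<le> d then fps_nth A (d - i) else 0))"
    by (intro sum.mono_neutral_right) (auto simp: binomial_eq_0)
  finally show ?thesis .
qed

text \<open>Extension by zero to negative degrees, so that the reflection m \<mapsto> n + 2 - m and
  the shifts in the Euler characteristic avoid truncated subtraction.\<close>

definition hilbZ :: "nat \<Rightarrow> int \<Rightarrow> int" where
  "hilbZ n m = (if 0 \<le> m then hilb n (nat m) else 0)"

lemma K_poly_nth:
  assumes "n \<ge> 2" "even n"
  shows "fps_nth (K_poly n) d = (\<Sum>i\<le>n. (-1) ^ i * int (n choose i) * hilbZ n (int d - int i))"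
  unfolding K_poly_eq[OF assms] fps_nth_mult_one_minus_X_power
  by (intro sum.cong) (auto simp: hilbZ_def nat_diff_distrib)

text \<open>The coefficients of (1 + X)^n (1 - X^2) change sign under m \<mapsto> n + 2 - m. The
  fixed point m = ell n + 2 carries the coefficient 0, and \<open>hilb\<close> keeps precisely the
  degrees below it.\<close>

lemma hilbZ_antisym:
  assumes "n \<ge> 2" "even n"
  shows "int (n choose m) - (if m < 2 then 0 else int (n choose (m - 2))) =
     hilbZ n (int m) - hilbZ n (int n + 2 - int m)"
proof -
  let ?l = "ell n"
  have n: "2 * ?l + 2 = n" using assms by (auto simp: ell_def elim!: evenE)
  consider "m \<le> ?l + 1" | "m = ?l + 2" | "?l + 3 \<le> m" "m \<le> n + 2" | "n + 2 < m" by linarith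
  then show ?thesis
  proof cases
    case 1
    then have "\<not> nat (int n + 2 - int m) \<le> ?l + 1" using n by linarith
    then show ?thesis using 1 by (simp add: hilbZ_def hilb_def)
  next
    case 2
    have "n - ?l = ?l + 2" using n by linarith
    then have "(n choose ?l) = (n choose (?l + 2))"
      using binomial_symmetric[of ?l n] n by simp
    then show ?thesis using 2 n by (simp add: hilbZ_def hilb_def)
  next
    case 3
    have e: "nat (int n + 2 - int m) = n + 2 - m" using 3 by linarith
    have s1: "(n choose (n + 2 - m)) = (n choose (m - 2))"
    proof -
      have "m - 2 = n - (n + 2 - m)" using 3 by linarith
      moreover have "n + 2 - m \<le> n" using 3 by linarith
      ultimately show ?thesis using binomial_symmetric by metis
    qed
    have s2: "(if n + 2 - m < 2 then 0 else int (n choose (n + 2 - m - 2))) = int (n choose m)"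
    proof (cases "n < m")
      case True
      then show ?thesis by (auto simp: binomial_eq_0)
    next
      case False
      then have "n choose m = (n choose (n - m))" by (intro binomial_symmetric) auto
      moreover have "n + 2 - m - 2 = n - m" by simp
      ultimately show ?thesis using False by simp
    qed
    have "hilb n (n + 2 - m) = int (n choose (m - 2)) - int (n choose m)"
      using 3 n unfolding hilb_def s1 s2 by auto
    moreover have "hilb n m = 0" using 3 by (simp add: hilb_def)
    ultimately show ?thesis using 3 by (simp add: hilbZ_def e)
  next
    case 4
    then show ?thesis using n by (simp add: hilbZ_def hilb_def binomial_eq_0)
  qed
qed

text \<open>Multiply \<open>hilbZ_antisym\<close> by (1 - X)^n. This factor is palindromic of degree
  n because n is even, so the reflection in n + 2 becomes the reflection in 2 n + 2.\<close>

lemma K_poly_antisym: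
  assumes "n \<ge> 2" "even n" "d \<le> 2 * n + 2"
  shows "fps_nth (K_poly n) d - fps_nth (K_poly n) (2 * n + 2 - d) =
     fps_nth ((1 - fps_X ^ 2) ^ (n + 1)) d"
proof -
  have sq: "(1 - fps_X ^ 2 :: int fps) = (1 - fps_X) * (1 + fps_X)"
    by (simp add: algebra_simps power2_eq_square)
  have "(1 - fps_X ^ 2 :: int fps) ^ (n + 1) = (1 - fps_X ^ 2) ^ n * (1 - fps_X ^ 2)" by simp
  also have "\<dots> = ((1 + fps_X) ^ n * (1 - fps_X ^ 2)) * (1 - fps_X) ^ n"
    by (simp only: sq power_mult_distrib) (simp add: mult_ac)
  finally have G: "(1 - fps_X ^ 2) ^ (n + 1) = ((1 + fps_X) ^ n * (1 - fps_X ^ 2)) * (1 - fps_X :: int fps) ^ n" .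
  have g: "fps_nth ((1 + fps_X) ^ n * (1 - fps_X ^ 2)) m = hilbZ n (int m) - hilbZ n (int n + 2 - int m)" for m
    unfolding hilbZ_antisym[OF assms(1,2), symmetric]
    by (simp add: right_diff_distrib fps_nth_one_plus_X_power fps_X_power_mult_right_nth)
  \<comment> \<open>Disposes of the summands with i > d: there d - i is negative and its reflection
    exceeds n.\<close>
  have hneg: "hilbZ n m = 0" if "m < 0 \<or> m > int n" for m
    using that assms(1) by (auto simp: hilbZ_def hilb_def ell_def)
  have "fps_nth ((1 - fps_X ^ 2) ^ (n + 1)) d =
    (\<Sum>i\<le>n. (-1) ^ i * int (n choose i) * (hilbZ n (int d - int i) - hilbZ n (int n + 2 - (int d - int i))))"
    unfolding G fps_nth_mult_one_minus_X_power
    by (intro sum.cong refl) (auto simp: g of_nat_diff hneg)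
  also have "\<dots> = fps_nth (K_poly n) d - (\<Sum>i\<le>n. (-1) ^ i * int (n choose i) * hilbZ n (int n + 2 - (int d - int i)))"
    by (simp add: right_diff_distrib sum_subtractf K_poly_nth[OF assms(1,2)])
  also have "(\<Sum>i\<le>n. (-1) ^ i * int (n choose i) * hilbZ n (int n + 2 - (int d - int i))) =
     (\<Sum>i\<le>n. (-1) ^ (n - i) * int (n choose (n - i)) * hilbZ n (int n + 2 - (int d - int (n - i))))"
    by (rule sum.nat_diff_reindex[symmetric, of _ "Suc n", simplified lessThan_Suc_atMost, simplified])
  also have "\<dots> = (\<Sum>i\<le>n. (-1) ^ i * int (n choose i) * hilbZ n (int (2 * n + 2 - d) - int i))"
  proof (intro sum.cong refl)
    fix i assume "i \<in> {..n}"
    then have i: "i \<le> n" by simp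
    have "int n + 2 - (int d - int (n - i)) = int (2 * n + 2 - d) - int i"
      using i assms(3) by (simp add: of_nat_diff)
    moreover have "(-1::int) ^ (n - i) = (-1) ^ i"
      using i assms(2) by (simp add: minus_one_power_iff)
    moreover have "n choose (n - i) = n choose i" using i by (simp add: binomial_symmetric[symmetric])
    ultimately show "(-1) ^ (n - i) * int (n choose (n - i)) * hilbZ n (int n + 2 - (int d - int (n - i))) =
       (-1) ^ i * int (n choose i) * hilbZ n (int (2 * n + 2 - d) - int i)"
      by (simp only:)
  qed
  also have "\<dots> = fps_nth (K_poly n) (2 * n + 2 - d)"
    by (simp only: K_poly_nth[OF assms(1,2)])
  finally show ?thesis by simp
qed

text \<open>The Hilbert function stops at degree ell n + 1 and (1 - X)^n has degree n, so the
  K-polynomial has no coefficient beyond n + ell n + 1.\<close>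

lemma rho_eq_0:
  assumes "n \<ge> 2" "even n" "k > n"
  shows "rho n k = 0"
proof -
  have "fps_nth (K_poly n) (k + ell n + 1) = 0"
    unfolding K_poly_nth[OF assms(1,2)]
    by (intro sum.neutral) (use assms(3) in \<open>auto simp: hilbZ_def hilb_def\<close>)
  moreover have "betti_linear n (k + ell n + 1) = 0"
    using assms by (auto simp: betti_linear_def ell_def)
  ultimately show ?thesis unfolding fps_nth_K_poly by simp
qed

text \<open>The antisymmetry read on the strand: as n = 2 ell n + 2, reflecting k + ell n + 1 in 2 n
  + 2 gives (n + 2 - k) + ell n + 1, again a strand degree.\<close>

lemma rho_antisym:
  assumes "n \<ge> 2" "even n" "k \<le> n"
  shows "betti_linear n (k + ell n + 1) + (-1) ^ k * (rho n k - rho n (n + 2 - k)) =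
     betti_linear n (n + 2 - k + ell n + 1) + fps_nth ((1 - fps_X ^ 2) ^ (n + 1)) (k + ell n + 1)"
proof -
  have n: "2 * ell n + 2 = n" using assms by (auto simp: ell_def elim!: evenE)
  have e: "2 * n + 2 - (k + ell n + 1) = (n + 2 - k) + ell n + 1" using n assms(3) by linarith
  have "even (n + 2 - k) \<longleftrightarrow> even k" using assms by simp
  then have p: "(-1::int) ^ (n + 2 - k) = (-1) ^ k" by (simp add: minus_one_power_iff)
  have "k + ell n + 1 \<le> 2 * n + 2" using n assms(3) by linarith
  note K = K_poly_antisym[OF assms(1,2) this, unfolded e fps_nth_K_poly]
  define k' where "k' = n + 2 - k"
  show ?thesis using K p unfolding k'_def[symmetric] by (simp add: algebra_simps)
qed

text \<open>In degree k + ell n + 1, at most 2 ell n + 1, the strand j = 2 i already accounts for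
  the whole coefficient of (1 - X^2)^(n + 1). The reflected degree lies above 2 ell n, where that
  strand has ended.\<close>

lemma rho_sym:
  assumes "n \<ge> 2" "even n" "k \<le> ell n"
  shows "rho n k = rho n (n + 2 - k)"
proof -
  have n: "2 * ell n + 2 = n" using assms by (auto simp: ell_def elim!: evenE)
  have "betti_linear n (n + 2 - k + ell n + 1) = 0"
    using n assms(3) by (auto simp: betti_linear_def)
  moreover have "betti_linear n (k + ell n + 1) = fps_nth ((1 - fps_X ^ 2) ^ (n + 1)) (k + ell n + 1)"
  proof -
    have "(k + ell n + 1) div 2 \<le> ell n" if "even (k + ell n + 1)"
      using that assms(3) by (elim evenE) linarith
    then show ?thesis unfolding betti_linear_def fps_nth_one_minus_X2_power 
      by (cases "even (k + ell n + 1)") (simp_all only: if_True if_False simp_thms)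
  qed
  moreover have "k \<le> n" using n assms(3) by linarith
  ultimately show ?thesis using rho_antisym[OF assms(1,2), of k] by simp
qed

text \<open>Here the degree is 2 (ell n + 1), the first even one past the end of the strand j = 2 i.
  The coefficient of (1 - X^2)^(n + 1) is therefore left over as the binomial.\<close>

lemma rho_middle:
  assumes "n \<ge> 2" "even n"
  shows "rho n (ell n + 1) = rho n (ell n + 3) + int ((n + 1) choose (ell n + 1))"
proof -
  have n: "2 * ell n + 2 = n" using assms by (auto simp: ell_def elim!: evenE)
  have e: "n + 2 - (ell n + 1) = ell n + 3" "ell n + 1 + ell n + 1 = 2 * (ell n + 1)" using n by auto
  have "betti_linear n (ell n + 3 + ell n + 1) = 0" "betti_linear n (2 * (ell n + 1)) = 0"
    by (auto simp: betti_linear_def)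
  moreover have "fps_nth ((1 - fps_X ^ 2) ^ (n + 1) :: int fps) (2 * (ell n + 1)) = (-1) ^ (ell n + 1) * int ((n + 1) choose (ell n + 1))"
    unfolding fps_nth_one_minus_X2_power by simp
  moreover have "ell n + 1 \<le> n" using n by linarith
  ultimately have "(-1) ^ (ell n + 1) * (rho n (ell n + 1) - rho n (ell n + 3)) = (-1) ^ (ell n + 1) * int ((n + 1) choose (ell n + 1))"
    using rho_antisym[OF assms, of "ell n + 1"] unfolding e by simp
  then show ?thesis by simp
qed

text \<open>Neighbouring binomials have rational quotients, so with N = m + 1 everything is a
  rational multiple of c = C(2 N, N). The relations are kept free of denominators, and positivity of
  N + 1 and N + 2 permits cancelling at the end.\<close>

lemma central_binomial_diff:
  "rat_of_nat ((2 * m + 2) choose (m + 1)) - (if m = 0 then 0 else rat_of_nat ((2 * m + 2) choose (m - 1))) =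
    catalan (m + 2)"
proof -
  define N where "N = m + 1"
  define c where "c = rat_of_nat ((2 * N) choose N)"
  have 1: "(rat_of_nat N + 1) * rat_of_nat ((2 * N) choose m) = rat_of_nat N * c"
  proof -
    have "Suc m * ((2 * N) choose Suc m) = (2 * N - m) * ((2 * N) choose m)"
      by (simp only: binomial_absorption binomial_absorb_comp)
    moreover have "2 * N - m = N + 1" by (simp add: N_def)
    ultimately have "N * ((2 * N) choose N) = (N + 1) * ((2 * N) choose m)" by (simp add: N_def)
    then have "rat_of_nat (N * ((2 * N) choose N)) = rat_of_nat ((N + 1) * ((2 * N) choose m))" by (simp only:)
    then show ?thesis unfolding c_def of_nat_mult of_nat_add of_nat_1 by (simp only:)
  qed
  have 2: "(rat_of_nat N + 2) * (if m = 0 then 0 else rat_of_nat ((2 * N) choose (m - 1))) =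
     rat_of_nat m * rat_of_nat ((2 * N) choose m)"
  proof (cases m)
    case (Suc q)
    have "Suc q * ((2 * N) choose Suc q) = (2 * N - q) * ((2 * N) choose q)"
      by (simp only: binomial_absorption binomial_absorb_comp)
    moreover have "2 * N - q = N + 2" by (simp add: N_def Suc)
    ultimately have "m * ((2 * N) choose m) = (N + 2) * ((2 * N) choose (m - 1))" by (simp add: Suc)
    then have "rat_of_nat m * rat_of_nat ((2 * N) choose m) = rat_of_nat (N + 2) * rat_of_nat ((2 * N) choose (m - 1))"
      by (metis of_nat_mult)
    then show ?thesis using Suc by simp
  qed simp
  have 3: "(rat_of_nat N + 1) * rat_of_nat ((2 * N + 2) choose (N + 1)) = 2 * (2 * rat_of_nat N + 1) * c"
  proof -
    have a: "(2 * N + 2) choose (N + 1) = 2 * ((2 * N + 1) choose (N + 1))"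
      using binomial_symmetric[of N "2 * N + 1"] by simp
    have b: "(N + 1) * ((2 * N + 1) choose (N + 1)) = (2 * N + 1) * ((2 * N) choose N)"
      using Suc_times_binomial[of N "2 * N"] by (simp only: Suc_eq_plus1)
    have "(N + 1) * ((2 * N + 2) choose (N + 1)) = 2 * ((N + 1) * ((2 * N + 1) choose (N + 1)))"
      unfolding a by (simp only: mult.left_commute)
    also have "\<dots> = 2 * (2 * N + 1) * ((2 * N) choose N)" unfolding b by (simp only: mult.assoc)
    finally have "(N + 1) * ((2 * N + 2) choose (N + 1)) = 2 * (2 * N + 1) * ((2 * N) choose N)" .
    then have "rat_of_nat ((N + 1) * ((2 * N + 2) choose (N + 1))) = rat_of_nat (2 * (2 * N + 1) * ((2 * N) choose N))" by (simp only:)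
    then show ?thesis unfolding c_def of_nat_mult of_nat_add of_nat_1 of_nat_numeral by (simp only:)
  qed
  let ?x = "rat_of_nat ((2 * N) choose m)"
  let ?y = "(if m = 0 then 0 else rat_of_nat ((2 * N) choose (m - 1)))"
  let ?z = "rat_of_nat ((2 * N + 2) choose (N + 1))"
  have m: "rat_of_nat m = rat_of_nat N - 1" by (simp add: N_def)
  have pos: "rat_of_nat N + 1 > 0" "rat_of_nat N + 2 > 0" by (auto simp: add_nonneg_pos)
  have y: "(rat_of_nat N + 1) * (rat_of_nat N + 2) * ?y = (rat_of_nat N - 1) * (rat_of_nat N * c)"
  proof -
    have "(rat_of_nat N + 1) * ((rat_of_nat N + 2) * ?y) = (rat_of_nat N - 1) * ((rat_of_nat N + 1) * ?x)"
      unfolding 2 m by (simp only: mult.left_commute)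
    then show ?thesis unfolding 1 by (simp only: mult.assoc)
  qed
  have "(rat_of_nat N + 1) * ((rat_of_nat N + 2) * (c - ?y) - ?z) = 0"
    using y 3 by (simp only: right_diff_distrib mult.assoc) (simp add: algebra_simps)
  then have "(rat_of_nat N + 2) * (c - ?y) = ?z" using pos by simp
  then have cy: "c - ?y = 1 / (rat_of_nat N + 2) * ?z" using pos by (simp add: field_simps)
  have e: "2 * N + 2 = 2 * (m + 2)" "N + 1 = m + 2" "2 * N = 2 * m + 2" "N = m + 1"
    "rat_of_nat N + 2 = rat_of_nat (m + 2) + 1"
    by (simp_all add: N_def)
  show ?thesis using cy unfolding catalan_def c_def e(1,2,5) unfolding e(3) unfolding e(4) .
qed

text \<open>Only i = n reaches the top degree n + ell n + 1, so the last entry of the strand is the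
  last value of the Hilbert function, a difference of binomials next to the central one.\<close>

lemma rho_n_catalan:
  assumes "n \<ge> 2" "even n"
  shows "of_int (rho n n) = catalan (ell n + 2)"
proof -
  have n: "2 * ell n + 2 = n" using assms by (auto simp: ell_def elim!: evenE)
  have "fps_nth (K_poly n) (n + ell n + 1) = (\<Sum>i\<in>{n}. (-1) ^ i * int (n choose i) * hilbZ n (int (n + ell n + 1) - int i))"
    unfolding K_poly_nth[OF assms] by (intro sum.mono_neutral_right) (auto simp: hilbZ_def hilb_def)
  then have "fps_nth (K_poly n) (n + ell n + 1) = hilb n (ell n + 1)"
    using assms by (simp add: hilbZ_def nat_add_distrib)
  moreover have "betti_linear n (n + ell n + 1) = 0" using n by (auto simp: betti_linear_def)
  ultimately have "rho n n = hilb n (ell n + 1)" using assms unfolding fps_nth_K_poly by simp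
  also have "of_int \<dots> = catalan (ell n + 2)"
    unfolding central_binomial_diff[symmetric] hilb_def n by auto
  finally show ?thesis .
qed

section \<open>Dimensions of quotients of subspaces\<close>

text \<open>Gaussian elimination: an unknown p with nonzero entry in the last equation is eliminated
  from the others, and its value is then chosen so that the last equation holds.\<close>

lemma homogeneous_system_nontrivial:
  fixes M :: "'i \<Rightarrow> nat \<Rightarrow> 'a::field"
  assumes "finite I" "d < card I"
  shows "\<exists>c. (\<exists>i\<in>I. c i \<noteq> 0) \<and> (\<forall>j<d. (\<Sum>i\<in>I. c i * M i j) = 0)"
  using assms
proof (induction d arbitrary: I M)
  case 0
  then obtain i where "i \<in> I" by fastforce
  then show ?case by (intro exI[of _ "\<lambda>_. 1"]) auto
next
  case (Suc d)
  show ?case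
  proof (cases "\<forall>i\<in>I. M i d = 0")
    case True
    from Suc.prems obtain c where "\<exists>i\<in>I. c i \<noteq> 0" "\<forall>j<d. (\<Sum>i\<in>I. c i * M i j) = 0"
      using Suc.IH[of I M] by auto
    with True show ?thesis by (intro exI[of _ c]) (auto simp: less_Suc_eq)
  next
    case False
    then obtain p where p: "p \<in> I" "M p d \<noteq> 0" by auto
    define J where "J = I - {p}"
    have J: "finite J" "d < card J" "I = insert p J" "p \<notin> J"
      using Suc.prems p by (auto simp: J_def)
    obtain c where c: "\<exists>i\<in>J. c i \<noteq> 0" "\<And>j. j < d \<Longrightarrow> (\<Sum>i\<in>J. c i * (M i j - M i d / M p d * M p j)) = 0"
      using Suc.IH[OF J(1,2), of "\<lambda>i j. M i j - M i d / M p d * M p j"] by auto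
    define c' where "c' = c(p := - (\<Sum>i\<in>J. c i * M i d) / M p d)"
    have c'_sum: "(\<Sum>i\<in>I. c' i * M i j) =
        - (\<Sum>i\<in>J. c i * M i d) / M p d * M p j + (\<Sum>i\<in>J. c i * M i j)" for j
    proof -
      have "(\<Sum>i\<in>J. c' i * M i j) = (\<Sum>i\<in>J. c i * M i j)"
        using J(4) by (intro sum.cong) (auto simp: c'_def)
      then show ?thesis using J(1,4) by (simp add: J(3) c'_def)
    qed
    have "(\<Sum>i\<in>I. c' i * M i j) = 0" if "j < Suc d" for j
    proof (cases "j = d")
      case True
      then show ?thesis using p by (simp add: c'_sum)
    next
      case False
      then have "(\<Sum>i\<in>J. c i * (M i j - M i d / M p d * M p j)) = 0" using that c(2) by auto
      then have "(\<Sum>i\<in>J. c i * M i j) = (\<Sum>i\<in>J. c i * M i d * (M p j / M p d))"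
        by (simp add: algebra_simps sum_subtractf)
      then show ?thesis by (simp add: c'_sum sum_distrib_right sum_divide_distrib)
    qed
    moreover have "\<exists>i\<in>I. c' i \<noteq> 0" using c(1) J by (auto simp: c'_def)
    ultimately show ?thesis by blast
  qed
qed

text \<open>A basis of \<open>A\<close> modulo \<open>B\<close>; unlike a difference of dimensions this makes sense when \<open>A\<close> and \<open>B\<close>
  are infinite-dimensional, as happens for the syzygies of an arbitrary resolution.\<close>

definition qdim :: "('a::field \<Rightarrow> 'b::ab_group_add \<Rightarrow> 'b) \<Rightarrow> 'b set \<Rightarrow> 'b set \<Rightarrow> nat \<Rightarrow> bool" where
  "qdim sc A B d \<longleftrightarrow> (\<exists>g::nat \<Rightarrow> 'b. (\<forall>i<d. g i \<in> A) \<and>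
     (\<forall>a\<in>A. \<exists>c. a - (\<Sum>i<d. sc (c i) (g i)) \<in> B) \<and>
     (\<forall>c. (\<Sum>i<d. sc (c i) (g i)) \<in> B \<longrightarrow> (\<forall>i<d. c i = 0)))"

context vector_space
begin

lemma qdimI:
  fixes I :: "'i set" and g :: "'i \<Rightarrow> 'b"
  assumes "finite I" "card I = d" "\<And>i. i \<in> I \<Longrightarrow> g i \<in> A"
    "\<And>a. a \<in> A \<Longrightarrow> \<exists>c. a - (\<Sum>i\<in>I. c i *s g i) \<in> B"
    "\<And>c i. (\<Sum>i\<in>I. c i *s g i) \<in> B \<Longrightarrow> i \<in> I \<Longrightarrow> c i = 0"
  shows "qdim scale A B d"
proof -
  obtain f where f: "bij_betw f {..<d} I"
    using assms(1,2) ex_bij_betw_nat_finite[of I] by (auto simp: lessThan_atLeast0)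
  define h where "h = inv_into {..<d} f"
  have h: "h (f i) = i" if "i < d" for i
    using f that by (simp add: h_def bij_betw_inv_into_left)
  have fI: "f i \<in> I" if "i < d" for i using f that by (auto simp: bij_betw_def)
  have s: "(\<Sum>i\<in>I. c i *s g i) = (\<Sum>i<d. c (f i) *s g (f i))" for c
    by (rule sum.reindex_bij_betw[OF f, symmetric])
  show ?thesis unfolding qdim_def
  proof (intro exI[of _ "g \<circ> f"] conjI allI impI ballI)
    fix i assume "i < d" then show "(g \<circ> f) i \<in> A" using fI assms(3) by simp
  next
    fix a assume "a \<in> A"
    then obtain c where "a - (\<Sum>i\<in>I. c i *s g i) \<in> B" using assms(4) by blast
    then show "\<exists>c. a - (\<Sum>i<d. c i *s (g \<circ> f) i) \<in> B"
      by (intro exI[of _ "c \<circ> f"]) (simp add: s)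
  next
    fix c i assume c: "(\<Sum>i<d. c i *s (g \<circ> f) i) \<in> B" and i: "i < d"
    have "(\<Sum>i\<in>I. c (h i) *s g i) \<in> B" using c by (simp add: s h)
    from assms(5)[OF this fI[OF i]] show "c i = 0" by (simp add: h i)
  qed
qed

text \<open>Steinitz exchange modulo B: expressing the h in terms of the g modulo B, more than d of
  them would satisfy a nontrivial relation.\<close>

lemma independent_mod_le:
  assumes B: "subspace B" and g: "\<And>a. a \<in> A \<Longrightarrow> \<exists>c. a - (\<Sum>i<d::nat. c i *s g i) \<in> B"
    and h: "\<And>i. i < e \<Longrightarrow> h i \<in> A" "\<And>c. (\<Sum>i<e::nat. c i *s h i) \<in> B \<Longrightarrow> \<forall>i<e. c i = 0"
  shows "e \<le> d"
proof (rule ccontr)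
  assume "\<not> e \<le> d"
  then have de: "d < card {..<e}" by simp
  have "\<forall>i. \<exists>m. i < e \<longrightarrow> h i - (\<Sum>j<d. m j *s g j) \<in> B" using g h(1) by blast
  then obtain M where M: "\<And>i. i < e \<Longrightarrow> h i - (\<Sum>j<d. M i j *s g j) \<in> B" by metis
  obtain c where c: "\<exists>i\<in>{..<e}. c i \<noteq> 0" "\<forall>j<d. (\<Sum>i<e. c i * M i j) = 0"
    using homogeneous_system_nontrivial[OF _ de, of M] by auto
  have "(\<Sum>i<e. c i *s (h i - (\<Sum>j<d. M i j *s g j))) \<in> B"
    using M B by (intro subspace_sum subspace_scale) auto
  also have "(\<Sum>i<e. c i *s (h i - (\<Sum>j<d. M i j *s g j))) =
      (\<Sum>i<e. c i *s h i) - (\<Sum>i<e. \<Sum>j<d. (c i * M i j) *s g j)"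
    by (simp add: scale_right_diff_distrib sum_subtractf scale_sum_right)
  also have "(\<Sum>i<e. \<Sum>j<d. (c i * M i j) *s g j) = (\<Sum>j<d. (\<Sum>i<e. c i * M i j) *s g j)"
    by (subst sum.swap) (simp add: scale_sum_left)
  also have "\<dots> = 0" using c(2) by simp
  finally have "(\<Sum>i<e. c i *s h i) \<in> B" by simp
  with h(2) c(1) show False by blast
qed

lemma qdim_unique:
  assumes "subspace B" "qdim scale A B d" "qdim scale A B e"
  shows "d = e"
proof (rule order_antisym)
  have "e \<le> d" if q: "qdim scale A B d" "qdim scale A B e" for d e
  proof -
    obtain g where "\<And>a. a \<in> A \<Longrightarrow> \<exists>c. a - (\<Sum>i<d. c i *s g i) \<in> B"
      using q(1) unfolding qdim_def by blast
    moreover obtain h where "\<And>i. i < e \<Longrightarrow> h i \<in> A" "\<And>c. (\<Sum>i<e. c i *s h i) \<in> B \<Longrightarrow> \<forall>i<e. c i = 0"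
      using q(2) unfolding qdim_def by blast
    ultimately show ?thesis by (rule independent_mod_le[OF assms(1)])
  qed
  then show "d \<le> e" "e \<le> d" using assms by blast+
qed

text \<open>Among the families independent modulo B, of bounded length, take one of maximal length.
  A vector outside its span modulo B would extend it.\<close>

lemma qdim_exI:
  assumes B: "subspace B" and bd: "\<And>e g. (\<And>i. i < e \<Longrightarrow> g i \<in> C) \<Longrightarrow>
      (\<And>c. (\<Sum>i<e. c i *s g i) \<in> B \<Longrightarrow> \<forall>i<e. c i = 0) \<Longrightarrow> e \<le> (N::nat)"
  shows "\<exists>e. qdim scale C B e"
proof -
  define P where "P e \<longleftrightarrow> (\<exists>g::nat \<Rightarrow> 'b. (\<forall>i<e. g i \<in> C) \<and>
      (\<forall>c. (\<Sum>i<e. c i *s g i) \<in> B \<longrightarrow> (\<forall>i<e. c i = 0)))" for e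
  have P0: "P 0" by (simp add: P_def)
  have Pb: "e \<le> N" if "P e" for e using that bd unfolding P_def by blast
  obtain e where e: "P e" "\<And>e'. P e' \<Longrightarrow> e' \<le> e"
    using GreatestI_nat[of P 0 N] Greatest_le_nat[of P _ N] P0 Pb by blast
  then obtain g where g: "\<And>i. i < e \<Longrightarrow> g i \<in> C" "\<And>c. (\<Sum>i<e. c i *s g i) \<in> B \<Longrightarrow> \<forall>i<e. c i = 0"
    unfolding P_def by blast
  have "\<exists>c. a - (\<Sum>i<e. c i *s g i) \<in> B" if a: "a \<in> C" for a
  proof (rule ccontr)
    assume no: "\<nexists>c. a - (\<Sum>i<e. c i *s g i) \<in> B"
    have "P (Suc e)" unfolding P_def
    proof (intro exI[of _ "g(e := a)"] conjI allI impI)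
      show "(g(e := a)) i \<in> C" if "i < Suc e" for i using that a g(1) by (auto simp: less_Suc_eq)
    next
      fix c i assume c: "(\<Sum>i<Suc e. c i *s (g(e := a)) i) \<in> B" and i: "i < Suc e"
      have s: "(\<Sum>i<Suc e. c i *s (g(e := a)) i) = (\<Sum>i<e. c i *s g i) + c e *s a" by simp
      show "c i = 0"
      proof (cases "c e = 0")
        case True
        then show ?thesis using c i g(2)[of c] unfolding s by (auto simp: less_Suc_eq)
      next
        case False
        have "inverse (c e) *s ((\<Sum>i<e. c i *s g i) + c e *s a) \<in> B"
          using c B unfolding s by (intro subspace_scale)
        also have "inverse (c e) *s ((\<Sum>i<e. c i *s g i) + c e *s a) =
            a - (\<Sum>i<e. (- inverse (c e) * c i) *s g i)"
          using False by (simp add: scale_right_distrib scale_sum_right sum_negf)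
        finally have "\<exists>c. a - (\<Sum>i<e. c i *s g i) \<in> B"
          by (rule exI[of _ "\<lambda>i. - inverse (c e) * c i"])
        then show ?thesis using no by simp
      qed
    qed
    then show False using e(2) by fastforce
  qed
  then show ?thesis using g unfolding qdim_def by blast
qed

text \<open>Families in C independent modulo B, and families in A independent modulo C, are all
  families in A independent modulo B, so d bounds their lengths.\<close>

lemma qdim_split:
  assumes B: "subspace B" and C: "subspace C" and BC: "B \<subseteq> C" and CA: "C \<subseteq> A" and q: "qdim scale A B d"
  shows "\<exists>e1 e2. qdim scale C B e1 \<and> qdim scale A C e2"
proof -
  obtain g where g: "\<And>a. a \<in> A \<Longrightarrow> \<exists>c. a - (\<Sum>i<d. c i *s g i) \<in> B"
    using q unfolding qdim_def by blast
  have "\<exists>e. qdim scale C B e"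
  proof (rule qdim_exI[OF B])
    fix e :: nat and h assume h: "\<And>i. i < e \<Longrightarrow> h i \<in> C" "\<And>c. (\<Sum>i<e. c i *s h i) \<in> B \<Longrightarrow> \<forall>i<e. c i = 0"
    show "e \<le> d" by (rule independent_mod_le[OF B g, where h = h]) (use h CA in blast)+
  qed
  moreover have "\<exists>e. qdim scale A C e"
  proof (rule qdim_exI[OF C])
    fix e :: nat and h assume h: "\<And>i. i < e \<Longrightarrow> h i \<in> A" "\<And>c. (\<Sum>i<e. c i *s h i) \<in> C \<Longrightarrow> \<forall>i<e. c i = 0"
    show "e \<le> d" by (rule independent_mod_le[OF B g, where h = h]) (use h BC in blast)+
  qed
  ultimately show ?thesis by blast
qed

lemma qdim_0: "A \<subseteq> B \<Longrightarrow> qdim scale A B 0"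
  by (auto simp: qdim_def)

lemma qdim_0D: "qdim scale A B 0 \<Longrightarrow> A \<subseteq> B"
  by (auto simp: qdim_def)

lemma qdim_add:
  assumes B: "subspace B" and C: "subspace C" and BC: "B \<subseteq> C" and CA: "C \<subseteq> A"
    and "qdim scale C B d" "qdim scale A C e"
  shows "qdim scale A B (d + e)"
proof -
  obtain g where g: "\<And>i. i < d \<Longrightarrow> g i \<in> C" "\<And>a. a \<in> C \<Longrightarrow> \<exists>c. a - (\<Sum>i<d. c i *s g i) \<in> B"
     "\<And>c. (\<Sum>i<d. c i *s g i) \<in> B \<Longrightarrow> \<forall>i<d. c i = 0"
    using assms(5) unfolding qdim_def by blast
  obtain h where h: "\<And>i. i < e \<Longrightarrow> h i \<in> A" "\<And>a. a \<in> A \<Longrightarrow> \<exists>c. a - (\<Sum>i<e. c i *s h i) \<in> C"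
     "\<And>c. (\<Sum>i<e. c i *s h i) \<in> C \<Longrightarrow> \<forall>i<e. c i = 0"
    using assms(6) unfolding qdim_def by blast
  have s: "(\<Sum>i\<in>{..<d} <+> {..<e}. c i *s case_sum g h i) =
     (\<Sum>i<d. c (Inl i) *s g i) + (\<Sum>i<e. c (Inr i) *s h i)" for c
    by (simp add: sum.Plus)
  show ?thesis
  proof (rule qdimI[of "{..<d} <+> {..<e}" _ "case_sum g h"])
    show "finite ({..<d} <+> {..<e})" by simp
    show "card ({..<d} <+> {..<e}) = d + e" by (simp add: card_Plus)
    show "case_sum g h i \<in> A" if "i \<in> {..<d} <+> {..<e}" for i
      using that g(1) h(1) CA by auto
  next
    fix a assume "a \<in> A"
    then obtain c where c: "a - (\<Sum>i<e. c i *s h i) \<in> C" using h(2) by blast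
    then obtain c' where "a - (\<Sum>i<e. c i *s h i) - (\<Sum>i<d. c' i *s g i) \<in> B" using g(2) by blast
    then show "\<exists>c. a - (\<Sum>i\<in>{..<d} <+> {..<e}. c i *s case_sum g h i) \<in> B"
      unfolding s by (intro exI[of _ "case_sum c' c"]) (simp add: algebra_simps)
  next
    fix c i assume c: "(\<Sum>i\<in>{..<d} <+> {..<e}. c i *s case_sum g h i) \<in> B"
      and i: "i \<in> {..<d} <+> {..<e}"
    have "(\<Sum>i<d. c (Inl i) *s g i) \<in> C" using g(1) C by (auto intro!: subspace_sum subspace_scale)
    then have "(\<Sum>i<e. c (Inr i) *s h i) \<in> C"
      using c BC C unfolding s by (metis add_diff_cancel_left' subsetD subspace_diff)
    then have e0: "c (Inr i) = 0" if "i < e" for i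
      using h(3)[of "\<lambda>i. c (Inr i)"] that by blast
    then have "(\<Sum>i<d. c (Inl i) *s g i) \<in> B" using c unfolding s by simp
    then have "c (Inl i) = 0" if "i < d" for i using g(3)[of "\<lambda>i. c (Inl i)"] that by blast
    with e0 i show "c i = 0" by auto
  qed
qed

text \<open>Connects \<open>qdim\<close> with the difference of dimensions in
  \<open>tor_dim\<close>: extend a basis of B to one of A and keep the added vectors.\<close>

lemma qdim_dim:
  assumes A: "subspace A" and B: "subspace B" and "B \<subseteq> A" and "finite T" "A \<subseteq> span T"
  shows "qdim scale A B (dim A - dim B)"
proof -
  obtain Y where Y: "Y \<subseteq> B" "independent Y" "B \<subseteq> span Y"
    using maximal_independent_subset[of B] by blast
  have "Y \<subseteq> A" using Y(1) \<open>B \<subseteq> A\<close> by blast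
  then obtain Z where Z: "Y \<subseteq> Z" "Z \<subseteq> A" "independent Z" "A \<subseteq> span Z"
    using Y(2) maximal_independent_subset_extend[of Y A] by blast
  have fin: "finite Z" using independent_span_bound[OF assms(4) Z(3)] Z(2) assms(5) by blast
  have dims: "dim A = card Z" "dim B = card Y"
    using dim_unique Z Y by blast+
  have finY: "finite Y" using fin Z(1) finite_subset by blast
  have sp: "span Y = B" by (rule span_unique) (use Y B span_minimal in blast)+
  show ?thesis
  proof (rule qdimI[of "Z - Y" _ "\<lambda>z. z"])
    show "finite (Z - Y)" using fin by simp
    show "card (Z - Y) = dim A - dim B" using dims fin Z(1) finY by (simp add: card_Diff_subset)
    show "i \<in> A" if "i \<in> Z - Y" for i using that Z(2) by blast
  next
    fix a assume "a \<in> A"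
    then obtain c where a: "a = (\<Sum>z\<in>Z. c z *s z)"
      using Z(4) span_finite[OF fin] by auto
    have "a = (\<Sum>z\<in>Z - Y. c z *s z) + (\<Sum>z\<in>Y. c z *s z)"
      unfolding a by (rule sum.subset_diff[OF Z(1) fin])
    moreover have "(\<Sum>z\<in>Y. c z *s z) \<in> B"
      using Y(1) B by (auto intro!: subspace_sum subspace_scale)
    ultimately show "\<exists>c. a - (\<Sum>z\<in>Z - Y. c z *s z) \<in> B"
      by (intro exI[of _ c]) simp
  next
    fix c i assume c: "(\<Sum>z\<in>Z - Y. c z *s z) \<in> B" and i: "i \<in> Z - Y"
    then obtain b where b: "(\<Sum>z\<in>Z - Y. c z *s z) = (\<Sum>z\<in>Y. b z *s z)"
      using span_finite[OF finY] sp by auto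
    define u where "u z = (if z \<in> Y then - b z else c z)" for z
    have "(\<Sum>z\<in>Z. u z *s z) = (\<Sum>z\<in>Z - Y. u z *s z) + (\<Sum>z\<in>Y. u z *s z)"
      by (rule sum.subset_diff[OF Z(1) fin])
    also have "\<dots> = (\<Sum>z\<in>Z - Y. c z *s z) + (\<Sum>z\<in>Y. - (b z *s z))"
      by (intro arg_cong2[where f = "(+)"] sum.cong) (auto simp: u_def)
    also have "\<dots> = 0" by (simp add: b sum_negf)
    finally have "u i = 0"
      using Z(3) fin i independentD[of Z Z u i] by auto
    then show "c i = 0" using i by (simp add: u_def)
  qed
qed

end

text \<open>A linear relation that is total on both sides and matches B with D induces an
  isomorphism from A / B to C / D. Relations are the natural form for connecting homomorphisms,
  whose values depend on the choice of lifts.\<close>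

lemma (in vector_space_pair) qdim_transfer:
  assumes add: "\<And>a b c d. G a c \<Longrightarrow> G b d \<Longrightarrow> G (a + b) (c + d)"
    and scl: "\<And>r a c. G a c \<Longrightarrow> G (s1 r a) (s2 r c)"
    and l: "\<And>a. a \<in> A \<Longrightarrow> \<exists>c\<in>C. G a c" and r: "\<And>c. c \<in> C \<Longrightarrow> \<exists>a\<in>A. G a c"
    and z: "\<And>a c. a \<in> A \<Longrightarrow> c \<in> C \<Longrightarrow> G a c \<Longrightarrow> a \<in> B \<longleftrightarrow> c \<in> D"
    and A: "vs1.subspace A" and C: "vs2.subspace C" and q: "qdim s1 A B d"
  shows "qdim s2 C D d"
proof -
  obtain g where g: "\<And>i. i < d \<Longrightarrow> g i \<in> A" "\<And>a. a \<in> A \<Longrightarrow> \<exists>c. a - (\<Sum>i<d. s1 (c i) (g i)) \<in> B"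
     "\<And>c. (\<Sum>i<d. s1 (c i) (g i)) \<in> B \<Longrightarrow> \<forall>i<d. c i = 0"
    using q unfolding qdim_def by blast
  have "\<forall>i. \<exists>c. i < d \<longrightarrow> c \<in> C \<and> G (g i) c" using l g(1) by blast
  then obtain h where h: "\<And>i. i < d \<Longrightarrow> h i \<in> C \<and> G (g i) (h i)" by metis
  have G0: "G 0 0" using l[OF vs1.subspace_0[OF A]] scl[of _ _ 0] by fastforce
  have Gs: "G (\<Sum>i\<in>S. s1 (c i) (g i)) (\<Sum>i\<in>S. s2 (c i) (h i))" if "S \<subseteq> {..<d}" for c S
    using finite_subset[OF that finite_lessThan] that
    by (induction S rule: finite_induct) (auto intro!: G0 add scl simp: h)
  have sA: "(\<Sum>i<d. s1 (c i) (g i)) \<in> A" for c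
    using g(1) A by (auto intro!: vs1.subspace_sum vs1.subspace_scale)
  have sC: "(\<Sum>i<d. s2 (c i) (h i)) \<in> C" for c
    using h C by (auto intro!: vs2.subspace_sum vs2.subspace_scale)
  show ?thesis unfolding qdim_def
  proof (intro exI[of _ h] conjI allI impI ballI)
    fix x assume x: "x \<in> C"
    then obtain a where a: "a \<in> A" "G a x" using r by blast
    then obtain c where c: "a - (\<Sum>i<d. s1 (c i) (g i)) \<in> B" using g(2) by blast
    have "G (a + s1 (-1) (\<Sum>i<d. s1 (c i) (g i))) (x + s2 (-1) (\<Sum>i<d. s2 (c i) (h i)))"
      by (intro add scl Gs a) auto
    then have "G (a - (\<Sum>i<d. s1 (c i) (g i))) (x - (\<Sum>i<d. s2 (c i) (h i)))" by simp
    then show "\<exists>c. x - (\<Sum>i<d. s2 (c i) (h i)) \<in> D"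
      using z c vs1.subspace_diff[OF A a(1) sA] vs2.subspace_diff[OF C x sC] by blast
  next
    fix c i assume c: "(\<Sum>i<d. s2 (c i) (h i)) \<in> D" and "i < d"
    moreover have "(\<Sum>i<d. s1 (c i) (g i)) \<in> B" using z[OF sA sC Gs] c by simp
    ultimately show "c i = 0" using g(3) by blast
  qed (use h in auto)
qed

section \<open>Polynomials and graded modules over them\<close>

abbreviation "lookup \<equiv> Poly_Mapping.lookup"
abbreviation "single \<equiv> Poly_Mapping.single"
abbreviation "keys \<equiv> Poly_Mapping.keys"

lemma lookup_single_mult:
  fixes p :: "'a::cancel_comm_monoid_add \<Rightarrow>\<^sub>0 'b::semiring_0"
  shows "lookup (single k c * p) (k + m) = c * lookup p m"
    and "(\<And>q. m' \<noteq> k + q) \<Longrightarrow> lookup (single k c * p) m' = 0"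
proof -
  have *: "lookup (single k c * p) m' =
      c * (\<Sum>q. lookup p q when m' = k + q)" for m'
    by (simp add: lookup_mult lookup_single when_mult)
  show "lookup (single k c * p) (k + m) = c * lookup p m"
    unfolding * by simp
  show "lookup (single k c * p) m' = 0" if "\<And>q. m' \<noteq> k + q"
    unfolding * using that by simp
qed

lemma monom_deg_0 [simp]: "monom_deg 0 = 0"
  by (simp add: monom_deg_def)

lemma monom_deg_add: "monom_deg (a + b) = monom_deg a + monom_deg b"
  by (simp add: monom_deg_def lookup_add sum.distrib)

lemma monom_deg_single [simp]: "monom_deg (single s e) = e"
proof -
  have "monom_deg (single s e) = (\<Sum>i\<in>{s}. lookup (single s e) i)"
    unfolding monom_deg_def by (rule sum.mono_neutral_right) (auto simp: lookup_single)
  then show ?thesis by simp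
qed

lemma monom_deg_eq_0_iff: "monom_deg m = 0 \<longleftrightarrow> m = 0"
  by (auto simp: monom_deg_def poly_mapping_eq_iff fun_eq_iff)

lemma homog_part_0 [simp]: "0 \<in> homog_part d"
  by (simp add: homog_part_def)

lemma homog_part_add: "p \<in> homog_part d \<Longrightarrow> q \<in> homog_part d \<Longrightarrow> p + q \<in> homog_part d"
  unfolding homog_part_def using keys_add[of p q] by auto

lemma homog_part_uminus: "p \<in> homog_part d \<Longrightarrow> - p \<in> homog_part d"
  unfolding homog_part_def by (auto simp: in_keys_iff)

lemma homog_part_mult: "p \<in> homog_part d \<Longrightarrow> q \<in> homog_part e \<Longrightarrow> p * q \<in> homog_part (d + e)"
  unfolding homog_part_def using keys_mult[of p q] by (force simp: monom_deg_add)

lemma homog_part_single: "int (monom_deg m) = d \<Longrightarrow> single m c \<in> homog_part d"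
  by (simp add: homog_part_def)

lemma homog_part_const [simp]: "single 0 c \<in> homog_part 0"
  by (simp add: homog_part_single)

lemma homog_part_one [simp]: "1 \<in> homog_part 0"
  using homog_part_const[of 1] by simp

lemma homog_part_neg: "d < 0 \<Longrightarrow> homog_part d = {0}"
  by (force simp: homog_part_def)

lemma homog_part_sum: "(\<And>i. i \<in> I \<Longrightarrow> p i \<in> homog_part d) \<Longrightarrow> (\<Sum>i\<in>I. p i) \<in> homog_part d"
  by (induction I rule: infinite_finite_induct) (auto intro: homog_part_add)

section \<open>Homogeneous components of polynomials\<close>

lift_definition hcomp :: "int \<Rightarrow> ('n::finite, 'k::field) mpoly \<Rightarrow> ('n, 'k) mpoly"
  is "\<lambda>d p m. p m when int (monom_deg m) = d"
  by simp

lemma lookup_hcomp: "lookup (hcomp d p) m = (lookup p m when int (monom_deg m) = d)"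
  by transfer simp

lemma hcomp_in: "hcomp d p \<in> homog_part d"
  by (auto simp: homog_part_def in_keys_iff lookup_hcomp when_def split: if_splits)

lemma hcomp_add: "hcomp d (p + q) = hcomp d p + hcomp d q"
  by (rule poly_mapping_eqI) (simp add: lookup_hcomp lookup_add when_add_distrib)

lemma hcomp_0 [simp]: "hcomp d 0 = 0"
  by (rule poly_mapping_eqI) (simp add: lookup_hcomp)

lemma hcomp_sum: "hcomp d (\<Sum>i\<in>I. p i) = (\<Sum>i\<in>I. hcomp d (p i))"
  by (induction I rule: infinite_finite_induct) (auto simp: hcomp_add)

lemma hcomp_homog: "p \<in> homog_part e \<Longrightarrow> hcomp d p = (if d = e then p else 0)"
  by (rule poly_mapping_eqI) (auto simp: homog_part_def in_keys_iff lookup_hcomp when_def)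

lemma hcomp_decomp:
  assumes "finite D" "\<And>m. m \<in> keys p \<Longrightarrow> int (monom_deg m) \<in> D"
  shows "p = (\<Sum>d\<in>D. hcomp d p)"
proof (rule poly_mapping_eqI)
  fix m
  have "(\<Sum>d\<in>D. lookup p m when int (monom_deg m) = d) =
     (if int (monom_deg m) \<in> D then lookup p m else 0)"
    using assms(1) by (simp add: when_def)
  then show "lookup p m = lookup (\<Sum>d\<in>D. hcomp d p) m"
    using assms(2)[of m] by (auto simp: lookup_sum lookup_hcomp in_keys_iff)
qed

lemma hcomp_mult_homog:
  assumes f: "f \<in> homog_part e"
  shows "hcomp d (p * f) = hcomp (d - e) p * f"
proof -
  define D where "D = insert (d - e) ((\<lambda>m. int (monom_deg m)) ` keys p)"
  have D: "finite D" by (simp add: D_def)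
  have p: "p = (\<Sum>c\<in>D. hcomp c p)" by (rule hcomp_decomp[OF D]) (simp add: D_def)
  have "hcomp d (p * f) = (\<Sum>c\<in>D. hcomp d (hcomp c p * f))"
    by (subst p) (simp only: sum_distrib_right hcomp_sum)
  also have "\<dots> = (\<Sum>c\<in>D. if c = d - e then hcomp c p * f else 0)"
    by (intro sum.cong refl) (auto simp: hcomp_homog[OF homog_part_mult[OF hcomp_in f]])
  also have "\<dots> = hcomp (d - e) p * f"
    using D by (simp add: D_def)
  finally show ?thesis .
qed

definition var :: "'n \<Rightarrow> ('n::finite, 'k::field) mpoly" where
  "var s = single (single s 1) 1"

lemma var_homog: "var s \<in> homog_part 1"
  by (simp add: var_def homog_part_single)

lemma lookup_vec_scale [simp]: "lookup (vec_scale c v) b = c * lookup v b"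
  by (simp add: vec_scale_def Poly_Mapping.map.rep_eq when_def)

lemma module_mult: "Modules.module ((*) :: 'a::comm_ring_1 \<Rightarrow> 'a \<Rightarrow> 'a)"
  by unfold_locales (simp_all add: algebra_simps)

lemma module_vec_scale: "Modules.module (vec_scale :: 'a::comm_ring_1 \<Rightarrow> (nat \<Rightarrow>\<^sub>0 'a) \<Rightarrow> _)"
  by unfold_locales (auto intro!: poly_mapping_eqI simp: lookup_add algebra_simps)

locale poly_module = Modules.module sm
  for sm :: "('n::finite, 'k::field) mpoly \<Rightarrow> 'v::ab_group_add \<Rightarrow> 'v"
begin

text \<open>A graded submodule is represented by its family of pieces, since every homological
  argument stays within one internal degree.\<close>

definition gmod :: "(int \<Rightarrow> 'v set) \<Rightarrow> bool" where
  "gmod A \<longleftrightarrow> (\<forall>d. 0 \<in> A d) \<and> (\<forall>d. \<forall>a\<in>A d. \<forall>b\<in>A d. a + b \<in> A d) \<and>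
     (\<forall>d e. \<forall>p\<in>homog_part e. \<forall>a\<in>A d. sm p a \<in> A (d + e))"

lemma gmod_0: "gmod A \<Longrightarrow> 0 \<in> A d"
  and gmod_add: "gmod A \<Longrightarrow> a \<in> A d \<Longrightarrow> b \<in> A d \<Longrightarrow> a + b \<in> A d"
  and gmod_sm: "gmod A \<Longrightarrow> p \<in> homog_part e \<Longrightarrow> a \<in> A d \<Longrightarrow> d' = d + e \<Longrightarrow> sm p a \<in> A d'"
  by (auto simp: gmod_def)

lemma gmod_uminus: "gmod A \<Longrightarrow> a \<in> A d \<Longrightarrow> - a \<in> A d"
  using gmod_sm[of A "- 1" 0 a d d] by (simp add: homog_part_uminus)

lemma gmod_diff: "gmod A \<Longrightarrow> a \<in> A d \<Longrightarrow> b \<in> A d \<Longrightarrow> a - b \<in> A d"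
  using gmod_add[of A a d "- b"] by (simp add: gmod_uminus)

lemma gmod_sum: "gmod A \<Longrightarrow> (\<And>i. i \<in> I \<Longrightarrow> a i \<in> A d) \<Longrightarrow> (\<Sum>i\<in>I. a i) \<in> A d"
  by (induction I rule: infinite_finite_induct) (auto intro: gmod_add gmod_0)

lemma gmod_zero: "gmod (\<lambda>_. {0})"
  by (auto simp: gmod_def)

sublocale kspace: vector_space "\<lambda>c. sm (single 0 c)"
  by unfold_locales (simp_all add: scale_right_distrib scale_left_distrib single_add mult_single)

lemma gmod_subspace: "gmod A \<Longrightarrow> kspace.subspace (A d)"
  by (auto simp: kspace.subspace_def gmod_0 gmod_add intro: gmod_sm[where e = 0])

end

section \<open>Koszul complexes\<close>

text \<open>The Koszul signs require an order on the variables; an arbitrary injection into the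
  naturals supplies it.\<close>

definition var_rank :: "'n::finite \<Rightarrow> nat" where
  "var_rank = (SOME f. inj f)"

lemma inj_var_rank: "inj (var_rank :: 'n::finite \<Rightarrow> nat)"
proof -
  obtain f :: "'n \<Rightarrow> nat" where "inj f"
    using finite_imp_inj_to_nat_seg[OF finite[of "UNIV :: 'n set"]] by auto
  then show ?thesis unfolding var_rank_def by (metis someI_ex)
qed

lemma var_rank_less_linear: "(s::'n::finite) \<noteq> t \<Longrightarrow> var_rank s < var_rank t \<or> var_rank t < var_rank s"
  by (metis injD inj_var_rank nat_neq_iff)

text \<open>The sign of moving the exterior generator of s from the front into its place in the
  ordered product over S.\<close>

definition ksgn :: "'n::finite set \<Rightarrow> 'n \<Rightarrow> ('n, 'k::field) mpoly" where
  "ksgn S s = (-1) ^ card {t \<in> S. var_rank t < var_rank s}"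

lemma ksgn_square [simp]: "ksgn S s * ksgn S s = 1"
  by (simp add: ksgn_def flip: power_mult_distrib)

lemma ksgn_homog: "ksgn S s \<in> homog_part 0"
  unfolding ksgn_def by (auto simp: minus_one_power_iff homog_part_uminus)

lemma ksgn_insert:
  fixes s t :: "'n::finite"
  assumes "s \<notin> S"
  shows "(ksgn (insert s S) t :: ('n, 'k::field) mpoly) = (if var_rank s < var_rank t then - ksgn S t else ksgn S t)"
proof (cases "var_rank s < var_rank t")
  case True
  then have "{u \<in> insert s S. var_rank u < var_rank t} = insert s {u \<in> S. var_rank u < var_rank t}" by auto
  then show ?thesis using True assms by (simp add: ksgn_def)
next
  case False
  then have "{u \<in> insert s S. var_rank u < var_rank t} = {u \<in> S. var_rank u < var_rank t}" by auto
  then show ?thesis using False by (simp add: ksgn_def)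
qed

text \<open>Exactly one of s and t precedes the other, so exactly one of the two insertions changes
  the sign of the other factor.\<close>

lemma ksgn_anticommute:
  fixes s t :: "'n::finite"
  assumes "s \<noteq> t" "s \<notin> S" "t \<notin> S"
  shows "ksgn S s * ksgn (insert s S) t = - (ksgn S t * ksgn (insert t S) s :: ('n, 'k::field) mpoly)"
  using var_rank_less_linear[OF assms(1)] assms by (auto simp: ksgn_insert mult_ac)

text \<open>A Koszul chain assigns to a set \<open>S\<close> of variables the coefficient of the exterior product of its
  members, ordered by \<open>var_rank\<close>.\<close>

definition kdiff :: "(('n::finite, 'k::field) mpoly \<Rightarrow> 'v \<Rightarrow> 'v::ab_group_add) \<Rightarrow> ('n set \<Rightarrow> 'v) \<Rightarrow> 'n set \<Rightarrow> 'v" where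
  "kdiff sm c S = (\<Sum>s\<in>- S. sm (ksgn S s * var s) (c (insert s S)))"

text \<open>Exterior multiplication from the left by the generator belonging to s.\<close>

definition kext :: "(('n::finite, 'k::field) mpoly \<Rightarrow> 'v \<Rightarrow> 'v::ab_group_add) \<Rightarrow> 'n \<Rightarrow> ('n set \<Rightarrow> 'v) \<Rightarrow> 'n set \<Rightarrow> 'v" where
  "kext sm s c S = (if s \<in> S then sm (ksgn (S - {s}) s) (c (S - {s})) else 0)"

definition chain_mult :: "('p \<Rightarrow> 'v \<Rightarrow> 'w) \<Rightarrow> 'p \<Rightarrow> ('s \<Rightarrow> 'v) \<Rightarrow> 's \<Rightarrow> 'w" where
  "chain_mult sm p c S = sm p (c S)"

text \<open>Each exterior generator has internal degree 1, hence coefficients of degree j - a.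
  Integer degrees make homological degrees such as -1 legitimate; their chains are zero.\<close>

definition kchains :: "(int \<Rightarrow> 'v::zero set) \<Rightarrow> int \<Rightarrow> int \<Rightarrow> ('n::finite set \<Rightarrow> 'v) set" where
  "kchains A a j = {c. \<forall>S. if int (card S) = a then c S \<in> A (j - a) else c S = 0}"

text \<open>Cycles and boundaries of homological degree \<open>a\<close> and internal degree \<open>j\<close> of the Koszul complex of the quotient \<open>A / B\<close>.\<close>

definition koszul_cycles where
  "koszul_cycles sm A B a j = {c \<in> kchains A a j. kdiff sm c \<in> kchains B (a - 1) j}"

definition koszul_boundaries where
  "koszul_boundaries sm A B a j = {c \<in> kchains A a j. \<exists>b\<in>kchains A (a + 1) j. c - kdiff sm b \<in> kchains B a j}"

abbreviation chain_scale :: "(('n::finite, 'k::field) mpoly \<Rightarrow> 'v \<Rightarrow> 'v) \<Rightarrow> 'k \<Rightarrow> ('n set \<Rightarrow> 'v) \<Rightarrow> 'n set \<Rightarrow> 'v" where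
  "chain_scale sm r \<equiv> chain_mult sm (single 0 r)"

abbreviation koszul_dim where
  "koszul_dim sm A B a j \<equiv> qdim (chain_scale sm) (koszul_cycles sm A B a j) (koszul_boundaries sm A B a j)"

text \<open>The terms are paired by \<open>var_rank\<close>. Merely swapping s and t in the whole
  sum would show that twice the sum vanishes, which says nothing in characteristic 2.\<close>

lemma sum_antisymmetric:
  fixes a :: "'n::finite \<Rightarrow> 'n \<Rightarrow> 'v::ab_group_add"
  assumes "\<And>s t. (s, t) \<in> P \<Longrightarrow> (t, s) \<in> P \<and> s \<noteq> t \<and> a s t = - a t s"
  shows "(\<Sum>(s, t)\<in>P. a s t) = 0"
proof -
  let ?L = "{(s, t) \<in> P. var_rank s < var_rank t}" and ?G = "{(s, t) \<in> P. var_rank t < var_rank s}"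
  have P: "P = ?L \<union> ?G" using assms var_rank_less_linear by fastforce
  have G: "(\<Sum>(s, t)\<in>?G. a s t) = (\<Sum>(s, t)\<in>?L. a t s)"
    by (rule sum.reindex_bij_witness[of _ "\<lambda>(s, t). (t, s)" "\<lambda>(s, t). (t, s)"]) (use assms in auto)
  have "(\<Sum>(s, t)\<in>P. a s t) = (\<Sum>(s, t)\<in>?L. a s t) + (\<Sum>(s, t)\<in>?G. a s t)"
    by (subst P, rule sum.union_disjoint) auto
  also have "\<dots> = (\<Sum>(s, t)\<in>?L. a s t + a t s)" unfolding G by (simp add: sum.distrib split_def)
  also have "\<dots> = 0" 
  proof (rule sum.neutral, clarify)
    fix s t assume "(s, t) \<in> P"
    then have "a s t = - a t s" using assms by blast
    then show "a s t + a t s = 0" by (simp only: eq_neg_iff_add_eq_0)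
  qed
  finally show ?thesis .
qed

context poly_module
begin

lemma kdiff_add: "kdiff sm (c + d) = kdiff sm c + kdiff sm d"
  by (rule ext) (simp add: kdiff_def scale_right_distrib sum.distrib)

lemma kdiff_diff: "kdiff sm (c - d) = kdiff sm c - kdiff sm d"
  by (rule ext) (simp add: kdiff_def scale_right_diff_distrib sum_subtractf)

lemma kdiff_0 [simp]: "kdiff sm 0 = 0"
  by (rule ext) (simp add: kdiff_def)

lemma chain_mult_add: "chain_mult sm p (c + d) = chain_mult sm p c + chain_mult sm p d"
  by (rule ext) (simp add: chain_mult_def scale_right_distrib)

lemma chain_mult_diff: "chain_mult sm p (c - d) = chain_mult sm p c - chain_mult sm p d"
  by (rule ext) (simp add: chain_mult_def scale_right_diff_distrib)

lemma kdiff_chain_mult: "kdiff sm (chain_mult sm p c) = chain_mult sm p (kdiff sm c)"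
  by (rule ext) (simp add: kdiff_def chain_mult_def scale_sum_right mult_ac)

lemma kdiff_kdiff: "kdiff sm (kdiff sm c) = 0"
proof
  fix S :: "'n set"
  let ?P = "Sigma (- S) (\<lambda>s. - insert s S)"
  let ?a = "\<lambda>s t. sm (ksgn S s * ksgn (insert s S) t * (var s * var t)) (c (insert s (insert t S)))"
  have "kdiff sm (kdiff sm c) S = (\<Sum>s\<in>- S. \<Sum>t\<in>- insert s S. ?a s t)"
    by (simp add: kdiff_def scale_sum_right mult_ac insert_commute)
  also have "\<dots> = (\<Sum>(s, t)\<in>?P. ?a s t)" by (rule sum.Sigma) auto
  also have "\<dots> = 0"
  proof (rule sum_antisymmetric)
    fix s t assume "(s, t) \<in> ?P"
    then have st: "s \<noteq> t" "s \<notin> S" "t \<notin> S" by auto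
    have "?a s t = - ?a t s"
      unfolding ksgn_anticommute[OF st] by (simp add: insert_commute mult.commute)
    then show "(t, s) \<in> ?P \<and> s \<noteq> t \<and> ?a s t = - ?a t s" using st by auto
  qed
  finally show "kdiff sm (kdiff sm c) S = 0 S" by simp
qed

text \<open>Exterior multiplication by s is a homotopy from 0 to multiplication by the variable;
  this is why variables act as zero on Koszul homology. One term gives the variable, the others
  cancel by the signs.\<close>

lemma kdiff_kext: "kdiff sm (kext sm s c) S + kext sm s (kdiff sm c) S = sm (var s) (c S)"
proof (cases "s \<in> S")
  case False
  have "kdiff sm (kext sm s c) S = (\<Sum>t\<in>{s}. sm (ksgn S t * var t) (kext sm s c (insert t S)))"
    unfolding kdiff_def using False by (intro sum.mono_neutral_right) (auto simp: kext_def)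
  also have "\<dots> = sm ((ksgn S s * ksgn S s) * var s) (c S)"
    using False by (simp add: kext_def mult_ac)
  finally show ?thesis using False by (simp add: kext_def)
next
  case True
  define T where "T = S - {s}"
  have T: "S = insert s T" "s \<notin> T" using True by (auto simp: T_def)
  have "kext sm s (kdiff sm c) S = (\<Sum>t\<in>- T. sm (ksgn T s * (ksgn T t * var t)) (c (insert t T)))"
    using T by (simp add: kext_def kdiff_def scale_sum_right)
  also have "- T = insert s (- S)" using T by auto
  also have "(\<Sum>t\<in>insert s (- S). sm (ksgn T s * (ksgn T t * var t)) (c (insert t T))) =
      sm (ksgn T s * ksgn T s * var s) (c S) + (\<Sum>t\<in>- S. sm (ksgn T s * (ksgn T t * var t)) (c (insert t T)))"
    using True by (simp add: T mult.assoc del: ksgn_square)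
  finally have 1: "kext sm s (kdiff sm c) S =
      sm (var s) (c S) + (\<Sum>t\<in>- S. sm (ksgn T s * (ksgn T t * var t)) (c (insert t T)))" by simp
  have "kdiff sm (kext sm s c) S = (\<Sum>t\<in>- S. sm (ksgn S t * var t * ksgn (insert t T) s) (c (insert t T)))"
    unfolding kdiff_def
  proof (intro sum.cong refl)
    fix t assume "t \<in> - S"
    then have "s \<in> insert t S" "insert t S - {s} = insert t T" using T by auto
    then show "sm (ksgn S t * var t) (kext sm s c (insert t S)) =
        sm (ksgn S t * var t * ksgn (insert t T) s) (c (insert t T))"
      by (simp add: kext_def)
  qed
  also have "\<dots> = (\<Sum>t\<in>- S. - sm (ksgn T s * (ksgn T t * var t)) (c (insert t T)))"
  proof (intro sum.cong refl)
    fix t assume "t \<in> - S"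
    then have t: "s \<noteq> t" "t \<notin> T" using T by auto
    have "ksgn S t * ksgn (insert t T) s = - (ksgn T s * ksgn T t :: ('n, 'k) mpoly)"
      using var_rank_less_linear[OF t(1)] t T by (auto simp: ksgn_insert mult_ac)
    then have "ksgn S t * var t * ksgn (insert t T) s = - (ksgn T s * (ksgn T t * var t) :: ('n, 'k) mpoly)"
      by (metis (no_types, lifting) minus_mult_left mult.assoc mult.commute)
    then show "sm (ksgn S t * var t * ksgn (insert t T) s) (c (insert t T)) =
        - sm (ksgn T s * (ksgn T t * var t)) (c (insert t T))" by (simp only: scale_minus_left)
  qed
  finally show ?thesis unfolding 1 by (simp add: sum_negf)
qed

subsection \<open>Graded pieces\<close>

lemma kchains_0: "gmod A \<Longrightarrow> 0 \<in> kchains A a j"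
  by (simp add: kchains_def gmod_0)

lemma kchains_add: "gmod A \<Longrightarrow> c \<in> kchains A a j \<Longrightarrow> d \<in> kchains A a j \<Longrightarrow> c + d \<in> kchains A a j"
  unfolding kchains_def by (auto simp: gmod_add split: if_splits)

lemma kchains_diff: "gmod A \<Longrightarrow> c \<in> kchains A a j \<Longrightarrow> d \<in> kchains A a j \<Longrightarrow> c - d \<in> kchains A a j"
  unfolding kchains_def by (auto simp: gmod_diff split: if_splits)

lemma kchains_chain_mult:
  "gmod A \<Longrightarrow> p \<in> homog_part e \<Longrightarrow> c \<in> kchains A a j \<Longrightarrow> chain_mult sm p c \<in> kchains A a (j + e)"
  using gmod_sm[of A p e "c S" "j - a" "j + e - a" for S]
  unfolding kchains_def chain_mult_def by (auto split: if_splits)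

lemma kchains_sum: "gmod A \<Longrightarrow> (\<And>i. i \<in> I \<Longrightarrow> c i \<in> kchains A a j) \<Longrightarrow> (\<Sum>i\<in>I. c i) \<in> kchains A a j"
  by (induction I rule: infinite_finite_induct) (auto intro: kchains_add kchains_0)

lemma kchains_mono: "(\<And>d. B d \<subseteq> A d) \<Longrightarrow> c \<in> kchains B a j \<Longrightarrow> c \<in> kchains A a j"
  unfolding kchains_def by (auto split: if_splits)

lemma kdiff_chain:
  assumes A: "gmod A" and c: "c \<in> kchains A a j"
  shows "kdiff sm c \<in> kchains A (a - 1) j"
  unfolding kchains_def
proof (intro CollectI allI)
  fix S
  show "if int (card S) = a - 1 then kdiff sm c S \<in> A (j - (a - 1)) else kdiff sm c S = 0"
  proof (cases "int (card S) = a - 1")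
    case True
    have "sm (ksgn S s * var s) (c (insert s S)) \<in> A (j - (a - 1))" if "s \<in> - S" for s
    proof -
      have "int (card (insert s S)) = a" using that True by simp
      then have "c (insert s S) \<in> A (j - a)" using c by (simp add: kchains_def)
      moreover have "ksgn S s * var s \<in> homog_part (0 + 1)" by (intro homog_part_mult ksgn_homog var_homog)
      ultimately show ?thesis using A by (auto intro: gmod_sm)
    qed
    then show ?thesis using True A by (auto simp: kdiff_def intro: gmod_sum)
  next
    case False
    have "c (insert s S) = 0" if "s \<in> - S" for s
    proof -
      have "int (card (insert s S)) \<noteq> a" using that False by auto
      then show ?thesis using c by (simp add: kchains_def)
    qed
    then show ?thesis using False by (simp add: kdiff_def)
  qed
qed

lemma kext_chain:
  assumes A: "gmod A" and c: "c \<in> kchains A a j"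
  shows "kext sm s c \<in> kchains A (a + 1) (j + 1)"
  unfolding kchains_def
proof (intro CollectI allI)
  fix S
  show "if int (card S) = a + 1 then kext sm s c S \<in> A (j + 1 - (a + 1)) else kext sm s c S = 0"
  proof (cases "s \<in> S")
    case True
    then have "int (card S) = int (card (S - {s})) + 1"
      by (metis card_Suc_Diff1 finite of_nat_Suc add.commute)
    then have e: "int (card (S - {s})) = a \<longleftrightarrow> int (card S) = a + 1" by linarith
    have d: "j + 1 - (a + 1) = j - a + 0" by simp
    have "if int (card (S - {s})) = a then c (S - {s}) \<in> A (j - a) else c (S - {s}) = 0"
      using c unfolding kchains_def by blast
    then show ?thesis
      using True gmod_sm[OF A ksgn_homog _ d, of "c (S - {s})"]
      unfolding e by (auto simp: kext_def split: if_splits)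
  next
    case False
    then show ?thesis using A by (auto simp: kext_def gmod_0)
  qed
qed

sublocale chain_space: vector_space "chain_scale sm"
  by unfold_locales
    (auto simp: chain_mult_def fun_eq_iff kspace.scale_right_distrib kspace.scale_left_distrib mult_single)

lemma kchains_subspace: "gmod A \<Longrightarrow> chain_space.subspace (kchains A a j)"
  unfolding chain_space.subspace_def
  by (auto simp: kchains_0 kchains_add intro: kchains_chain_mult[where e = 0, simplified])

lemma koszul_cycles_subspace:
  assumes "gmod A" "gmod B"
  shows "chain_space.subspace (koszul_cycles sm A B a j)"
  using kchains_subspace[OF assms(1), of a j] kchains_subspace[OF assms(2), of "a - 1" j]
  unfolding chain_space.subspace_def koszul_cycles_def
  by (auto simp: kdiff_add kdiff_chain_mult)

lemma koszul_boundaries_subspace: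
  assumes "gmod A" "gmod B"
  shows "chain_space.subspace (koszul_boundaries sm A B a j)"
  unfolding chain_space.subspace_def
proof (intro conjI ballI allI)
  show "0 \<in> koszul_boundaries sm A B a j"
    by (auto simp: koszul_boundaries_def intro!: bexI[of _ 0] kchains_0 assms)
next
  fix c d assume "c \<in> koszul_boundaries sm A B a j" "d \<in> koszul_boundaries sm A B a j"
  then obtain b b' where *: "c \<in> kchains A a j" "b \<in> kchains A (a + 1) j" "c - kdiff sm b \<in> kchains B a j"
    "d \<in> kchains A a j" "b' \<in> kchains A (a + 1) j" "d - kdiff sm b' \<in> kchains B a j"
    by (auto simp: koszul_boundaries_def)
  have "c + d - kdiff sm (b + b') = (c - kdiff sm b) + (d - kdiff sm b')" by (simp add: kdiff_add)
  also have "\<dots> \<in> kchains B a j" using * assms by (intro kchains_add)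
  finally show "c + d \<in> koszul_boundaries sm A B a j"
    unfolding koszul_boundaries_def using * assms by (auto intro!: bexI[of _ "b + b'"] kchains_add)
next
  fix r c assume "c \<in> koszul_boundaries sm A B a j"
  then obtain b where *: "c \<in> kchains A a j" "b \<in> kchains A (a + 1) j" "c - kdiff sm b \<in> kchains B a j"
    by (auto simp: koszul_boundaries_def)
  have "chain_scale sm r c - kdiff sm (chain_scale sm r b) = chain_scale sm r (c - kdiff sm b)"
    by (simp add: kdiff_chain_mult chain_mult_diff)
  then show "chain_scale sm r c \<in> koszul_boundaries sm A B a j"
    unfolding koszul_boundaries_def using *
    by (auto intro!: bexI[of _ "chain_scale sm r b"] chain_space.subspace_scale kchains_subspace assms)
qed

lemma kchains_subset_koszul_boundaries:
  assumes "gmod A" "gmod B" "\<And>d. B d \<subseteq> A d"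
  shows "kchains B a j \<subseteq> koszul_boundaries sm A B a j"
  unfolding koszul_boundaries_def using assms by (auto intro!: bexI[of _ 0] kchains_0 intro: kchains_mono)

lemma koszul_boundaries_subset_koszul_cycles:
  assumes "gmod A" "gmod B"
  shows "koszul_boundaries sm A B a j \<subseteq> koszul_cycles sm A B a j"
proof
  fix c assume "c \<in> koszul_boundaries sm A B a j"
  then obtain b where *: "c \<in> kchains A a j" "c - kdiff sm b \<in> kchains B a j"
    by (auto simp: koszul_boundaries_def)
  have "kdiff sm c = kdiff sm (c - kdiff sm b)" by (simp add: kdiff_diff kdiff_kdiff)
  also have "\<dots> \<in> kchains B (a - 1) j" by (rule kdiff_chain[OF assms(2) *(2)])
  finally show "c \<in> koszul_cycles sm A B a j" using * by (simp add: koszul_cycles_def)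
qed

end

section \<open>Koszul homology under isomorphisms of graded modules\<close>

lemma sum_fun_apply: "(\<Sum>i\<in>I. f i) x = (\<Sum>i\<in>I. (f i x :: 'a::comm_monoid_add))"
  by (induction I rule: infinite_finite_induct) auto

lemma kchains_empty: "c \<in> kchains A a j \<Longrightarrow> a \<noteq> 0 \<Longrightarrow> c {} = 0"
  unfolding kchains_def by (auto dest: spec[of _ "{}"])

lemma kchains_0_iff: "c \<in> kchains A 0 j \<longleftrightarrow> c {} \<in> A j \<and> (\<forall>S. S \<noteq> {} \<longrightarrow> c S = 0)"
  by (auto simp: kchains_def)

lemma kchains_zero: "kchains (\<lambda>_. {0}) a j = {0}"
  by (auto simp: kchains_def fun_eq_iff)

lemma kchains_lift:
  assumes "\<And>d v. v \<in> A d \<Longrightarrow> \<exists>w\<in>A' d. G v w" "G 0 0" and c: "c \<in> kchains A a j"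
  shows "\<exists>c'\<in>kchains A' a j. \<forall>S. G (c S) (c' S)"
proof -
  have "\<exists>w. G (c S) w \<and> (if int (card S) = a then w \<in> A' (j - a) else w = 0)" for S
    using c assms(1)[of "c S" "j - a"] assms(2) by (auto simp: kchains_def split: if_splits)
  then obtain c' where "\<forall>S. G (c S) (c' S) \<and> (if int (card S) = a then c' S \<in> A' (j - a) else c' S = 0)"
    by metis
  then show ?thesis by (intro bexI[of _ c']) (auto simp: kchains_def)
qed

locale poly_module_pair = m1: poly_module s1 + m2: poly_module s2
  for s1 :: "('n::finite, 'k::field) mpoly \<Rightarrow> 'v::ab_group_add \<Rightarrow> 'v"
    and s2 :: "('n, 'k) mpoly \<Rightarrow> 'w::ab_group_add \<Rightarrow> 'w"
begin

sublocale chain_pair: vector_space_pair "chain_scale s1" "chain_scale s2"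
  by unfold_locales

text \<open>Koszul homology depends only on the graded module A / B. The relation G presents an
  isomorphism from A / B to A' / B' and is applied to chains coefficient by coefficient.\<close>

lemma koszul_dim_transfer:
  assumes add: "\<And>v v' w w'. G v w \<Longrightarrow> G v' w' \<Longrightarrow> G (v + v') (w + w')"
    and sm: "\<And>p v w. G v w \<Longrightarrow> G (s1 p v) (s2 p w)"
    and l: "\<And>d v. v \<in> A d \<Longrightarrow> \<exists>w\<in>A' d. G v w" and r: "\<And>d w. w \<in> A' d \<Longrightarrow> \<exists>v\<in>A d. G v w"
    and z: "\<And>d v w. v \<in> A d \<Longrightarrow> w \<in> A' d \<Longrightarrow> G v w \<Longrightarrow> v \<in> B d \<longleftrightarrow> w \<in> B' d"
    and gm: "m1.gmod A" "m1.gmod B" "m2.gmod A'" "m2.gmod B'"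
    and h: "koszul_dim s1 A B a j h"
  shows "koszul_dim s2 A' B' a j h"
proof -
  have G0: "G 0 0" using l[OF m1.gmod_0[OF gm(1)], of 0] sm[of 0 _ 0] by fastforce
  have Gdiff: "G (v - v') (w - w')" if "G v w" "G v' w'" for v v' w w'
    using add[OF that(1) sm[OF that(2), of "- 1"]] by simp
  have Gsum: "G (\<Sum>i\<in>I. f i) (\<Sum>i\<in>I. g i)" if "\<And>i. i \<in> I \<Longrightarrow> G (f i) (g i)"
    for I :: "'n set" and f g
    using that by (induction I rule: infinite_finite_induct) (auto intro: G0 add)
  define GG where "GG c c' \<longleftrightarrow> (\<forall>S::'n set. G (c S) (c' S))" for c c'
  have GGdiff: "GG (c - d) (c' - d')" if "GG c c'" "GG d d'" for c c' d d'
    using that by (auto simp: GG_def Gdiff)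
  have GGk: "GG (kdiff s1 c) (kdiff s2 c')" if "GG c c'" for c c'
    using that by (auto simp: GG_def kdiff_def intro!: Gsum sm)
  have lift: "\<exists>c'\<in>kchains A' a j. GG c c'" if "c \<in> kchains A a j" for c a j
    unfolding GG_def by (rule kchains_lift[where A = A and A' = A' and G = G]) (fact l G0 that)+
  have lift': "\<exists>c\<in>kchains A a j. GG c c'" if "c' \<in> kchains A' a j" for c' a j
    unfolding GG_def by (rule kchains_lift[where A = A' and A' = A and G = "\<lambda>w v. G v w"]) (fact r G0 that)+
  have zz: "c \<in> kchains B a j \<longleftrightarrow> c' \<in> kchains B' a j"
    if c: "c \<in> kchains A a j" "c' \<in> kchains A' a j" "GG c c'" for c c' a j
  proof -
    have "c S \<in> B (j - a) \<longleftrightarrow> c' S \<in> B' (j - a)" if "int (card S) = a" for S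
    proof (rule z)
      show "c S \<in> A (j - a)" "c' S \<in> A' (j - a)" using c(1,2) that by (auto simp: kchains_def)
      show "G (c S) (c' S)" using c(3) by (simp add: GG_def)
    qed
    then show ?thesis using c(1,2) unfolding kchains_def by auto
  qed
  have koszul_cycles: "c \<in> koszul_cycles s1 A B a j \<longleftrightarrow> c' \<in> koszul_cycles s2 A' B' a j"
    if c: "c \<in> kchains A a j" "c' \<in> kchains A' a j" "GG c c'" for c c'
    using zz[OF m1.kdiff_chain[OF gm(1) c(1)] m2.kdiff_chain[OF gm(3) c(2)] GGk[OF c(3)]] c
    by (simp add: koszul_cycles_def)
  have koszul_boundaries: "c \<in> koszul_boundaries s1 A B a j \<longleftrightarrow> c' \<in> koszul_boundaries s2 A' B' a j"
    if c: "c \<in> kchains A a j" "c' \<in> kchains A' a j" "GG c c'" for c c'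
  proof -
    have *: "c - kdiff s1 b \<in> kchains B a j \<longleftrightarrow> c' - kdiff s2 b' \<in> kchains B' a j"
      if b: "b \<in> kchains A (a + 1) j" "b' \<in> kchains A' (a + 1) j" "GG b b'" for b b'
      using m1.kdiff_chain[OF gm(1) b(1)] m2.kdiff_chain[OF gm(3) b(2)] c b
      by (intro zz m1.kchains_diff m2.kchains_diff gm GGdiff GGk) auto
    show ?thesis using c(1,2) lift lift' * unfolding koszul_boundaries_def by blast
  qed
  show ?thesis
  proof (rule chain_pair.qdim_transfer[where G = GG, OF _ _ _ _ _ _ _ h])
    show "m1.chain_space.subspace (koszul_cycles s1 A B a j)" "m2.chain_space.subspace (koszul_cycles s2 A' B' a j)"
      by (intro m1.koszul_cycles_subspace m2.koszul_cycles_subspace gm)+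
    show "GG (c + d) (c' + d')" if "GG c c'" "GG d d'" for c c' d d'
      using that by (auto simp: GG_def add)
    show "GG (chain_scale s1 x c) (chain_scale s2 x c')" if "GG c c'" for x c c'
      using that by (auto simp: GG_def chain_mult_def sm)
    show "\<exists>c'\<in>koszul_cycles s2 A' B' a j. GG c c'" if "c \<in> koszul_cycles s1 A B a j" for c
      using that lift[of c a j] koszul_cycles unfolding koszul_cycles_def by blast
    show "\<exists>c\<in>koszul_cycles s1 A B a j. GG c c'" if "c' \<in> koszul_cycles s2 A' B' a j" for c'
      using that lift'[of c' a j] koszul_cycles unfolding koszul_cycles_def by blast
    show "c \<in> koszul_boundaries s1 A B a j \<longleftrightarrow> c' \<in> koszul_boundaries s2 A' B' a j"
      if "c \<in> koszul_cycles s1 A B a j" "c' \<in> koszul_cycles s2 A' B' a j" "GG c c'" for c c'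
      using that koszul_boundaries by (auto simp: koszul_cycles_def)
  qed
qed

end

context poly_module
begin

sublocale self_pair: poly_module_pair sm sm
  by unfold_locales

subsection \<open>Dimension shifting\<close>

text \<open>The connecting map of 0 -> Z -> F -> F / Z -> 0, given on representatives by
  \<open>kdiff\<close>. Exactness of F in degree a makes it surjective, exactness in degree a + 1
  makes it injective.\<close>

lemma koszul_dim_shift:
  assumes F: "gmod F" and Z: "gmod Z" and ZF: "\<And>d. Z d \<subseteq> F d"
    and ex: "\<And>c b. b \<in> {a, a + 1} \<Longrightarrow> c \<in> kchains F b j \<Longrightarrow> kdiff sm c = 0 \<Longrightarrow> \<exists>e\<in>kchains F (b + 1) j. c = kdiff sm e"
    and h: "koszul_dim sm F Z (a + 1) j h"
  shows "koszul_dim sm Z (\<lambda>_. {0}) a j h"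
proof (rule self_pair.chain_pair.qdim_transfer[where G = "\<lambda>c z. z = kdiff sm c", OF _ _ _ _ _ _ _ h])
  show "chain_space.subspace (koszul_cycles sm F Z (a + 1) j)" "chain_space.subspace (koszul_cycles sm Z (\<lambda>_. {0}) a j)"
    by (intro koszul_cycles_subspace F Z gmod_zero)+
  show "\<exists>z\<in>koszul_cycles sm Z (\<lambda>_. {0}) a j. z = kdiff sm c" if "c \<in> koszul_cycles sm F Z (a + 1) j" for c
    using that by (auto simp: koszul_cycles_def kchains_zero kdiff_kdiff)
  show "\<exists>c\<in>koszul_cycles sm F Z (a + 1) j. z = kdiff sm c" if "z \<in> koszul_cycles sm Z (\<lambda>_. {0}) a j" for z
    using that ex[of a z] kchains_mono[of Z F z a j] ZF by (auto simp: koszul_cycles_def kchains_zero)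
  show "c \<in> koszul_boundaries sm F Z (a + 1) j \<longleftrightarrow> z \<in> koszul_boundaries sm Z (\<lambda>_. {0}) a j"
    if c: "c \<in> koszul_cycles sm F Z (a + 1) j" and z: "z \<in> koszul_cycles sm Z (\<lambda>_. {0}) a j" "z = kdiff sm c" for c z
  proof
    assume "c \<in> koszul_boundaries sm F Z (a + 1) j"
    then obtain b where b: "c - kdiff sm b \<in> kchains Z (a + 1) j" by (auto simp: koszul_boundaries_def)
    have "z = kdiff sm (c - kdiff sm b)" by (simp add: z kdiff_diff kdiff_kdiff)
    then show "z \<in> koszul_boundaries sm Z (\<lambda>_. {0}) a j"
      using b z(1) by (auto simp: koszul_boundaries_def koszul_cycles_def kchains_zero intro!: bexI[of _ "c - kdiff sm b"])
  next
    assume "z \<in> koszul_boundaries sm Z (\<lambda>_. {0}) a j"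
    then obtain b where b: "b \<in> kchains Z (a + 1) j" "z = kdiff sm b" by (auto simp: koszul_boundaries_def kchains_zero)
    have "c - b \<in> kchains F (a + 1) j"
      using c b(1) kchains_mono[of Z F b, OF ZF] by (auto simp: koszul_cycles_def intro: kchains_diff F)
    moreover have "kdiff sm (c - b) = 0" using z b by (simp add: kdiff_diff)
    ultimately obtain e where "e \<in> kchains F (a + 2) j" "c - b = kdiff sm e"
      using ex[of "a + 1" "c - b"] by (auto simp: add.assoc)
    moreover from this(2)[symmetric] have "c - kdiff sm e = b" by (simp add: algebra_simps)
    ultimately show "c \<in> koszul_boundaries sm F Z (a + 1) j"
      using b c by (auto simp: koszul_boundaries_def koszul_cycles_def add.assoc)
  qed
qed (auto simp: kdiff_add kdiff_chain_mult)

subsection \<open>Adding a form of positive degree to the submodule\<close>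

definition add_form :: "(int \<Rightarrow> 'v set) \<Rightarrow> (int \<Rightarrow> 'v set) \<Rightarrow> int \<Rightarrow> ('n, 'k) mpoly \<Rightarrow> int \<Rightarrow> 'v set" where
  "add_form A B e f d = {b + sm f a | a b. a \<in> A (d - e) \<and> b \<in> B d}"

lemma gmod_add_form:
  assumes A: "gmod A" and B: "gmod B"
  shows "gmod (add_form A B e f)"
  unfolding gmod_def
proof (intro conjI allI ballI)
  show "0 \<in> add_form A B e f d" for d
    unfolding add_form_def using gmod_0[OF A] gmod_0[OF B] by force
next
  fix d x y assume "x \<in> add_form A B e f d" "y \<in> add_form A B e f d"
  then obtain a b a' b' where "x = b + sm f a" "y = b' + sm f a'"
    "a \<in> A (d - e)" "b \<in> B d" "a' \<in> A (d - e)" "b' \<in> B d"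
    by (auto simp: add_form_def)
  moreover from this have "x + y = (b + b') + sm f (a + a')" by (simp add: scale_right_distrib)
  ultimately show "x + y \<in> add_form A B e f d"
    unfolding add_form_def using gmod_add[OF A] gmod_add[OF B] by blast
next
  fix d d' x and p :: "('n, 'k) mpoly" assume p: "p \<in> homog_part d'" and "x \<in> add_form A B e f d"
  then obtain a b where "x = b + sm f a" "a \<in> A (d - e)" "b \<in> B d"
    by (auto simp: add_form_def)
  moreover from this have "sm p x = sm p b + sm f (sm p a)"
    by (simp add: scale_right_distrib mult.commute)
  moreover have "sm p a \<in> A (d + d' - e)" if "a \<in> A (d - e)" for a
    by (rule gmod_sm[OF A p that]) simp
  ultimately show "sm p x \<in> add_form A B e f (d + d')"
    unfolding add_form_def using gmod_sm[OF B p] by blast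
qed

lemma kchains_add_formD:
  assumes A: "gmod A" and B: "gmod B" and c: "c \<in> kchains (add_form A B e f) a j"
  shows "\<exists>g\<in>kchains A a (j - e). c - chain_mult sm f g \<in> kchains B a j"
proof -
  have "\<exists>g. c S - sm f g \<in> B (j - a) \<and> g \<in> A (j - a - e)" if "int (card S) = a" for S
  proof -
    have "c S \<in> add_form A B e f (j - a)" using c that unfolding kchains_def by auto
    then obtain g b where "c S = b + sm f g" "g \<in> A (j - a - e)" "b \<in> B (j - a)"
      by (auto simp: add_form_def)
    then show ?thesis by (intro exI[of _ g]) simp
  qed
  then obtain g where g: "\<And>S. int (card S) = a \<Longrightarrow> c S - sm f (g S) \<in> B (j - a) \<and> g S \<in> A (j - a - e)"
    by metis
  define g' where "g' S = (if int (card S) = a then g S else 0)" for S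
  have ae: "j - a - e = j - e - a" by simp
  have "g' \<in> kchains A a (j - e)"
    using g[unfolded ae] unfolding kchains_def g'_def by auto
  moreover have "c - chain_mult sm f g' \<in> kchains B a j"
    using g c unfolding kchains_def g'_def chain_mult_def by auto
  ultimately show ?thesis by blast
qed

lemma add_form_mono: "gmod A \<Longrightarrow> B d \<subseteq> add_form A B e f d"
  unfolding add_form_def using gmod_0[of A] by force

lemma chain_mult_add_form:
  assumes A: "gmod A" and B: "gmod B" and g: "g \<in> kchains A a (j - e)"
  shows "chain_mult sm f g \<in> kchains (add_form A B e f) a j"
proof -
  have ae: "j - e - a = j - a - e" by simp
  have "sm f x \<in> add_form A B e f (j - a)" if "x \<in> A (j - a - e)" for x
    unfolding add_form_def using that gmod_0[OF B] by force
  then show ?thesis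
    using g unfolding kchains_def chain_mult_def ae by (auto split: if_splits)
qed

text \<open>The homology of \<open>A / (B + f A)\<close> is assembled from that of \<open>A / B\<close> as long as \<open>f\<close> is a
  nonzerodivisor on \<open>A / B\<close> in the degrees involved: \<open>f\<close> lies in the square of the ideal of the
  variables, and the variables act trivially on Koszul homology.\<close>

lemma koszul_dim_add_form:
  assumes A: "gmod A" and B: "gmod B" and BA: "\<And>d. B d \<subseteq> A d"
    and y: "\<And>s. y s \<in> homog_part (e - 1)" and f: "f = (\<Sum>s\<in>UNIV. y s * var s)"
    and inj: "\<And>d a. d \<le> D \<Longrightarrow> a \<in> A d \<Longrightarrow> sm f a \<in> B (d + e) \<Longrightarrow> a \<in> B d"
    and j: "j \<le> i + D + e - 2"
    and h1: "koszul_dim sm A B i j h1" and h2: "koszul_dim sm A B (i - 1) (j - e) h2"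
  shows "koszul_dim sm A (add_form A B e f) i j (h1 + h2)"
proof -
  let ?B' = "add_form A B e f"
  let ?f = "chain_mult sm f"
  have gB': "gmod ?B'" by (rule gmod_add_form[OF A B])
  have BB': "B d \<subseteq> ?B' d" for d by (rule add_form_mono[OF A])
  have B'A: "?B' d \<subseteq> A d" for d
  proof -
    have "f \<in> homog_part (e - 1 + 1)" unfolding f
      by (intro homog_part_sum homog_part_mult y var_homog)
    then show ?thesis unfolding add_form_def
      using BA by (auto intro!: gmod_add[OF A] intro: gmod_sm[OF A, of f e])
  qed
  \<comment> \<open>The homotopies of the variables combine, with weights y s, to one for f. It only
    multiplies coefficients by polynomials, so it preserves chains in B as well as chains in
    A.\<close>
  define hom where "hom b S = (\<Sum>s\<in>UNIV. sm (y s) (kext sm s b S))" for b S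
  have hom_chain: "hom b \<in> kchains M (a + 1) (j' + e)" if M: "gmod M" and b: "b \<in> kchains M a j'" for M b a j'
  proof -
    have "chain_mult sm (y s) (kext sm s b) \<in> kchains M (a + 1) (j' + e)" for s
      using kchains_chain_mult[OF M y kext_chain[OF M b], of s s] by (simp add: algebra_simps)
    then have "(\<Sum>s\<in>UNIV. chain_mult sm (y s) (kext sm s b)) \<in> kchains M (a + 1) (j' + e)"
      by (intro kchains_sum M)
    also have "(\<Sum>s\<in>UNIV. chain_mult sm (y s) (kext sm s b)) = hom b"
      by (rule ext) (simp add: hom_def chain_mult_def sum_fun_apply)
    finally show ?thesis .
  qed
  have hom_eq: "kdiff sm (hom b) + hom (kdiff sm b) = ?f b" for b
  proof
    fix S
    have "kdiff sm (hom b) S = (\<Sum>t\<in>- S. \<Sum>s\<in>UNIV. sm (y s) (sm (ksgn S t * var t) (kext sm s b (insert t S))))"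
      unfolding kdiff_def hom_def by (simp add: scale_sum_right mult_ac)
    also have "\<dots> = (\<Sum>s\<in>UNIV. sm (y s) (kdiff sm (kext sm s b) S))"
      by (subst sum.swap) (simp add: kdiff_def scale_sum_right)
    finally have "(kdiff sm (hom b) + hom (kdiff sm b)) S =
        (\<Sum>s\<in>UNIV. sm (y s) (kdiff sm (kext sm s b) S + kext sm s (kdiff sm b) S))"
      by (simp add: hom_def scale_right_distrib sum.distrib)
    also have "\<dots> = ?f b S" by (simp add: kdiff_kext f chain_mult_def scale_sum_left)
    finally show "(kdiff sm (hom b) + hom (kdiff sm b)) S = ?f b S" .
  qed
  have injc: "g \<in> kchains B a j'"
    if g: "g \<in> kchains A a j'" "?f g \<in> kchains B a (j' + e)" and "j' - a \<le> D" for g a j'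
  proof -
    have "g S \<in> B (j' - a)" if "int (card S) = a" for S
    proof -
      have "g S \<in> A (j' - a)" "sm f (g S) \<in> B (j' + e - a)"
        using that g unfolding kchains_def chain_mult_def by (auto split: if_splits)
      moreover have "j' + e - a = j' - a + e" by simp
      ultimately show ?thesis using inj[OF \<open>j' - a \<le> D\<close>] by simp
    qed
    then show ?thesis using g(1) unfolding kchains_def by auto
  qed
  have fB: "?f \<beta> \<in> kchains B a (j' + e)" if "\<beta> \<in> kchains B a j'" for \<beta> a j'
  proof -
    have "f \<in> homog_part (e - 1 + 1)" unfolding f
      by (intro homog_part_sum homog_part_mult y var_homog)
    then show ?thesis using kchains_chain_mult[OF B _ that, of f e] by simp
  qed
  let ?Z = "koszul_cycles sm A B i j" and ?N = "koszul_boundaries sm A B i j"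
  let ?Z' = "koszul_cycles sm A ?B' i j" and ?N' = "koszul_boundaries sm A ?B' i j"
  \<comment> \<open>C / N' is the image of the homology of A / B in that of A / (B + f A). The
    filtration N' \<subseteq> C \<subseteq> Z' cuts the latter into this image and the part seen by
    the connecting map.\<close>
  define C where "C = {z + n | z n. z \<in> ?Z \<and> n \<in> ?N'}"
  have subs: "chain_space.subspace ?Z" "chain_space.subspace ?N" "chain_space.subspace ?Z'" "chain_space.subspace ?N'"
    by (intro koszul_cycles_subspace koszul_boundaries_subspace A B gB')+
  have subC: "chain_space.subspace C" unfolding C_def by (rule chain_space.subspace_sums[OF subs(1,4)])
  have ZZ': "?Z \<subseteq> ?Z'" using kchains_mono[of B ?B', OF BB'] by (auto simp: koszul_cycles_def)
  have NN': "?N \<subseteq> ?N'" using kchains_mono[of B ?B', OF BB'] by (auto simp: koszul_boundaries_def)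
  have N'Z': "?N' \<subseteq> ?Z'" by (rule koszul_boundaries_subset_koszul_cycles[OF A gB'])
  have N'C: "?N' \<subseteq> C" unfolding C_def using chain_space.subspace_0[OF subs(1)] by force
  have CZ': "C \<subseteq> ?Z'" unfolding C_def using ZZ' N'Z' chain_space.subspace_add[OF subs(3)] by blast
  have N'D: "\<exists>e' g \<beta>. e' \<in> kchains A (i + 1) j \<and> g \<in> kchains A i (j - e) \<and> \<beta> \<in> kchains B i j \<and>
      c = kdiff sm e' + ?f g + \<beta>" if "c \<in> ?N'" for c
  proof -
    obtain e' where e': "e' \<in> kchains A (i + 1) j" "c - kdiff sm e' \<in> kchains ?B' i j"
      using \<open>c \<in> ?N'\<close> by (auto simp: koszul_boundaries_def)
    obtain g where "g \<in> kchains A i (j - e)" "c - kdiff sm e' - ?f g \<in> kchains B i j"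
      using kchains_add_formD[OF A B e'(2)] by blast
    then show ?thesis using e'(1)
      by (intro exI[of _ e'] exI[of _ g] exI[of _ "c - kdiff sm e' - ?f g"]) simp
  qed
  \<comment> \<open>The map from the homology of A / B is injective: if f g occurs in a boundary of
    B-cycles, then \<open>kdiff sm g\<close> lies in B by injectivity of f, and f g equals
    \<open>kdiff sm (hom g)\<close> modulo B.\<close>
  have N_of: "z \<in> ?N" if z: "z \<in> ?Z" "z \<in> ?N'" for z
  proof -
    obtain e' g \<beta> where *: "e' \<in> kchains A (i + 1) j" "g \<in> kchains A i (j - e)" "\<beta> \<in> kchains B i j"
      and zeq: "z = kdiff sm e' + ?f g + \<beta>" using N'D[OF z(2)] by blast
    have dg: "kdiff sm g \<in> kchains A (i - 1) (j - e)" by (rule kdiff_chain[OF A *(2)])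
    have "?f (kdiff sm g) = kdiff sm z - kdiff sm \<beta>"
      by (simp add: zeq kdiff_add kdiff_kdiff kdiff_chain_mult)
    also have "\<dots> \<in> kchains B (i - 1) j"
      using z(1) kdiff_chain[OF B *(3)] by (auto simp: koszul_cycles_def intro: kchains_diff B)
    finally have "kdiff sm g \<in> kchains B (i - 1) (j - e)"
      using injc[OF dg] j by simp
    then have hg: "hom (kdiff sm g) \<in> kchains B i j" using hom_chain[OF B, of _ "i - 1" "j - e"] by simp
    have "hom g \<in> kchains A (i + 1) j" using hom_chain[OF A *(2)] by simp
    then have "e' + hom g \<in> kchains A (i + 1) j" using * by (intro kchains_add A)
    moreover have "z - kdiff sm (e' + hom g) = \<beta> + hom (kdiff sm g)"
      unfolding zeq kdiff_add hom_eq[symmetric] by (simp add: algebra_simps)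
    ultimately show ?thesis using z(1) *(3) hg
      unfolding koszul_boundaries_def koszul_cycles_def by (auto intro!: bexI[of _ "e' + hom g"] kchains_add B)
  qed
  have q1: "qdim (chain_scale sm) C ?N' h1"
  proof (rule self_pair.chain_pair.qdim_transfer[where G = "\<lambda>z c. c - z \<in> ?N'", OF _ _ _ _ _ subs(1) subC h1])
    fix a b c d assume "c - a \<in> ?N'" "d - b \<in> ?N'"
    then show "c + d - (a + b) \<in> ?N'"
      using chain_space.subspace_add[OF subs(4)] by (metis add_diff_add)
  next
    fix r a c assume "c - a \<in> ?N'"
    then show "chain_scale sm r c - chain_scale sm r a \<in> ?N'"
      using chain_space.subspace_scale[OF subs(4), of "c - a" r] by (simp add: chain_mult_diff)
  next
    fix z assume "z \<in> ?Z"
    then show "\<exists>c\<in>C. c - z \<in> ?N'"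
      unfolding C_def using chain_space.subspace_0[OF subs(4)]
      by (intro bexI[of _ z] CollectI exI[of _ z] exI[of _ 0]) auto
  next
    fix c assume "c \<in> C"
    then show "\<exists>z\<in>?Z. c - z \<in> ?N'" unfolding C_def by force
  next
    fix z c assume z: "z \<in> ?Z" and "c \<in> C" and cz: "c - z \<in> ?N'"
    have "z \<in> ?N \<longleftrightarrow> z \<in> ?N'" using N_of[OF z] NN' by blast
    also have "\<dots> \<longleftrightarrow> c \<in> ?N'"
      using cz chain_space.subspace_add[OF subs(4) cz, of z] chain_space.subspace_diff[OF subs(4) _ cz, of c] by auto
    finally show "z \<in> ?N \<longleftrightarrow> c \<in> ?N'" .
  qed
  \<comment> \<open>The connecting relation: c belongs to b when its differential is f b modulo B.
    Every cycle b is reached, by \<open>hom b\<close>.\<close>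
  have q2: "qdim (chain_scale sm) ?Z' C h2"
  proof (rule self_pair.chain_pair.qdim_transfer[where G = "\<lambda>b c. kdiff sm c - ?f b \<in> kchains B (i - 1) j",
        OF _ _ _ _ _ koszul_cycles_subspace[OF A B] subs(3) h2])
    fix a b c d assume "kdiff sm c - ?f a \<in> kchains B (i - 1) j" "kdiff sm d - ?f b \<in> kchains B (i - 1) j"
    then have "(kdiff sm c - ?f a) + (kdiff sm d - ?f b) \<in> kchains B (i - 1) j" by (rule kchains_add[OF B])
    then show "kdiff sm (c + d) - ?f (a + b) \<in> kchains B (i - 1) j"
      by (simp add: kdiff_add chain_mult_add algebra_simps)
  next
    fix r a c assume "kdiff sm c - ?f a \<in> kchains B (i - 1) j"
    then have "chain_scale sm r (kdiff sm c - ?f a) \<in> kchains B (i - 1) j"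
      by (rule chain_space.subspace_scale[OF kchains_subspace[OF B]])
    moreover have "?f (chain_scale sm r a) = chain_scale sm r (?f a)" by (rule ext) (simp add: chain_mult_def mult.commute)
    ultimately show "kdiff sm (chain_scale sm r c) - ?f (chain_scale sm r a) \<in> kchains B (i - 1) j"
      by (simp add: kdiff_chain_mult chain_mult_diff)
  next
    fix b assume "b \<in> koszul_cycles sm A B (i - 1) (j - e)"
    then have b: "b \<in> kchains A (i - 1) (j - e)" "kdiff sm b \<in> kchains B (i - 1 - 1) (j - e)"
      by (auto simp: koszul_cycles_def)
    have 1: "hom b \<in> kchains A i j" using hom_chain[OF A b(1)] by simp
    have 2: "hom (kdiff sm b) \<in> kchains B (i - 1) j" using hom_chain[OF B b(2)] by simp
    have 3: "kdiff sm (hom b) = ?f b - hom (kdiff sm b)" by (simp add: hom_eq[symmetric])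
    have "?f b \<in> kchains ?B' (i - 1) j" by (rule chain_mult_add_form[OF A B b(1)])
    then have "kdiff sm (hom b) \<in> kchains ?B' (i - 1) j"
      unfolding 3 using kchains_mono[of B ?B', OF BB' 2] by (rule kchains_diff[OF gB'])
    moreover have "kdiff sm (hom b) - ?f b \<in> kchains B (i - 1) j"
      using kchains_diff[OF B kchains_0[OF B] 2] by (simp add: 3)
    ultimately show "\<exists>c\<in>?Z'. kdiff sm c - ?f b \<in> kchains B (i - 1) j"
      using 1 by (auto simp: koszul_cycles_def)
  next
    fix c assume "c \<in> ?Z'"
    then have c: "c \<in> kchains A i j" "kdiff sm c \<in> kchains ?B' (i - 1) j" by (auto simp: koszul_cycles_def)
    obtain b where b: "b \<in> kchains A (i - 1) (j - e)" "kdiff sm c - ?f b \<in> kchains B (i - 1) j"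
      using kchains_add_formD[OF A B c(2)] by blast
    have "?f (kdiff sm b) = 0 - kdiff sm (kdiff sm c - ?f b)"
      by (simp add: kdiff_diff kdiff_kdiff kdiff_chain_mult)
    also have "\<dots> \<in> kchains B (i - 1 - 1) j"
      by (intro kchains_diff kchains_0 kdiff_chain b B)
    \<comment> \<open>These coefficients have degree j - e - (i - 2), the highest degree in which
      injectivity of f is applied; the bound on j comes from here.\<close>
    finally have "kdiff sm b \<in> kchains B (i - 1 - 1) (j - e)"
      using injc[OF kdiff_chain[OF A b(1)]] j by simp
    then show "\<exists>b\<in>koszul_cycles sm A B (i - 1) (j - e). kdiff sm c - ?f b \<in> kchains B (i - 1) j"
      using b by (auto simp: koszul_cycles_def)
  next
    fix b c assume bz: "b \<in> koszul_cycles sm A B (i - 1) (j - e)" and cz: "c \<in> ?Z'"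
      and bc: "kdiff sm c - ?f b \<in> kchains B (i - 1) j"
    have b: "b \<in> kchains A (i - 1) (j - e)" and c: "c \<in> kchains A i j"
      using bz cz by (auto simp: koszul_cycles_def)
    show "b \<in> koszul_boundaries sm A B (i - 1) (j - e) \<longleftrightarrow> c \<in> C"
    proof
      assume "b \<in> koszul_boundaries sm A B (i - 1) (j - e)"
      then obtain g where g: "g \<in> kchains A i (j - e)" "b - kdiff sm g \<in> kchains B (i - 1) (j - e)"
        by (auto simp: koszul_boundaries_def)
      have fgB': "?f g \<in> kchains ?B' i j" by (rule chain_mult_add_form[OF A B g(1)])
      then have fgN: "?f g \<in> ?N'" using kchains_subset_koszul_boundaries[OF A gB' B'A] by blast
      have "kdiff sm (c - ?f g) = (kdiff sm c - ?f b) + ?f (b - kdiff sm g)"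
        by (simp add: kdiff_diff kdiff_chain_mult chain_mult_diff)
      also have "\<dots> \<in> kchains B (i - 1) j" using fB[OF g(2)] by (intro kchains_add B bc) simp
      finally have "c - ?f g \<in> ?Z"
        using c kchains_mono[of ?B' A, OF B'A fgB'] by (auto simp: koszul_cycles_def intro: kchains_diff A)
      then show "c \<in> C" unfolding C_def using fgN by force
    next
      assume "c \<in> C"
      then obtain z n where zn: "c = z + n" "z \<in> ?Z" "n \<in> ?N'" by (auto simp: C_def)
      obtain e' g \<beta> where *: "e' \<in> kchains A (i + 1) j" "g \<in> kchains A i (j - e)" "\<beta> \<in> kchains B i j"
        and neq: "n = kdiff sm e' + ?f g + \<beta>" using N'D[OF zn(3)] by blast
      have "?f (b - kdiff sm g) = (kdiff sm z + kdiff sm \<beta>) - (kdiff sm c - ?f b)"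
        by (simp add: zn(1) neq kdiff_add kdiff_kdiff kdiff_chain_mult chain_mult_diff)
      also have "\<dots> \<in> kchains B (i - 1) j"
        using zn(2) kdiff_chain[OF B *(3)] bc by (auto simp: koszul_cycles_def intro!: kchains_diff kchains_add B)
      finally have "b - kdiff sm g \<in> kchains B (i - 1) (j - e)"
        using injc[OF kchains_diff[OF A b kdiff_chain[OF A *(2)]]] j by simp
      then show "b \<in> koszul_boundaries sm A B (i - 1) (j - e)"
        using b *(2) by (auto simp: koszul_boundaries_def)
    qed
  qed
  show ?thesis by (rule chain_space.qdim_add[OF subs(4) subC N'C CZ' q1 q2])
qed

end

context poly_module
begin

subsection \<open>Euler characteristics\<close>

lemma qdim_kchains:
  assumes A: "gmod A" and B: "gmod B"
    and q: "qdim (\<lambda>c. sm (single 0 c)) (A (j - int i)) (B (j - int i)) r"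
  shows "qdim (chain_scale sm) (kchains A (int i) j) (kchains B (int i) j) ((CARD('n) choose i) * r)"
proof -
  let ?k = "\<lambda>c. sm (single 0 c)"
  obtain g where g: "\<And>k. k < r \<Longrightarrow> g k \<in> A (j - int i)"
    "\<And>a. a \<in> A (j - int i) \<Longrightarrow> \<exists>c. a - (\<Sum>k<r. ?k (c k) (g k)) \<in> B (j - int i)"
    "\<And>c. (\<Sum>k<r. ?k (c k) (g k)) \<in> B (j - int i) \<Longrightarrow> \<forall>k<r. c k = 0"
    using q unfolding qdim_def by blast
  define I where "I = {S :: 'n set. card S = i} \<times> {..<r}"
  define e where "e x T = (if fst x = T then g (snd x) else 0)" for x :: "'n set \<times> nat" and T
  have sum_e: "(\<Sum>x\<in>I. chain_scale sm (c x) (e x)) T = (if card T = i then \<Sum>k<r. ?k (c (T, k)) (g k) else 0)" for c T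
  proof -
    have "(\<Sum>x\<in>I. chain_scale sm (c x) (e x)) T = (\<Sum>S | card S = i. \<Sum>k<r. if S = T then ?k (c (T, k)) (g k) else 0)"
      unfolding sum_fun_apply I_def sum.cartesian_product
    proof (rule sum.cong[OF refl])
      fix x :: "'n set \<times> nat"
      show "chain_scale sm (c x) (e x) T = (case x of (S, k) \<Rightarrow> if S = T then ?k (c (T, k)) (g k) else 0)"
        by (cases x; cases "fst x = T") (simp_all add: chain_mult_def e_def)
    qed
    also have "\<dots> = (\<Sum>S | card S = i. if S = T then \<Sum>k<r. ?k (c (T, k)) (g k) else 0)"
      by (intro sum.cong) auto
    also have "\<dots> = (if card T = i then \<Sum>k<r. ?k (c (T, k)) (g k) else 0)"
      by (simp add: sum.delta')
    finally show ?thesis .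
  qed
  show ?thesis
  proof (rule chain_space.qdimI[of I _ e])
    show "finite I" by (simp add: I_def)
    have "card {S :: 'n set. card S = i} = CARD('n) choose i"
      using n_subsets[OF finite[of "UNIV :: 'n set"], of i] by simp
    then show "card I = (CARD('n) choose i) * r" by (simp add: I_def card_cartesian_product)
    show "e x \<in> kchains A (int i) j" if "x \<in> I" for x
      using that g(1) gmod_0[OF A] by (auto simp: I_def e_def kchains_def)
  next
    fix a :: "'n set \<Rightarrow> 'v" assume a: "a \<in> kchains A (int i) j"
    have "\<exists>c. card S = i \<longrightarrow> a S - (\<Sum>k<r. ?k (c k) (g k)) \<in> B (j - int i)" for S
      using a g(2)[of "a S"] by (auto simp: kchains_def)
    then obtain c where c: "\<And>S. card S = i \<Longrightarrow> a S - (\<Sum>k<r. ?k (c S k) (g k)) \<in> B (j - int i)" by metis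
    have "a - (\<Sum>x\<in>I. chain_scale sm (case x of (S, k) \<Rightarrow> c S k) (e x)) \<in> kchains B (int i) j"
      using a c unfolding kchains_def by (auto simp: sum_e)
    then show "\<exists>c. a - (\<Sum>x\<in>I. chain_scale sm (c x) (e x)) \<in> kchains B (int i) j" by blast
  next
    fix c x assume c: "(\<Sum>x\<in>I. chain_scale sm (c x) (e x)) \<in> kchains B (int i) j" and x: "x \<in> I"
    obtain S k where Sk: "x = (S, k)" "card S = i" "k < r" using x by (auto simp: I_def)
    have "(\<Sum>x\<in>I. chain_scale sm (c x) (e x)) S \<in> B (j - int i)" using c Sk(2) by (auto simp: kchains_def)
    then show "c x = 0" using g(3)[of "\<lambda>k. c (S, k)"] Sk unfolding sum_e by simp
  qed
qed

lemma alternating_telescope: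
  fixes b :: "nat \<Rightarrow> int"
  shows "(\<Sum>i\<le>m. (-1) ^ i * (b (Suc i) + b i)) = (-1) ^ m * b (Suc m) + b 0"
  by (induction m) (auto simp: algebra_simps)

lemma kchains_eq_0: "a < 0 \<or> int CARD('n) < a \<Longrightarrow> (kchains A a j :: ('n set \<Rightarrow> 'v) set) \<subseteq> {0}"
proof
  fix c :: "'n set \<Rightarrow> 'v" assume a: "a < 0 \<or> int CARD('n) < a" and c: "c \<in> kchains A a j"
  have "c S = 0" for S
  proof -
    have "card S \<le> CARD('n)" by (rule card_mono) auto
    then have "int (card S) \<noteq> a" using a by auto
    then show ?thesis using c by (auto simp: kchains_def)
  qed
  then show "c \<in> {0}" by auto
qed

text \<open>In each homological degree the chains split into homology, the boundaries there, and the
  boundaries one degree lower. The boundary dimensions telescope in the alternating sum.\<close>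

lemma euler_characteristic:
  assumes A: "gmod A" and B: "gmod B" and BA: "\<And>d. B d \<subseteq> A d"
    and r: "\<And>d. qdim (\<lambda>c. sm (single 0 c)) (A d) (B d) (r d)"
    and h: "\<And>i. i \<le> CARD('n) \<Longrightarrow> koszul_dim sm A B (int i) j (h i)"
  shows "(\<Sum>i\<le>CARD('n). (-1) ^ i * int (h i)) =
     (\<Sum>i\<le>CARD('n). (-1) ^ i * int (CARD('n) choose i) * int (r (j - int i)))"
proof -
  note sub = kchains_subspace[OF B] koszul_cycles_subspace[OF A B] koszul_boundaries_subspace[OF A B]
  have kzA: "koszul_cycles sm A B a j \<subseteq> kchains A a j" for a by (auto simp: koszul_cycles_def)
  have kbB: "kchains B a j \<subseteq> koszul_boundaries sm A B a j" for a by (rule kchains_subset_koszul_boundaries[OF A B BA])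
  have kbz: "koszul_boundaries sm A B a j \<subseteq> koszul_cycles sm A B a j" for a by (rule koszul_boundaries_subset_koszul_cycles[OF A B])
  have neg: "koszul_boundaries sm A B (- 1) j \<subseteq> kchains B (- 1) j"
  proof -
    have "(kchains A (- 1) j :: ('n set \<Rightarrow> 'v) set) \<subseteq> {0}" by (rule kchains_eq_0) simp
    then show ?thesis using kchains_0[OF B, of "- 1" j] unfolding koszul_boundaries_def by blast
  qed
  have "\<exists>b. qdim (chain_scale sm) (koszul_boundaries sm A B (int i - 1) j) (kchains B (int i - 1) j) b" for i
  proof (cases i)
    case 0
    show ?thesis using chain_space.qdim_0[OF neg] 0 by auto
  next
    case (Suc i')
    have "\<exists>e1 e2. qdim (chain_scale sm) (koszul_boundaries sm A B (int i') j) (kchains B (int i') j) e1 \<and>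
        qdim (chain_scale sm) (kchains A (int i') j) (koszul_boundaries sm A B (int i') j) e2"
      by (rule chain_space.qdim_split[OF sub(1,3) kbB _ qdim_kchains[OF A B r]]) (use kbz kzA in blast)
    then show ?thesis using Suc by auto
  qed
  \<comment> \<open>b i counts the boundaries in degree i - 1, so that the two ends of the telescope
    are b 0 and b (n + 1) with n the number of variables, both 0.\<close>
  then obtain b where b: "\<And>i. qdim (chain_scale sm) (koszul_boundaries sm A B (int i - 1) j) (kchains B (int i - 1) j) (b i)" by metis
  have b0: "b 0 = 0"
  proof (rule chain_space.qdim_unique[OF sub(1) b])
    show "qdim (chain_scale sm) (koszul_boundaries sm A B (int 0 - 1) j) (kchains B (int 0 - 1) j) 0"
      using chain_space.qdim_0[OF neg] by simp
  qed
  let ?n = "CARD('n)"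
  have bn: "b (Suc ?n) = 0"
  proof (rule chain_space.qdim_unique[OF sub(1) b])
    have "koszul_boundaries sm A B (int ?n) j \<subseteq> kchains B (int ?n) j"
    proof
      fix c assume "c \<in> koszul_boundaries sm A B (int ?n) j"
      then obtain e where e: "e \<in> kchains A (int ?n + 1) j" "c - kdiff sm e \<in> kchains B (int ?n) j"
        by (auto simp: koszul_boundaries_def)
      have "e = 0" using kchains_eq_0[of "int ?n + 1" A j] e(1) by auto
      then show "c \<in> kchains B (int ?n) j" using e(2) by simp
    qed
    then show "qdim (chain_scale sm) (koszul_boundaries sm A B (int (Suc ?n) - 1) j) (kchains B (int (Suc ?n) - 1) j) 0"
      using chain_space.qdim_0 by auto
  qed
  have rel: "(?n choose i) * r (j - int i) = h i + b (Suc i) + b i" if i: "i \<le> ?n" for i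
  proof -
    have z: "qdim (chain_scale sm) (koszul_cycles sm A B (int i) j) (kchains B (int i) j) (b (Suc i) + h i)"
      using b[of "Suc i"] by (intro chain_space.qdim_add[OF sub(1,3) kbB kbz _ h[OF i]]) simp
    \<comment> \<open>The differential identifies chains modulo cycles with the boundaries one
      degree lower.\<close>
    have c: "qdim (chain_scale sm) (kchains A (int i) j) (koszul_cycles sm A B (int i) j) (b i)"
    proof (rule self_pair.chain_pair.qdim_transfer[where G = "\<lambda>x c. kdiff sm c - x \<in> kchains B (int i - 1) j",
          OF _ _ _ _ _ sub(3) kchains_subspace[OF A] b])
      fix x y c d assume "kdiff sm c - x \<in> kchains B (int i - 1) j" "kdiff sm d - y \<in> kchains B (int i - 1) j"
      then have "(kdiff sm c - x) + (kdiff sm d - y) \<in> kchains B (int i - 1) j" by (rule kchains_add[OF B])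
      then show "kdiff sm (c + d) - (x + y) \<in> kchains B (int i - 1) j"
        by (simp add: kdiff_add algebra_simps)
    next
      fix t x c assume "kdiff sm c - x \<in> kchains B (int i - 1) j"
      then have "chain_scale sm t (kdiff sm c - x) \<in> kchains B (int i - 1) j"
        by (rule chain_space.subspace_scale[OF sub(1)])
      then show "kdiff sm (chain_scale sm t c) - chain_scale sm t x \<in> kchains B (int i - 1) j"
        by (simp add: kdiff_chain_mult chain_mult_diff)
    next
      fix x assume "x \<in> koszul_boundaries sm A B (int i - 1) j"
      then obtain c where "c \<in> kchains A (int i) j" "x - kdiff sm c \<in> kchains B (int i - 1) j"
        by (auto simp: koszul_boundaries_def)
      moreover from this have "0 - (x - kdiff sm c) \<in> kchains B (int i - 1) j"
        by (metis kchains_diff[OF B] kchains_0[OF B])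
      ultimately show "\<exists>c\<in>kchains A (int i) j. kdiff sm c - x \<in> kchains B (int i - 1) j"
        by (intro bexI[of _ c]) simp_all
    next
      fix c :: "'n set \<Rightarrow> 'v" assume c: "c \<in> kchains A (int i) j"
      have "kdiff sm c \<in> koszul_boundaries sm A B (int i - 1) j"
        using kdiff_chain[OF A c] c kchains_0[OF B] unfolding koszul_boundaries_def by (auto intro!: bexI[of _ c])
      then show "\<exists>x\<in>koszul_boundaries sm A B (int i - 1) j. kdiff sm c - x \<in> kchains B (int i - 1) j"
        by (intro bexI[of _ "kdiff sm c"]) (auto simp: kchains_0[OF B])
    next
      fix x c assume "c \<in> kchains A (int i) j" and xc: "kdiff sm c - x \<in> kchains B (int i - 1) j"
      then have "c \<in> koszul_cycles sm A B (int i) j \<longleftrightarrow> kdiff sm c \<in> kchains B (int i - 1) j" by (simp add: koszul_cycles_def)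
      also have "\<dots> \<longleftrightarrow> x \<in> kchains B (int i - 1) j"
        using kchains_add[OF B xc, of x] kchains_diff[OF B _ xc, of "kdiff sm c"] by auto
      finally show "x \<in> kchains B (int i - 1) j \<longleftrightarrow> c \<in> koszul_cycles sm A B (int i) j" by simp
    qed
    have "kchains B (int i) j \<subseteq> koszul_cycles sm A B (int i) j" using kbB kbz by blast
    from chain_space.qdim_add[OF sub(1,2) this kzA z c]
    have "(b (Suc i) + h i) + b i = (?n choose i) * r (j - int i)"
      by (rule chain_space.qdim_unique[OF sub(1) _ qdim_kchains[OF A B r]])
    then show ?thesis by simp
  qed
  have "(\<Sum>i\<le>?n. (-1) ^ i * int (?n choose i) * int (r (j - int i))) =
      (\<Sum>i\<le>?n. (-1) ^ i * int (h i) + (-1) ^ i * (int (b (Suc i)) + int (b i)))"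
  proof (intro sum.cong refl)
    fix i assume "i \<in> {..?n}"
    then have "int (?n choose i) * int (r (j - int i)) = int (h i) + int (b (Suc i)) + int (b i)"
      using rel[of i] by (metis atMost_iff of_nat_add of_nat_mult)
    then show "(-1) ^ i * int (?n choose i) * int (r (j - int i)) =
       (-1) ^ i * int (h i) + (-1) ^ i * (int (b (Suc i)) + int (b i))"
      by (simp only: mult.assoc distrib_left add.assoc)
  qed
  also have "\<dots> = (\<Sum>i\<le>?n. (-1) ^ i * int (h i)) + (\<Sum>i\<le>?n. (-1) ^ i * (int (b (Suc i)) + int (b i)))"
    by (rule sum.distrib)
  also have "(\<Sum>i\<le>?n. (-1) ^ i * (int (b (Suc i)) + int (b i))) = 0"
    using alternating_telescope[of "\<lambda>i. int (b i)" ?n] b0 bn by simp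
  finally show ?thesis by simp
qed

end

subsection \<open>Acyclicity of the Koszul complex of the polynomial ring\<close>

text \<open>Division by a variable, restricted to quotient monomials without earlier variables. The
  restriction makes s the first vertex of the support, as the cone contraction demands.\<close>

lift_definition div_var :: "'n::finite \<Rightarrow> ('n, 'k::field) mpoly \<Rightarrow> ('n, 'k) mpoly"
  is "\<lambda>s p m. p (m + single s 1) when (\<forall>t. var_rank t < var_rank s \<longrightarrow> lookup m t = 0)"
proof -
  fix s :: 'n and p :: "('n \<Rightarrow>\<^sub>0 nat) \<Rightarrow> 'k"
  assume fin: "finite {m. p m \<noteq> 0}"
  have "finite ((\<lambda>m. m + single s 1) -` {m. p m \<noteq> 0})"
    by (rule finite_vimageI[OF fin]) (simp add: inj_def)
  then show "finite {m. (p (m + single s 1) when (\<forall>t. var_rank t < var_rank s \<longrightarrow> lookup m t = 0)) \<noteq> 0}"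
    by (rule rev_finite_subset) auto
qed

lemma lookup_div_var:
  "lookup (div_var s p) m =
    (lookup p (m + single s 1) when (\<forall>t. var_rank t < var_rank s \<longrightarrow> lookup m t = 0))"
  by (simp add: div_var.rep_eq)

lemma div_var_homog:
  assumes "p \<in> homog_part d" "d = e + 1"
  shows "div_var s p \<in> homog_part e"
  unfolding homog_part_def
proof (intro CollectI ballI)
  fix m assume "m \<in> keys (div_var s p)"
  then have "m + single s 1 \<in> keys p"
    by (auto simp: in_keys_iff lookup_div_var)
  then have "int (monom_deg (m + single s 1)) = d" using assms(1) unfolding homog_part_def by blast
  then show "int (monom_deg m) = e" using assms(2) by (simp add: monom_deg_add)
qed

definition first :: "'n::finite set \<Rightarrow> 'n" where
  "first S = arg_min_on var_rank S"

lemma first_in: "S \<noteq> {} \<Longrightarrow> first S \<in> S"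
  and first_le: "s \<in> S \<Longrightarrow> s \<noteq> first S \<Longrightarrow> var_rank (first S) < var_rank s"
  using arg_min_if_finite[OF finite[of S], of var_rank] var_rank_less_linear[of s "first S"]
  by (auto simp: first_def)

lemma first_eqI:
  assumes "s \<in> S" "\<And>t. t \<in> S \<Longrightarrow> t \<noteq> s \<Longrightarrow> var_rank s < var_rank t"
  shows "first S = s"
  using assms first_in[of S] first_le[of s S] by (metis empty_iff less_asym)

text \<open>In multidegree \<open>\<alpha>\<close> the Koszul complex is the augmented chain complex of the full simplex on
  the support of \<open>\<alpha>\<close>; this is the cone contraction towards the first vertex of the support.\<close>

definition contraction :: "('n::finite set \<Rightarrow> ('n, 'k::field) mpoly) \<Rightarrow> 'n set \<Rightarrow> ('n, 'k) mpoly" where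
  "contraction c S = (if S = {} then 0 else div_var (first S) (c (S - {first S})))"

text \<open>The coefficient at m of the component S has a multidegree with support S \<union> keys
  m. Reading the contraction coefficientwise puts the cone vertex s in terms of that support
  alone.\<close>

lemma lookup_contraction:
  assumes "S \<union> keys m \<noteq> {}"
  defines "s \<equiv> first (S \<union> keys m)"
  shows "lookup (contraction c S) m =
    (if s \<in> S then lookup (c (S - {s})) (m + single s 1) else 0)"
proof (cases "s \<in> S")
  case True
  have f: "first S = s"
    by (rule first_eqI[OF True]) (use first_le s_def in blast)
  have "lookup m t = 0" if "var_rank t < var_rank s" for t
    using that first_le[of t "S \<union> keys m"] unfolding s_def
    by (metis Un_iff in_keys_iff less_asym less_irrefl)
  then show ?thesis using True f by (auto simp: contraction_def lookup_div_var)
next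
  case False
  have s: "s \<in> keys m" using first_in[OF assms(1)] False by (auto simp: s_def)
  show ?thesis
  proof (cases "S = {}")
    case ne: False
    have "first S \<noteq> s" using first_in[OF ne] False by auto
    then have "var_rank s < var_rank (first S)"
      using first_le[of "first S" "S \<union> keys m"] first_in[OF ne] unfolding s_def by blast
    then show ?thesis using s False ne by (auto simp: contraction_def lookup_div_var in_keys_iff)
  qed (use False in \<open>simp add: contraction_def\<close>)
qed

lemma lookup_kdiff:
  fixes c :: "'n::finite set \<Rightarrow> ('n, 'k::field) mpoly"
  shows "lookup (kdiff (*) c S) m =
    (\<Sum>t\<in>- S \<inter> keys m. (-1) ^ card {u \<in> S. var_rank u < var_rank t} *
       lookup (c (insert t S)) (m - single t 1))"
proof -
  have "ksgn S t * var t = single (single t 1) ((-1) ^ card {u \<in> S. var_rank u < var_rank t} :: 'k)" for t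
    by (auto simp: ksgn_def var_def minus_one_power_iff single_uminus)
  then have "lookup (kdiff (*) c S) m =
    (\<Sum>t\<in>- S. lookup (single (single t 1) ((-1) ^ card {u \<in> S. var_rank u < var_rank t}) * c (insert t S)) m)"
    by (simp add: kdiff_def lookup_sum)
  also have "\<dots> = (\<Sum>t\<in>- S. if t \<in> keys m then (-1) ^ card {u \<in> S. var_rank u < var_rank t} *
       lookup (c (insert t S)) (m - single t 1) else 0)"
  proof (intro sum.cong refl)
    fix t assume "t \<in> - S"
    let ?x = "(-1) ^ card {u \<in> S. var_rank u < var_rank t} :: 'k"
    show "lookup (single (single t 1) ?x * c (insert t S)) m =
      (if t \<in> keys m then ?x * lookup (c (insert t S)) (m - single t 1) else 0)"
    proof (cases "t \<in> keys m")
      case True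
      then have mm: "m = single t 1 + (m - single t 1)"
        by (intro poly_mapping_eqI) (auto simp: lookup_add lookup_minus lookup_single when_def in_keys_iff)
      have "lookup (single (single t 1) ?x * c (insert t S))
          (single t 1 + (m - single t 1)) =
          ?x * lookup (c (insert t S)) (m - single t 1)"
        by (rule lookup_single_mult(1))
      then show ?thesis using True unfolding mm[symmetric] by simp
    next
      case False
      have "m \<noteq> single t 1 + q" for q
        using False by (auto simp: in_keys_iff lookup_add)
      then have "lookup (single (single t 1) ?x * c (insert t S)) m = 0"
        by (rule lookup_single_mult(2))
      then show ?thesis using False by simp
    qed
  qed
  also have "\<dots> = (\<Sum>t\<in>- S \<inter> keys m. (-1) ^ card {u \<in> S. var_rank u < var_rank t} *
       lookup (c (insert t S)) (m - single t 1))"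
    by (rule sum.inter_restrict[symmetric]) simp
  finally show ?thesis .
qed

text \<open>If the cone vertex s is outside S, only t = s survives in the first term and the second
  vanishes. If s is in S, the summand of s in the second term is the identity and all others cancel
  against the first.\<close>

lemma contraction_homotopy:
  fixes c :: "'n::finite set \<Rightarrow> ('n, 'k::field) mpoly"
  assumes ne: "S \<union> keys m \<noteq> {}"
  shows "lookup (kdiff (*) (contraction c) S) m + lookup (contraction (kdiff (*) c) S) m =
    lookup (c S) m"
proof -
  define s where "s = first (S \<union> keys m)"
  let ?L = "lookup"
  let ?x = "\<lambda>t. single t (1::nat)"
  let ?e = "\<lambda>S t. (-1) ^ card {u \<in> S. var_rank u < var_rank t} :: 'k"
  have sin: "s \<in> S \<union> keys m" unfolding s_def by (rule first_in[OF ne])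
  have smin: "var_rank s < var_rank t" if "t \<in> S \<union> keys m" "t \<noteq> s" for t
    using first_le that unfolding s_def by blast
  \<comment> \<open>The differential moves t from the monomial into the set and keeps the support,
    so one vertex s serves all terms.\<close>
  have supp: "insert t S \<union> keys (m - ?x t) = S \<union> keys m"
    if "t \<in> keys m" for t
    using that by (auto simp: in_keys_iff lookup_minus lookup_single when_def split: if_splits)
  have D: "?L (kdiff (*) (contraction c) S) m =
    (\<Sum>t\<in>- S \<inter> keys m. ?e S t * (if s \<in> insert t S then ?L (c (insert t S - {s})) (m - ?x t + ?x s) else 0))"
    unfolding lookup_kdiff
  proof (intro sum.cong refl arg_cong2[where f = "(*)"])
    fix t assume "t \<in> - S \<inter> keys m"
    then have t: "insert t S \<union> keys (m - ?x t) = S \<union> keys m" using supp by blast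
    show "?L (contraction c (insert t S)) (m - ?x t) =
        (if s \<in> insert t S then ?L (c (insert t S - {s})) (m - ?x t + ?x s) else 0)"
      using lookup_contraction[of "insert t S" "m - ?x t" c] ne unfolding t s_def by blast
  qed
  show ?thesis
  proof (cases "s \<in> S")
    case False
    then have sm: "s \<in> keys m" using sin by blast
    have e1: "?e S s = 1"
    proof -
      have "{u \<in> S. var_rank u < var_rank s} = {}" using smin False by (auto dest: less_asym)
      then show ?thesis by (simp only: card.empty power_0)
    qed
    have ms: "m - ?x s + ?x s = m"
      using sm by (intro poly_mapping_eqI) (auto simp: lookup_add lookup_minus lookup_single when_def in_keys_iff)
    have "?L (kdiff (*) (contraction c) S) m = (\<Sum>t\<in>{s}. ?e S t * (if s \<in> insert t S then ?L (c (insert t S - {s})) (m - ?x t + ?x s) else 0))"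
      unfolding D by (rule sum.mono_neutral_right) (use False sm in auto)
    also have "\<dots> = ?L (c S) m" using False e1 ms by simp
    finally show ?thesis
      using lookup_contraction[OF ne, of "kdiff (*) c"] False unfolding s_def by simp
  next
    case True
    define T where "T = S - {s}"
    have T: "S = insert s T" "s \<notin> T" using True by (auto simp: T_def)
    have keys: "keys (m + ?x s) = insert s (keys m)"
      by (auto simp: in_keys_iff lookup_add lookup_single when_def split: if_splits)
    have set: "- T \<inter> keys (m + ?x s) = insert s (- S \<inter> keys m)"
      unfolding keys using T by auto
    have e1: "?e T s = 1"
    proof -
      have "{u \<in> T. var_rank u < var_rank s} = {}" using smin T by (auto dest: less_asym)
      then show ?thesis by (simp only: card.empty power_0)
    qed
    have "?L (contraction (kdiff (*) c) S) m = ?L (kdiff (*) c T) (m + ?x s)"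
      using lookup_contraction[OF ne, of "kdiff (*) c"] True unfolding s_def T_def by simp
    also have "\<dots> = ?e T s * ?L (c (insert s T)) (m + ?x s - ?x s) +
       (\<Sum>t\<in>- S \<inter> keys m. ?e T t * ?L (c (insert t T)) (m + ?x s - ?x t))"
      unfolding lookup_kdiff set using True by (subst sum.insert) auto
    also have "?e T s * ?L (c (insert s T)) (m + ?x s - ?x s) = ?L (c S) m"
      unfolding e1 T(1)[symmetric] by simp
    also have "(\<Sum>t\<in>- S \<inter> keys m. ?e T t * ?L (c (insert t T)) (m + ?x s - ?x t)) =
      (\<Sum>t\<in>- S \<inter> keys m. - (?e S t * (if s \<in> insert t S then ?L (c (insert t S - {s})) (m - ?x t + ?x s) else 0)))"
    proof (intro sum.cong refl)
      fix t assume t: "t \<in> - S \<inter> keys m"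
      then have ts: "t \<noteq> s" "t \<notin> T" using T by auto
      \<comment> \<open>As s precedes the rest of the support, adding it to T reverses every
        remaining sign.\<close>
      have "{u \<in> S. var_rank u < var_rank t} = insert s {u \<in> T. var_rank u < var_rank t}"
        using smin[of t] t ts T by auto
      then have "?e S t = - ?e T t" using T by simp
      moreover have "m + ?x s - ?x t = m - ?x t + ?x s"
        using t ts by (intro poly_mapping_eqI) (auto simp: lookup_add lookup_minus lookup_single when_def in_keys_iff)
      moreover have "insert t S - {s} = insert t T" using T ts by auto
      ultimately show "?e T t * ?L (c (insert t T)) (m + ?x s - ?x t) =
         - (?e S t * (if s \<in> insert t S then ?L (c (insert t S - {s})) (m - ?x t + ?x s) else 0))"
        using True by simp
    qed
    finally show ?thesis unfolding D by (simp add: sum_negf)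
  qed
qed

lemma contraction_chain:
  assumes c: "c \<in> kchains homog_part a j"
  shows "contraction c \<in> kchains homog_part (a + 1) j"
  unfolding kchains_def
proof (intro CollectI allI)
  fix S :: "'a set"
  show "if int (card S) = a + 1 then contraction c S \<in> homog_part (j - (a + 1)) else contraction c S = 0"
  proof (cases "S = {}")
    case True
    then show ?thesis by (simp add: contraction_def)
  next
    case False
    have "int (card S) = int (card (S - {first S})) + 1"
      using first_in[OF False] by (metis card_Suc_Diff1 finite of_nat_Suc add.commute)
    then have e: "int (card (S - {first S})) = a \<longleftrightarrow> int (card S) = a + 1" by linarith
    have "if int (card (S - {first S})) = a then c (S - {first S}) \<in> homog_part (j - a) else c (S - {first S}) = 0"
      using c unfolding kchains_def by blast
    then have c': "if int (card S) = a + 1 then c (S - {first S}) \<in> homog_part (j - a) else c (S - {first S}) = 0"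
      unfolding e .
    have z: "div_var s 0 = (0 :: ('a, 'b) mpoly)" for s
      by (rule poly_mapping_eqI) (simp add: lookup_div_var)
    show ?thesis
    proof (cases "int (card S) = a + 1")
      case True
      have "div_var (first S) (c (S - {first S})) \<in> homog_part (j - (a + 1))"
        by (rule div_var_homog[of _ "j - a"]) (use c' True in simp_all)
      then show ?thesis using True False by (simp add: contraction_def)
    next
      case n: False
      then show ?thesis using c' False z by (simp add: contraction_def)
    qed
  qed
qed

text \<open>Only the multidegree 0 lacks a first vertex. It occurs solely in the constant
  coefficient of \<open>c {}\<close>, which is assumed to vanish.\<close>

lemma koszul_exact:
  fixes c :: "'n::finite set \<Rightarrow> ('n, 'k::field) mpoly"
  assumes c: "c \<in> kchains homog_part a j" "kdiff (*) c = 0" "lookup (c {}) 0 = 0"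
  shows "kdiff (*) (contraction c) = c"
proof (rule ext, rule poly_mapping_eqI)
  fix S m
  have z: "contraction (kdiff (*) c) S = 0"
    unfolding c(2) by (rule poly_mapping_eqI) (simp add: contraction_def lookup_div_var)
  show "lookup (kdiff (*) (contraction c) S) m = lookup (c S) m"
  proof (cases "S \<union> keys m = {}")
    case True
    then have "S = {}" "m = 0" by auto
    then show ?thesis using c(3) by (simp add: lookup_kdiff)
  next
    case False
    from contraction_homotopy[OF this, of c] show ?thesis by (simp add: z)
  qed
qed

interpretation Qmod: poly_module "(*) :: ('n::finite, 'k::field) mpoly \<Rightarrow> _ \<Rightarrow> _"
  by (rule poly_module.intro, rule module_mult)

interpretation Vmod: poly_module "vec_scale :: ('n::finite, 'k::field) mpoly \<Rightarrow> _ \<Rightarrow> _"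
  by (rule poly_module.intro, rule module_vec_scale)

interpretation QV: poly_module_pair "(*) :: ('n::finite, 'k::field) mpoly \<Rightarrow> _ \<Rightarrow> _"
    "vec_scale :: ('n, 'k) mpoly \<Rightarrow> _ \<Rightarrow> _"
  by unfold_locales

interpretation kvec: vector_space "vec_scale :: 'k::field \<Rightarrow> _ \<Rightarrow> _"
  by unfold_locales (auto intro!: poly_mapping_eqI simp: lookup_add algebra_simps)

lemma gmod_homog_part: "Qmod.gmod homog_part"
  unfolding Qmod.gmod_def by (auto intro: homog_part_add) (metis add.commute homog_part_mult)

section \<open>Complexes of free modules\<close>

lemma lin_ext_eq:
  assumes "finite U" "keys v \<subseteq> U"
  shows "lin_ext D v = (\<Sum>b\<in>U. vec_scale (lookup v b) (D b))"
  unfolding lin_ext_def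
  by (rule sum.mono_neutral_left) (use assms in \<open>auto simp: in_keys_iff intro!: poly_mapping_eqI\<close>)

lemma vec_scale_add_left: "vec_scale (a + b) v = vec_scale a v + vec_scale (b :: 'r::comm_ring_1) v"
  by (rule poly_mapping_eqI) (simp add: lookup_add distrib_right)

lemma lin_ext_add: "lin_ext D (u + v) = lin_ext D u + lin_ext D (v :: nat \<Rightarrow>\<^sub>0 'r::comm_ring_1)"
proof -
  let ?U = "keys u \<union> keys v"
  have "keys (u + v) \<subseteq> ?U" by (rule keys_add)
  then show ?thesis
    by (subst (1 2 3) lin_ext_eq[of ?U])
      (auto simp: lookup_add sum.distrib vec_scale_add_left)
qed

lemma lin_ext_scale: "lin_ext D (vec_scale c v) = vec_scale c (lin_ext D (v :: nat \<Rightarrow>\<^sub>0 'r::comm_ring_1))"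
proof -
  have "keys (vec_scale c v) \<subseteq> keys v" by (auto simp: in_keys_iff)
  then show ?thesis
    by (subst (1 2) lin_ext_eq[of "keys v"])
      (auto simp: lookup_sum sum_distrib_left mult.assoc intro!: poly_mapping_eqI)
qed

lemma lin_ext_0 [simp]: "lin_ext D 0 = 0"
  by (simp add: lin_ext_def)

lemma lin_ext_sum: "lin_ext D (\<Sum>i\<in>I. v i) = (\<Sum>i\<in>I. lin_ext D (v i :: nat \<Rightarrow>\<^sub>0 'r::comm_ring_1))"
  by (induction I rule: infinite_finite_induct) (auto simp: lin_ext_add)

lemma lin_ext_diff: "lin_ext D (u - v) = lin_ext D u - lin_ext D (v :: nat \<Rightarrow>\<^sub>0 'r::comm_ring_1)"
  by (metis add_diff_cancel_right' diff_add_cancel lin_ext_add)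

lemma lin_ext_kdiff:
  fixes c :: "'n::finite set \<Rightarrow> (nat \<Rightarrow>\<^sub>0 ('n, 'k::field) mpoly)"
  shows "lin_ext D (kdiff vec_scale c S) = kdiff vec_scale (\<lambda>S. lin_ext D (c S)) S"
  by (simp add: kdiff_def lin_ext_sum lin_ext_scale)

lemma gmod_free_part: "Vmod.gmod (free_part F i)"
  unfolding Vmod.gmod_def
proof (intro conjI allI ballI)
  show "0 \<in> free_part F i d" for d by (simp add: free_part_def free_mod_def)
next
  fix d u v assume "u \<in> free_part F i d" "v \<in> free_part F i d"
  then show "u + v \<in> free_part F i d"
    using keys_add[of u v] by (auto simp: free_part_def free_mod_def lookup_add homog_part_add)
next
  fix d e and p :: "('a, 'b) mpoly" and v
  assume p: "p \<in> homog_part e" and v: "v \<in> free_part F i d"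
  have "keys (vec_scale p v) \<subseteq> keys v" by (auto simp: in_keys_iff)
  moreover have "p * lookup v b \<in> homog_part (d + e - gdeg F i b)" for b
  proof -
    have "lookup v b \<in> homog_part (d - gdeg F i b)" using v by (simp add: free_part_def)
    from homog_part_mult[OF p this] show ?thesis by (simp add: algebra_simps)
  qed
  ultimately show "vec_scale p v \<in> free_part F i (d + e)"
    using v by (auto simp: free_part_def free_mod_def)
qed

section \<open>Homogeneous components of elements of free modules\<close>

lemma free_part_mod: "v \<in> free_part F i d \<Longrightarrow> v \<in> free_mod F i"
  by (simp add: free_part_def)

definition vcomp :: "(nat \<Rightarrow> int) \<Rightarrow> int \<Rightarrow> (nat \<Rightarrow>\<^sub>0 ('n::finite, 'k::field) mpoly) \<Rightarrow> (nat \<Rightarrow>\<^sub>0 ('n, 'k) mpoly)" where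
  "vcomp g d v = (\<Sum>b\<in>keys v. single b (hcomp (d - g b) (lookup v b)))"

lemma lookup_vcomp: "lookup (vcomp g d v) b = hcomp (d - g b) (lookup v b)"
proof -
  have "lookup (vcomp g d v) b =
    (\<Sum>b'\<in>keys v. if b' = b then hcomp (d - g b) (lookup v b) else 0)"
    unfolding vcomp_def lookup_sum by (intro sum.cong) (auto simp: lookup_single when_def)
  also have "\<dots> = hcomp (d - g b) (lookup v b)"
    by (auto simp: in_keys_iff)
  finally show ?thesis .
qed

lemma vcomp_in: "v \<in> free_mod F i \<Longrightarrow> vcomp (gdeg F i) d v \<in> free_part F i d"
  by (auto simp: free_part_def free_mod_def lookup_vcomp hcomp_in in_keys_iff) (metis hcomp_0 in_keys_iff subsetD)

lemma vcomp_sum: "vcomp g d (\<Sum>i\<in>I. v i) = (\<Sum>i\<in>I. vcomp g d (v i))"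
  by (rule poly_mapping_eqI) (simp add: lookup_vcomp lookup_sum hcomp_sum)

lemma vcomp_free_part: "v \<in> free_part F i e \<Longrightarrow> vcomp (gdeg F i) d v = (if d = e then v else 0)"
proof (rule poly_mapping_eqI)
  fix b assume "v \<in> free_part F i e"
  then have "lookup v b \<in> homog_part (e - gdeg F i b)" by (simp add: free_part_def)
  from hcomp_homog[OF this, of "d - gdeg F i b"]
  show "lookup (vcomp (gdeg F i) d v) b = lookup (if d = e then v else 0) b"
    by (auto simp: lookup_vcomp)
qed

text \<open>D contains a prescribed degree d so that the d-th component of the sum can be read off
  directly.\<close>

lemma vcomp_decomp:
  obtains D where "finite D" "d \<in> D" "v = (\<Sum>e\<in>D. vcomp g e v)"
proof -
  define D where "D = insert d (\<Union>b\<in>keys v. (\<lambda>m. int (monom_deg m) + g b) ` keys (lookup v b))"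
  have D: "finite D" by (simp add: D_def)
  have "v = (\<Sum>e\<in>D. vcomp g e v)"
  proof (rule poly_mapping_eqI)
    fix b
    have "lookup v b = (\<Sum>e\<in>(\<lambda>e. e - g b) ` D. hcomp e (lookup v b))"
    proof (rule hcomp_decomp)
      fix m assume "m \<in> keys (lookup v b)"
      moreover from this have "b \<in> keys v" by (auto simp: in_keys_iff)
      ultimately have "int (monom_deg m) + g b \<in> D" by (auto simp: D_def)
      then show "int (monom_deg m) \<in> (\<lambda>e. e - g b) ` D" by (metis add_diff_cancel_right' image_eqI)
    qed (use D in simp)
    also have "\<dots> = (\<Sum>e\<in>D. hcomp (e - g b) (lookup v b))"
      by (subst sum.reindex) (auto simp: inj_on_def)
    finally show "lookup v b = lookup (\<Sum>e\<in>D. vcomp g e v) b"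
      by (simp add: lookup_sum lookup_vcomp)
  qed
  then show ?thesis using D that[of D] by (simp add: D_def)
qed

lemma lin_ext_free_part:
  assumes col: "\<And>b. b \<in> gens F (Suc i) \<Longrightarrow> col F (Suc i) b \<in> free_part F i (gdeg F (Suc i) b)"
    and v: "v \<in> free_part F (Suc i) d"
  shows "lin_ext (col F (Suc i)) v \<in> free_part F i d"
proof -
  have "vec_scale (lookup v b) (col F (Suc i) b) \<in> free_part F i d"
    if "b \<in> keys v" for b
  proof (rule Vmod.gmod_sm[OF gmod_free_part])
    show "lookup v b \<in> homog_part (d - gdeg F (Suc i) b)" using v by (simp add: free_part_def)
    show "col F (Suc i) b \<in> free_part F i (gdeg F (Suc i) b)"
      using v that by (intro col) (auto simp: free_part_def free_mod_def)
  qed simp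
  then show ?thesis unfolding lin_ext_def by (intro Vmod.gmod_sum[OF gmod_free_part])
qed

text \<open>The differential is homogeneous, hence commutes with taking components. Exactness, which
  is stated for whole modules, thereby passes to single degrees.\<close>

lemma vcomp_lin_ext:
  assumes col: "\<And>b. b \<in> gens F (Suc i) \<Longrightarrow> col F (Suc i) b \<in> free_part F i (gdeg F (Suc i) b)"
    and u: "u \<in> free_mod F (Suc i)"
  shows "vcomp (gdeg F i) d (lin_ext (col F (Suc i)) u) = lin_ext (col F (Suc i)) (vcomp (gdeg F (Suc i)) d u)"
proof -
  obtain D where D: "finite D" "d \<in> D" "u = (\<Sum>e\<in>D. vcomp (gdeg F (Suc i)) e u)"
    by (rule vcomp_decomp)
  have "vcomp (gdeg F i) d (lin_ext (col F (Suc i)) u) =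
      vcomp (gdeg F i) d (lin_ext (col F (Suc i)) (\<Sum>e\<in>D. vcomp (gdeg F (Suc i)) e u))"
    unfolding D(3)[symmetric] ..
  also have "\<dots> = (\<Sum>e\<in>D. if d = e then lin_ext (col F (Suc i)) (vcomp (gdeg F (Suc i)) e u) else 0)"
    unfolding lin_ext_sum vcomp_sum
    by (intro sum.cong refl vcomp_free_part lin_ext_free_part[OF col] vcomp_in u)
  also have "\<dots> = lin_ext (col F (Suc i)) (vcomp (gdeg F (Suc i)) d u)" using D(1,2) by simp
  finally show ?thesis .
qed

lemma contraction_zero: "contraction 0 = 0"
  by (rule ext, rule poly_mapping_eqI) (simp add: contraction_def lookup_div_var)

text \<open>A free module is a sum of shifted copies of the polynomial ring, so the contraction
  applies in each coordinate.\<close>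

lemma free_koszul_exact:
  fixes c :: "'n::finite set \<Rightarrow> (nat \<Rightarrow>\<^sub>0 ('n, 'k::field) mpoly)"
  assumes c: "c \<in> kchains (free_part F i) a j" "kdiff vec_scale c = 0"
    and c0: "\<And>b. lookup (lookup (c {}) b) 0 = 0"
  shows "\<exists>e\<in>kchains (free_part F i) (a + 1) j. c = kdiff vec_scale e"
proof -
  define cb where "cb b S = lookup (c S) b" for b S
  \<comment> \<open>There are finitely many sets S, so only finitely many coordinates occur and the
    coordinatewise contraction has finite support.\<close>
  define U where "U = (\<Union>S. keys (c S))"
  have U: "finite U" by (simp add: U_def)
  have cU: "cb b = 0" if "b \<notin> U" for b
    using that by (auto simp: U_def cb_def in_keys_iff fun_eq_iff)
  define e where "e S = (\<Sum>b\<in>U. single b (contraction (cb b) S))" for S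
  have e: "lookup (e S) b = contraction (cb b) S" for S b
  proof -
    have "lookup (e S) b = (\<Sum>b'\<in>U. if b' = b then contraction (cb b) S else 0)"
      unfolding e_def lookup_sum by (intro sum.cong) (auto simp: lookup_single when_def)
    also have "\<dots> = contraction (cb b) S"
      using U cU[of b] by (cases "b \<in> U") (simp_all add: contraction_zero)
    finally show ?thesis .
  qed
  have cb: "cb b \<in> kchains homog_part a (j - gdeg F i b)" for b
  proof -
    have *: "j - gdeg F i b - a = j - a - gdeg F i b" by simp
    show ?thesis using c(1) unfolding kchains_def cb_def free_part_def * by (auto split: if_splits)
  qed
  have kd: "lookup (kdiff vec_scale x S) b = kdiff (*) (\<lambda>S. lookup (x S) b) S"
    for x :: "'n set \<Rightarrow> (nat \<Rightarrow>\<^sub>0 ('n, 'k) mpoly)" and S b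
    by (simp add: kdiff_def lookup_sum)
  have ex: "kdiff (*) (contraction (cb b)) = cb b" for b
  proof (rule koszul_exact[OF cb])
    show "kdiff (*) (cb b) = 0" using c(2) kd[of c _ b] by (auto simp: cb_def[abs_def] fun_eq_iff)
    show "lookup (cb b {}) 0 = 0" using c0 by (simp add: cb_def)
  qed
  have "c = kdiff vec_scale e"
  proof (rule ext, rule poly_mapping_eqI)
    fix S b
    have "lookup (kdiff vec_scale e S) b = kdiff (*) (contraction (cb b)) S"
      unfolding kd e by simp
    then show "lookup (c S) b = lookup (kdiff vec_scale e S) b"
      by (simp add: ex) (simp add: cb_def)
  qed
  moreover have "e \<in> kchains (free_part F i) (a + 1) j"
    unfolding kchains_def
  proof (intro CollectI allI)
    fix S
    have con: "if int (card S) = a + 1 then contraction (cb b) S \<in> homog_part (j - gdeg F i b - (a + 1))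
        else contraction (cb b) S = 0" for b
      using contraction_chain[OF cb[of b]] unfolding kchains_def by blast
    have "keys (e S) \<subseteq> gens F i"
    proof
      fix b assume "b \<in> keys (e S)"
      then have "b \<in> U" using cU[of b]
        by (cases "b \<in> U") (simp_all add: in_keys_iff e contraction_zero)
      then obtain T where "b \<in> keys (c T)" by (auto simp: U_def)
      moreover have "c T \<in> free_part F i (j - a) \<or> c T = 0" using c(1) by (auto simp: kchains_def split: if_splits)
      ultimately show "b \<in> gens F i" by (auto simp: free_part_def free_mod_def)
    qed
    moreover have deg: "j - (a + 1) - gdeg F i b = j - gdeg F i b - (a + 1)" for b by simp
    ultimately show "if int (card S) = a + 1 then e S \<in> free_part F i (j - (a + 1)) else e S = 0"
      using con unfolding free_part_def free_mod_def deg
      by (cases "int (card S) = a + 1") (auto simp: e intro!: poly_mapping_eqI)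
  qed
  ultimately show ?thesis by blast
qed

lemma lookup_mult_0:
  fixes p q :: "('n::finite, 'k::field) mpoly"
  shows "lookup (p * q) 0 = lookup p 0 * lookup q 0"
proof -
  have z: "(0 = l + q') \<longleftrightarrow> (q' = 0 \<and> l = 0)" for l q' :: "'n \<Rightarrow>\<^sub>0 nat"
    by (auto simp: poly_mapping_eq_iff fun_eq_iff lookup_add)
  have "(\<Sum>q'. lookup q q' when 0 = l + q') = (lookup q 0 when l = 0)" for l
    unfolding z by (cases "l = 0") simp_all
  then show ?thesis by (simp add: lookup_mult mult_when)
qed

subsection \<open>Reduction modulo the variables\<close>

definition red :: "(nat \<Rightarrow>\<^sub>0 ('n, 'k::field) mpoly) \<Rightarrow> (nat \<Rightarrow>\<^sub>0 'k)" where
  "red v = Poly_Mapping.map (\<lambda>p. lookup p 0) v"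

definition unred :: "(nat \<Rightarrow>\<^sub>0 'k::field) \<Rightarrow> (nat \<Rightarrow>\<^sub>0 ('n, 'k) mpoly)" where
  "unred w = Poly_Mapping.map (single 0) w"

lemma lookup_red: "lookup (red v) b = lookup (lookup v b) 0"
  by (simp add: red_def Poly_Mapping.map.rep_eq when_def)

lemma lookup_unred: "lookup (unred w) b = single 0 (lookup w b)"
  by (simp add: unred_def Poly_Mapping.map.rep_eq when_def)

lemma red_unred [simp]: "red (unred w) = w"
  by (rule poly_mapping_eqI) (simp add: lookup_red lookup_unred)

lemma red_add: "red (u + v) = red u + red v"
  by (rule poly_mapping_eqI) (simp add: lookup_red lookup_add)

lemma red_diff_eq: "red (u - v) = red u - red v"
  by (rule poly_mapping_eqI) (simp add: lookup_red lookup_minus)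

lemma red_0 [simp]: "red 0 = 0"
  by (rule poly_mapping_eqI) (simp add: lookup_red)

lemma red_sum: "red (\<Sum>i\<in>I. v i) = (\<Sum>i\<in>I. red (v i))"
  by (induction I rule: infinite_finite_induct) (auto simp: red_add)

lemma red_scale:
  fixes v :: "nat \<Rightarrow>\<^sub>0 ('n::finite, 'k::field) mpoly"
  shows "red (vec_scale p v) = vec_scale (lookup p 0) (red v)"
  by (rule poly_mapping_eqI) (simp add: lookup_red lookup_mult_0)

lemma red_lin_ext:
  fixes v :: "nat \<Rightarrow>\<^sub>0 ('n::finite, 'k::field) mpoly"
  shows "red (lin_ext D v) = lin_ext (\<lambda>b. red (D b)) (red v)"
proof -
  have "keys (red v) \<subseteq> keys v" by (auto simp: in_keys_iff lookup_red)
  then show ?thesis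
    by (subst (1 2) lin_ext_eq[of "keys v"]) (auto simp: red_sum red_scale lookup_red)
qed

lemma red_diff_Suc: "red_diff F (Suc i) (red v) = red (lin_ext (col F (Suc i)) (v :: nat \<Rightarrow>\<^sub>0 ('n::finite, 'k::field) mpoly))"
  unfolding red_lin_ext red_diff_def by (simp add: red_def)

lemma red_in: "v \<in> free_part F i j \<Longrightarrow> red v \<in> red_part F i j"
proof -
  assume v: "v \<in> free_part F i j"
  have "b \<in> gens F i \<and> gdeg F i b = j" if "b \<in> keys (red v)" for b
  proof -
    have "lookup (lookup v b) 0 \<noteq> 0" using that by (simp add: in_keys_iff lookup_red)
    then have k: "0 \<in> keys (lookup v b)" by (simp add: in_keys_iff)
    then have "b \<in> keys v" by (auto simp: in_keys_iff)
    moreover have "lookup v b \<in> homog_part (j - gdeg F i b)" using v by (simp add: free_part_def)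
    then have "int (monom_deg (0 :: 'a \<Rightarrow>\<^sub>0 nat)) = j - gdeg F i b" using k unfolding homog_part_def by blast
    ultimately show ?thesis using v by (auto simp: free_part_def free_mod_def)
  qed
  then show ?thesis by (auto simp: red_part_def)
qed

lemma unred_in:
  assumes "w \<in> red_part F i j"
  shows "unred w \<in> free_part F i j"
proof -
  have "keys (unred w) \<subseteq> keys w" by (auto simp: in_keys_iff lookup_unred)
  moreover have "lookup (unred w) b \<in> homog_part (j - gdeg F i b)" for b
  proof (cases "b \<in> keys w")
    case True
    then have "gdeg F i b = j" using assms by (auto simp: red_part_def)
    then show ?thesis by (simp add: lookup_unred)
  next
    case False
    then show ?thesis by (simp add: lookup_unred in_keys_iff)
  qed
  ultimately show ?thesis using assms by (auto simp: free_part_def free_mod_def red_part_def)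
qed

lemma red_kdiff: "red (kdiff vec_scale (c :: 'n::finite set \<Rightarrow> (nat \<Rightarrow>\<^sub>0 ('n, 'k::field) mpoly)) S) = 0"
proof -
  have "lookup (ksgn S s * var s :: ('n, 'k) mpoly) 0 = 0" for S :: "'n set" and s
  proof -
    have "single s (1::nat) \<noteq> 0" by (metis lookup_single_eq lookup_zero zero_neq_one)
    then show ?thesis by (simp add: lookup_mult_0 var_def lookup_single when_def)
  qed
  then show ?thesis by (simp add: kdiff_def red_sum red_scale)
qed

text \<open>A vector without constant coefficients is a Koszul 0-cycle to which exactness applies:
  the kernel of the reduction is the image of the 1-chains.\<close>

lemma red_eq_0:
  fixes v :: "nat \<Rightarrow>\<^sub>0 ('n::finite, 'k::field) mpoly"
  assumes v: "v \<in> free_part F i j" "red v = 0"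
  shows "\<exists>b\<in>kchains (free_part F i) 1 j. v = kdiff vec_scale b {}"
proof -
  define c where "c S = (if S = {} then v else 0)" for S :: "'n set"
  have c: "c \<in> kchains (free_part F i) 0 j" using v(1) by (auto simp: c_def kchains_def)
  moreover have "kdiff vec_scale c = 0" by (rule ext) (simp add: kdiff_def c_def)
  moreover have "lookup (lookup (c {}) b) 0 = 0" for b
    using v(2) by (simp add: c_def flip: lookup_red)
  ultimately obtain b where "b \<in> kchains (free_part F i) 1 j" "c = kdiff vec_scale b"
    using free_koszul_exact[of c F i 0 j] by auto
  then show ?thesis by (metis c_def)
qed

section \<open>Ideals and quotients of the polynomial ring\<close>

lemma mpoly_ring_simps [simp]:
  "carrier mpoly_ring = UNIV" "monoid.mult mpoly_ring = (*)" "one mpoly_ring = 1"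
  "ring.zero mpoly_ring = 0" "add mpoly_ring = (+)"
  by (simp_all add: mpoly_ring_def)

lemma cring_mpoly_ring: "cring (mpoly_ring :: ('n::finite, 'k::field) mpoly ring)"
proof (rule cringI)
  show "abelian_group (mpoly_ring :: ('n, 'k) mpoly ring)"
  proof (rule abelian_groupI)
    fix x :: "('n, 'k) mpoly"
    show "\<exists>y\<in>carrier mpoly_ring. y \<oplus>\<^bsub>mpoly_ring\<^esub> x = \<zero>\<^bsub>mpoly_ring\<^esub>"
      by (intro bexI[of _ "- x"]) auto
  qed (auto simp: add_ac)
  show "comm_monoid (mpoly_ring :: ('n, 'k) mpoly ring)"
  proof (rule comm_monoidI)
    fix x y z :: "('n, 'k) mpoly"
    show "x \<otimes>\<^bsub>mpoly_ring\<^esub> y \<otimes>\<^bsub>mpoly_ring\<^esub> z = x \<otimes>\<^bsub>mpoly_ring\<^esub> (y \<otimes>\<^bsub>mpoly_ring\<^esub> z)"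
      unfolding mpoly_ring_simps by (rule mult.assoc)
    show "x \<otimes>\<^bsub>mpoly_ring\<^esub> y = y \<otimes>\<^bsub>mpoly_ring\<^esub> x"
      unfolding mpoly_ring_simps by (rule mult.commute)
  qed simp_all
  fix x y z :: "('n, 'k) mpoly"
  show "(x \<oplus>\<^bsub>mpoly_ring\<^esub> y) \<otimes>\<^bsub>mpoly_ring\<^esub> z = x \<otimes>\<^bsub>mpoly_ring\<^esub> z \<oplus>\<^bsub>mpoly_ring\<^esub> y \<otimes>\<^bsub>mpoly_ring\<^esub> z"
    unfolding mpoly_ring_simps by (rule distrib_right)
qed

interpretation MR: cring "mpoly_ring :: ('n::finite, 'k::field) mpoly ring"
  by (rule cring_mpoly_ring)

lemma mpoly_a_inv: "\<ominus>\<^bsub>mpoly_ring\<^esub> x = - (x :: ('n::finite, 'k::field) mpoly)"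
  using MR.minus_equality[of "- x" x] by simp

lemma ideal_mpoly_iff:
  fixes I :: "('n::finite, 'k::field) mpoly set"
  shows "ideal I mpoly_ring \<longleftrightarrow> 0 \<in> I \<and> (\<forall>a\<in>I. \<forall>b\<in>I. a + b \<in> I) \<and> (\<forall>q. \<forall>a\<in>I. q * a \<in> I)"
proof
  assume "ideal I mpoly_ring"
  then interpret ideal I mpoly_ring .
  show "0 \<in> I \<and> (\<forall>a\<in>I. \<forall>b\<in>I. a + b \<in> I) \<and> (\<forall>q. \<forall>a\<in>I. q * a \<in> I)"
    using zero_closed a_closed I_l_closed by simp
next
  assume I: "0 \<in> I \<and> (\<forall>a\<in>I. \<forall>b\<in>I. a + b \<in> I) \<and> (\<forall>q. \<forall>a\<in>I. q * a \<in> I)"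
  have "a * q \<in> I" if "a \<in> I" for a q using I that by (metis mult.commute)
  have "- a \<in> I" if "a \<in> I" for a using I that by (metis mult_minus1)
  then have "subgroup I (add_monoid mpoly_ring)"
    using I by (intro MR.add.subgroupI) (auto simp: mpoly_a_inv)
  then show "ideal I mpoly_ring"
    using I \<open>\<And>a q. a \<in> I \<Longrightarrow> a * q \<in> I\<close> by (intro idealI MR.ring_axioms) auto
qed

context
  fixes I :: "('n::finite, 'k::field) mpoly set"
  assumes ideal: "ideal I mpoly_ring"
begin

lemma ideal_mpoly_0: "0 \<in> I" and ideal_mpoly_add: "a \<in> I \<Longrightarrow> b \<in> I \<Longrightarrow> a + b \<in> I"
  and ideal_mpoly_mult: "a \<in> I \<Longrightarrow> q * a \<in> I"
  using ideal by (auto simp: ideal_mpoly_iff)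

lemma ideal_mpoly_uminus: "a \<in> I \<Longrightarrow> - a \<in> I"
  using ideal_mpoly_mult[of a "- 1"] by simp

lemma ideal_mpoly_diff: "a \<in> I \<Longrightarrow> b \<in> I \<Longrightarrow> a - b \<in> I"
  using ideal_mpoly_add[of a "- b"] ideal_mpoly_uminus[of b] by simp

lemma coset_eq_iff: "I +>\<^bsub>mpoly_ring\<^esub> p = I +>\<^bsub>mpoly_ring\<^esub> q \<longleftrightarrow> p - q \<in> I"
proof -
  have c: "x \<in> I +>\<^bsub>mpoly_ring\<^esub> p \<longleftrightarrow> x - p \<in> I" for x p
    by (auto simp: a_r_coset_def r_coset_def) (metis diff_add_cancel)
  show ?thesis
  proof
    assume "I +>\<^bsub>mpoly_ring\<^esub> p = I +>\<^bsub>mpoly_ring\<^esub> q"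
    then have "p \<in> I +>\<^bsub>mpoly_ring\<^esub> q" using c[of p p] ideal_mpoly_0 by auto
    then show "p - q \<in> I" by (simp add: c)
  next
    assume pq: "p - q \<in> I"
    have "x - p \<in> I \<longleftrightarrow> x - q \<in> I" for x
    proof -
      have "x - q = (x - p) + (p - q)" "x - p = (x - q) - (p - q)" by simp_all
      then show ?thesis using pq ideal_mpoly_add ideal_mpoly_diff by metis
    qed
    then show "I +>\<^bsub>mpoly_ring\<^esub> p = I +>\<^bsub>mpoly_ring\<^esub> q" using c by blast
  qed
qed

lemma coset_0: "I +>\<^bsub>mpoly_ring\<^esub> 0 = I"
  by (auto simp: a_r_coset_def r_coset_def)

lemma quot_mult: "(I +>\<^bsub>mpoly_ring\<^esub> p) \<otimes>\<^bsub>mpoly_ring Quot I\<^esub> (I +>\<^bsub>mpoly_ring\<^esub> q) = I +>\<^bsub>mpoly_ring\<^esub> (p * q)"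
  using ideal.rcoset_mult_add[OF ideal, of p q] by (simp add: FactRing_def)

lemma quot_module_carrier: "carrier (quot_module I) = range (\<lambda>p. I +>\<^bsub>mpoly_ring\<^esub> p)"
  by (auto simp: quot_module_def ring.extend_def FactRing_def A_RCOSETS_def' image_def)

lemma quot_module_zero: "\<zero>\<^bsub>quot_module I\<^esub> = I"
  by (simp add: quot_module_def ring.extend_def FactRing_def)

lemma quot_module_add:
  "(I +>\<^bsub>mpoly_ring\<^esub> p) \<oplus>\<^bsub>quot_module I\<^esub> (I +>\<^bsub>mpoly_ring\<^esub> q) = I +>\<^bsub>mpoly_ring\<^esub> (p + q)"
proof -
  interpret ideal I mpoly_ring by (rule ideal)
  show ?thesis using a_rcos_sum[of p q] by (simp add: quot_module_def ring.extend_def FactRing_def)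
qed

lemma quot_module_smult: "q \<odot>\<^bsub>quot_module I\<^esub> (I +>\<^bsub>mpoly_ring\<^esub> p) = I +>\<^bsub>mpoly_ring\<^esub> (q * p)"
  by (simp add: quot_module_def ring.extend_def module.fields_def quot_mult)

end

definition ipart :: "('n::finite, 'k::field) mpoly set \<Rightarrow> int \<Rightarrow> ('n, 'k) mpoly set" where
  "ipart I d = I \<inter> homog_part d"

lemma gmod_ipart: "ideal I mpoly_ring \<Longrightarrow> Qmod.gmod (ipart I)"
  using gmod_homog_part unfolding Qmod.gmod_def ipart_def
  by (auto simp: ideal_mpoly_0 ideal_mpoly_add ideal_mpoly_mult)

section \<open>Betti numbers from Koszul homology\<close>

lemma red_diff_add: "red_diff F i (u + v) = red_diff F i u + red_diff F i v"
  by (simp add: red_diff_def lin_ext_add)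

lemma red_diff_scale: "red_diff F i (vec_scale c v) = vec_scale c (red_diff F i v)"
  by (auto simp: red_diff_def lin_ext_scale intro: poly_mapping_eqI)

lemma red_part_subspace:
  fixes F :: "('n, 'k::field) free_complex"
  shows "kvec.subspace (red_part F i j)"
proof -
  have "keys (vec_scale c v) \<subseteq> keys v" for c :: 'k and v :: "nat \<Rightarrow>\<^sub>0 'k"
    by (auto simp: in_keys_iff)
  moreover have "keys (u + v) \<subseteq> keys u \<union> keys v"
    for u v :: "nat \<Rightarrow>\<^sub>0 'k" by (rule keys_add)
  ultimately show ?thesis
    unfolding kvec.subspace_def red_part_def mem_Collect_eq
    by (intro conjI ballI allI) (simp, (metis (mono_tags) Un_least order_trans mem_Collect_eq)+)
qed

locale quot_resolution =
  fixes I :: "('n::finite, 'k::field) mpoly set" and F :: "('n, 'k) free_complex" and \<epsilon>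
  assumes ideal: "ideal I mpoly_ring" and hcomp_I: "\<And>p d. p \<in> I \<Longrightarrow> hcomp d p \<in> I"
    and res: "graded_free_resolution (quot_module I) (quot_part I) F \<epsilon>"
begin

lemma finite_gens: "finite {b \<in> gens F i. gdeg F i b = j}"
  and col_in: "b \<in> gens F (Suc i) \<Longrightarrow> col F (Suc i) b \<in> free_part F i (gdeg F (Suc i) b)"
  and eps_add: "u \<in> free_mod F 0 \<Longrightarrow> v \<in> free_mod F 0 \<Longrightarrow> \<epsilon> (u + v) = \<epsilon> u \<oplus>\<^bsub>quot_module I\<^esub> \<epsilon> v"
  and eps_scale: "v \<in> free_mod F 0 \<Longrightarrow> \<epsilon> (vec_scale q v) = q \<odot>\<^bsub>quot_module I\<^esub> \<epsilon> v"
  and eps_part: "\<epsilon> ` free_part F 0 j \<subseteq> quot_part I j"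
  and eps_onto: "\<epsilon> ` free_mod F 0 = carrier (quot_module I)"
  and exact_0: "{v \<in> free_mod F 0. \<epsilon> v = I} = lin_ext (col F 1) ` free_mod F 1"
  and exact_Suc: "{v \<in> free_mod F (Suc i). lin_ext (col F (Suc i)) v = 0} =
          lin_ext (col F (Suc (Suc i))) ` free_mod F (Suc (Suc i))"
  using res quot_module_zero[OF ideal] unfolding graded_free_resolution_def by auto

abbreviation coset :: "('n, 'k) mpoly \<Rightarrow> ('n, 'k) mpoly set" where
  "coset p \<equiv> I +>\<^bsub>mpoly_ring\<^esub> p"

text \<open>For i = 0 this is the kernel of the augmentation; the zero of the quotient is the coset
  I.\<close>

definition syz :: "nat \<Rightarrow> int \<Rightarrow> (nat \<Rightarrow>\<^sub>0 ('n, 'k) mpoly) set" where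
  "syz i d = {v \<in> free_part F i d. if i = 0 then \<epsilon> v = I else lin_ext (col F i) v = 0}"

lemma diff_part: "v \<in> free_part F (Suc i) d \<Longrightarrow> lin_ext (col F (Suc i)) v \<in> free_part F i d"
  by (rule lin_ext_free_part[OF col_in])

lemma diff_in: "v \<in> free_part F (Suc i) d \<Longrightarrow> lin_ext (col F (Suc i)) v \<in> syz i d"
  using diff_part[of v i d] exact_0 exact_Suc[of "i - 1"] free_part_mod[of v F "Suc i" d]
  by (cases i) (auto simp: syz_def)

lemma diff_onto:
  assumes z: "z \<in> syz i d"
  shows "\<exists>v\<in>free_part F (Suc i) d. z = lin_ext (col F (Suc i)) v"
proof -
  have zf: "z \<in> free_part F i d" using z by (simp add: syz_def)
  have "\<exists>u\<in>free_mod F (Suc i). z = lin_ext (col F (Suc i)) u"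
    using z exact_0 exact_Suc[of "i - 1"] free_part_mod[OF zf] by (cases i) (auto simp: syz_def)
  then obtain u where u: "u \<in> free_mod F (Suc i)" "z = lin_ext (col F (Suc i)) u" by blast
  \<comment> \<open>z is its own component of degree d, so the preimage u may be replaced by its
    component of degree d.\<close>
  have "z = vcomp (gdeg F i) d z" using vcomp_free_part[OF zf] by simp
  also have "\<dots> = lin_ext (col F (Suc i)) (vcomp (gdeg F (Suc i)) d u)"
    unfolding u(2) by (rule vcomp_lin_ext[OF col_in u(1)])
  finally show ?thesis using vcomp_in[OF u(1)] by blast
qed

lemma gmod_syz: "Vmod.gmod (syz i)"
proof -
  note g = gmod_free_part[of F i, unfolded Vmod.gmod_def]
  have 0: "0 \<in> free_mod F 0" by (simp add: free_mod_def)
  \<comment> \<open>The resolution only states additivity and compatibility with scalars; the value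
    at 0 follows from the scalar 0.\<close>
  have eps0: "\<epsilon> 0 = I"
  proof -
    obtain p where "\<epsilon> 0 = coset p" using eps_onto 0 unfolding quot_module_carrier[OF ideal] by blast
    moreover have "\<epsilon> (vec_scale 0 0) = 0 \<odot>\<^bsub>quot_module I\<^esub> \<epsilon> 0" by (rule eps_scale[OF 0])
    ultimately show ?thesis by (simp add: quot_module_smult[OF ideal] coset_0[OF ideal])
  qed
  have II: "I \<oplus>\<^bsub>quot_module I\<^esub> I = I" "q \<odot>\<^bsub>quot_module I\<^esub> I = I" for q
    using quot_module_add[OF ideal, of 0 0] quot_module_smult[OF ideal, of q 0] by (auto simp: coset_0[OF ideal])
  show ?thesis
    unfolding Vmod.gmod_def
  proof (intro conjI allI ballI)
    show "0 \<in> syz i d" for d using g eps0 by (simp add: syz_def)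
  next
    fix d a b assume "a \<in> syz i d" "b \<in> syz i d"
    then have ab: "a \<in> free_part F i d" "b \<in> free_part F i d"
      "if i = 0 then \<epsilon> a = I else lin_ext (col F i) a = 0" "if i = 0 then \<epsilon> b = I else lin_ext (col F i) b = 0"
      by (simp_all add: syz_def)
    have "\<epsilon> (a + b) = I" if "i = 0"
    proof -
      have "\<epsilon> (a + b) = \<epsilon> a \<oplus>\<^bsub>quot_module I\<^esub> \<epsilon> b"
        by (rule eps_add) (use ab that free_part_mod in auto)
      moreover have "\<epsilon> a = I" "\<epsilon> b = I" using ab that by simp_all
      ultimately show ?thesis by (simp only: II)
    qed
    then show "a + b \<in> syz i d" using ab g by (simp add: syz_def lin_ext_add split: if_splits)
  next
    fix d e a and p :: "('n, 'k) mpoly" assume p: "p \<in> homog_part e" and "a \<in> syz i d"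
    then have a: "a \<in> free_part F i d" "if i = 0 then \<epsilon> a = I else lin_ext (col F i) a = 0"
      by (simp_all add: syz_def)
    have "\<epsilon> (vec_scale p a) = I" if "i = 0"
    proof -
      have "\<epsilon> (vec_scale p a) = p \<odot>\<^bsub>quot_module I\<^esub> \<epsilon> a"
        by (rule eps_scale) (use a that free_part_mod in auto)
      moreover have "\<epsilon> a = I" using a that by simp
      ultimately show ?thesis by (simp only: II)
    qed
    then show "vec_scale p a \<in> syz i (d + e)"
      using a p g by (simp add: syz_def lin_ext_scale split: if_splits)
  qed
qed

lemma syz_subset: "syz i d \<subseteq> free_part F i d"
  by (auto simp: syz_def)

text \<open>Lift without regard to degree and keep the component of degree d. The images of the
  components sum to q modulo I, and since I is homogeneous the degree d part of this congruence
  holds by itself.\<close>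

lemma eps_lift:
  assumes q: "q \<in> homog_part d"
  shows "\<exists>v\<in>free_part F 0 d. \<epsilon> v = coset q"
proof -
  obtain v where v: "v \<in> free_mod F 0" "\<epsilon> v = coset q"
    using eps_onto unfolding quot_module_carrier[OF ideal] by (metis imageE rangeI)
  obtain D where D: "finite D" "d \<in> D" "v = (\<Sum>e\<in>D. vcomp (gdeg F 0) e v)" by (rule vcomp_decomp)
  have "\<forall>e. \<exists>p. p \<in> homog_part e \<and> \<epsilon> (vcomp (gdeg F 0) e v) = coset p"
    using eps_part vcomp_in[OF v(1)] unfolding quot_part_def by blast
  then obtain p where p: "\<And>e. p e \<in> homog_part e" "\<And>e. \<epsilon> (vcomp (gdeg F 0) e v) = coset (p e)" by metis
  have vm: "vcomp (gdeg F 0) e v \<in> free_mod F 0" for e by (rule free_part_mod[OF vcomp_in[OF v(1)]])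
  have "(\<Sum>e\<in>E. vcomp (gdeg F 0) e v) \<in> free_mod F 0 \<and>
      \<epsilon> (\<Sum>e\<in>E. vcomp (gdeg F 0) e v) = coset (\<Sum>e\<in>E. p e)" if "finite E" "E \<noteq> {}" for E
    using that
  proof (induction E rule: finite_ne_induct)
    case (singleton e)
    then show ?case using vm p by simp
  next
    case (insert e E)
    then show ?case using vm[of e] keys_add[of "vcomp (gdeg F 0) e v" "\<Sum>e\<in>E. vcomp (gdeg F 0) e v"]
      by (auto simp: eps_add p quot_module_add[OF ideal] free_mod_def)
  qed
  from this[OF D(1)] have "coset q = coset (\<Sum>e\<in>D. p e)" using D v(2) by auto
  then have "q - (\<Sum>e\<in>D. p e) \<in> I" by (simp add: coset_eq_iff[OF ideal])
  then have "hcomp d (q - (\<Sum>e\<in>D. p e)) \<in> I" by (rule hcomp_I)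
  moreover have "hcomp d (q - (\<Sum>e\<in>D. p e)) = q - p d"
  proof -
    have "hcomp d (q - (\<Sum>e\<in>D. p e)) + hcomp d (\<Sum>e\<in>D. p e) = hcomp d q"
      by (simp flip: hcomp_add)
    moreover have "hcomp d (\<Sum>e\<in>D. p e) = p d"
      using D(1,2) by (simp add: hcomp_sum hcomp_homog[OF p(1)])
    ultimately show ?thesis using hcomp_homog[OF q] by (simp add: algebra_simps)
  qed
  ultimately have "\<epsilon> (vcomp (gdeg F 0) d v) = coset q"
    by (simp add: p coset_eq_iff[OF ideal]) (metis ideal_mpoly_uminus[OF ideal] minus_diff_eq)
  then show ?thesis using vcomp_in[OF v(1)] by blast
qed

text \<open>The augmentation identifies F 0 modulo its syzygies with Q / I: q and v are related when
  v maps to the coset of q.\<close>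

lemma koszul_dim_augmentation:
  assumes "koszul_dim (*) homog_part (ipart I) a j h"
  shows "koszul_dim vec_scale (free_part F 0) (syz 0) a j h"
proof (rule QV.koszul_dim_transfer[where G = "\<lambda>q v. v \<in> free_mod F 0 \<and> \<epsilon> v = coset q", OF _ _ _ _ _ _ _ _ _ assms])
  fix p q u v assume "u \<in> free_mod F 0 \<and> \<epsilon> u = coset p" "v \<in> free_mod F 0 \<and> \<epsilon> v = coset q"
  then show "u + v \<in> free_mod F 0 \<and> \<epsilon> (u + v) = coset (p + q)"
    using keys_add[of u v] by (auto simp: eps_add quot_module_add[OF ideal] free_mod_def)
next
  fix p q v assume "v \<in> free_mod F 0 \<and> \<epsilon> v = coset q"
  moreover have "keys (vec_scale p v) \<subseteq> keys v" by (auto simp: in_keys_iff)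
  ultimately show "vec_scale p v \<in> free_mod F 0 \<and> \<epsilon> (vec_scale p v) = coset (p * q)"
    by (auto simp: eps_scale quot_module_smult[OF ideal] free_mod_def)
next
  fix d and q :: "('n, 'k) mpoly" assume "q \<in> homog_part d"
  then show "\<exists>v\<in>free_part F 0 d. v \<in> free_mod F 0 \<and> \<epsilon> v = coset q"
    using eps_lift free_part_mod by blast
next
  fix d v assume v: "v \<in> free_part F 0 d"
  then have "\<epsilon> v \<in> quot_part I d" using eps_part by blast
  then obtain q where "q \<in> homog_part d" "\<epsilon> v = coset q" unfolding quot_part_def by (elim imageE)
  then show "\<exists>q\<in>homog_part d. v \<in> free_mod F 0 \<and> \<epsilon> v = coset q"
    using free_part_mod[OF v] by (intro bexI[of _ q] conjI)
next
  fix d v and q :: "('n, 'k) mpoly" assume "q \<in> homog_part d" "v \<in> free_part F 0 d" "v \<in> free_mod F 0 \<and> \<epsilon> v = coset q"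
  then show "q \<in> ipart I d \<longleftrightarrow> v \<in> syz 0 d"
    using coset_eq_iff[OF ideal, of q 0] by (auto simp: ipart_def syz_def coset_0[OF ideal])
qed (rule gmod_homog_part gmod_ipart ideal gmod_free_part gmod_syz)+

text \<open>The shift passes from F i / syz i to syz i, and the differential identifies syz i with F
  (i + 1) / syz (i + 1). The bound b \<ge> 1 stays clear of Koszul degree 0, where free modules are
  not acyclic.\<close>

lemma koszul_dim_syzygy:
  assumes b: "b \<ge> 1" and h: "koszul_dim vec_scale (free_part F i) (syz i) (b + 1) j h"
  shows "koszul_dim vec_scale (free_part F (Suc i)) (syz (Suc i)) b j h"
proof -
  have "koszul_dim vec_scale (syz i) (\<lambda>_. {0}) b j h"
  proof (rule Vmod.koszul_dim_shift[OF gmod_free_part gmod_syz syz_subset _ h])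
    fix c :: "'n set \<Rightarrow> (nat \<Rightarrow>\<^sub>0 ('n, 'k) mpoly)" and b'
    assume "b' \<in> {b, b + 1}" and c: "c \<in> kchains (free_part F i) b' j" "kdiff vec_scale c = 0"
    then have "b' \<noteq> 0" using b by auto
    then have "c {} = 0" by (rule kchains_empty[OF c(1)])
    then show "\<exists>e\<in>kchains (free_part F i) (b' + 1) j. c = kdiff vec_scale e"
      by (intro free_koszul_exact c) simp
  qed
  then show ?thesis
  proof (rule Vmod.self_pair.koszul_dim_transfer[where G = "\<lambda>z v. v \<in> free_mod F (Suc i) \<and> z = lin_ext (col F (Suc i)) v", rotated -1])
    fix z z' u v assume "u \<in> free_mod F (Suc i) \<and> z = lin_ext (col F (Suc i)) u"
       "v \<in> free_mod F (Suc i) \<and> z' = lin_ext (col F (Suc i)) v"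
    then show "u + v \<in> free_mod F (Suc i) \<and> z + z' = lin_ext (col F (Suc i)) (u + v)"
      using keys_add[of u v] by (auto simp: lin_ext_add free_mod_def)
  next
    fix p z v assume "v \<in> free_mod F (Suc i) \<and> z = lin_ext (col F (Suc i)) v"
    moreover have "keys (vec_scale p v) \<subseteq> keys v" by (auto simp: in_keys_iff)
    ultimately show "vec_scale p v \<in> free_mod F (Suc i) \<and> vec_scale p z = lin_ext (col F (Suc i)) (vec_scale p v)"
      by (auto simp: lin_ext_scale free_mod_def)
  next
    fix d z assume "z \<in> syz i d"
    then show "\<exists>v\<in>free_part F (Suc i) d. v \<in> free_mod F (Suc i) \<and> z = lin_ext (col F (Suc i)) v"
      using diff_onto free_part_mod by blast
  next
    fix d v assume "v \<in> free_part F (Suc i) d"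
    then show "\<exists>z\<in>syz i d. v \<in> free_mod F (Suc i) \<and> z = lin_ext (col F (Suc i)) v"
      using diff_in free_part_mod by blast
  next
    fix d z v assume "z \<in> syz i d" "v \<in> free_part F (Suc i) d" "v \<in> free_mod F (Suc i) \<and> z = lin_ext (col F (Suc i)) v"
    then show "z \<in> {0} \<longleftrightarrow> v \<in> syz (Suc i) d" by (auto simp: syz_def)
  qed (rule gmod_syz Vmod.gmod_zero gmod_free_part)+
qed

section \<open>Homology of the reduced complex\<close>

abbreviation "tor_cycles i j \<equiv> {w \<in> red_part F i j. red_diff F i w = 0}"
abbreviation "tor_boundaries i j \<equiv> red_diff F (Suc i) ` red_part F (Suc i) j"

lemma tor_cycles_subspace: "kvec.subspace (tor_cycles i j)"
  using red_part_subspace[of F i j] unfolding kvec.subspace_def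
  by (auto simp: red_diff_add red_diff_scale) (simp add: red_diff_def)

lemma tor_boundaries_subspace: "kvec.subspace (tor_boundaries i j)"
proof -
  have R: "kvec.subspace (red_part F (Suc i) j)" by (rule red_part_subspace)
  have 0: "red_diff F (Suc i) 0 = 0" by (simp add: red_diff_def)
  show ?thesis unfolding kvec.subspace_def
  proof (intro conjI ballI allI)
    show "0 \<in> tor_boundaries i j" using kvec.subspace_0[OF R] 0 by force
  next
    fix x y assume "x \<in> tor_boundaries i j" "y \<in> tor_boundaries i j"
    then show "x + y \<in> tor_boundaries i j"
      using kvec.subspace_add[OF R] by (auto simp flip: red_diff_add)
  next
    fix c x assume "x \<in> tor_boundaries i j"
    then show "vec_scale c x \<in> tor_boundaries i j"
      using kvec.subspace_scale[OF R] by (auto simp flip: red_diff_scale)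
  qed
qed

lemma lift_boundary:
  assumes "w \<in> tor_boundaries i j"
  shows "\<exists>u\<in>free_part F (Suc i) j. w = red (lin_ext (col F (Suc i)) u)"
proof -
  obtain u where u: "u \<in> red_part F (Suc i) j" "w = red_diff F (Suc i) u" using assms by auto
  have "w = red_diff F (Suc i) (red (unred u :: nat \<Rightarrow>\<^sub>0 ('n, 'k) mpoly))" by (simp add: u(2))
  then show ?thesis unfolding red_diff_Suc using unred_in[OF u(1)] by blast
qed

lemma red_boundary:
  "u \<in> free_part F (Suc i) j \<Longrightarrow> red (lin_ext (col F (Suc i)) u) \<in> tor_boundaries i j"
  unfolding red_diff_Suc[symmetric] using red_in by blast

lemma tor_boundaries_subset: "tor_boundaries i j \<subseteq> tor_cycles i j"
proof
  fix w assume "w \<in> tor_boundaries i j"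
  then obtain u where u: "u \<in> free_part F (Suc i) j" "w = red (lin_ext (col F (Suc i)) u)"
    using lift_boundary by blast
  have "red_diff F i w = 0"
  proof (cases i)
    case (Suc i')
    have "lin_ext (col F i) (lin_ext (col F (Suc i)) u) = 0"
      using diff_in[OF u(1)] Suc by (simp add: syz_def)
    then show ?thesis unfolding u(2) Suc red_diff_Suc by simp
  qed (simp add: red_diff_def)
  then show "w \<in> tor_cycles i j" using red_in[OF diff_part[OF u(1)]] by (simp add: u(2))
qed

lemma pair: "vector_space_pair (chain_scale (vec_scale :: ('n, 'k) mpoly \<Rightarrow> (nat \<Rightarrow>\<^sub>0 ('n, 'k) mpoly) \<Rightarrow> _)) (vec_scale :: 'k \<Rightarrow> (nat \<Rightarrow>\<^sub>0 'k) \<Rightarrow> _)"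
  by (intro vector_space_pair.intro Vmod.chain_space.vector_space_axioms kvec.vector_space_axioms)

lemma chain_scale_empty: "chain_scale vec_scale r c S = vec_scale (single 0 r) (c S)"
  by (simp add: chain_mult_def)

lemma red_const_scale: "red (vec_scale (single 0 r) v) = vec_scale r (red (v :: nat \<Rightarrow>\<^sub>0 ('n, 'k) mpoly))"
  by (simp add: red_scale)

text \<open>The last shift, where Koszul degree 0 is reached. A 1-cycle c modulo syzygies yields the
  syzygy \<open>kdiff vec_scale c {}\<close> without constant coefficients; lifting it through the
  resolution and reducing gives a cycle of the reduced complex.\<close>

lemma qdim_tor_Suc:
  assumes h: "koszul_dim vec_scale (free_part F i) (syz i) 1 j h"
  shows "qdim vec_scale (tor_cycles (Suc i) j) (tor_boundaries (Suc i) j) h"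
proof (rule vector_space_pair.qdim_transfer[OF pair,
      where G = "\<lambda>c w. \<exists>v\<in>free_part F (Suc i) j. kdiff vec_scale c {} = lin_ext (col F (Suc i)) v \<and> red v = w",
      OF _ _ _ _ _ Vmod.koszul_cycles_subspace[OF gmod_free_part gmod_syz] tor_cycles_subspace h])
  fix c c' w w'
  assume "\<exists>v\<in>free_part F (Suc i) j. kdiff vec_scale c {} = lin_ext (col F (Suc i)) v \<and> red v = w"
    "\<exists>v\<in>free_part F (Suc i) j. kdiff vec_scale c' {} = lin_ext (col F (Suc i)) v \<and> red v = w'"
  then obtain v v' where "v \<in> free_part F (Suc i) j" "kdiff vec_scale c {} = lin_ext (col F (Suc i)) v" "red v = w"
    "v' \<in> free_part F (Suc i) j" "kdiff vec_scale c' {} = lin_ext (col F (Suc i)) v'" "red v' = w'" by blast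
  then show "\<exists>v\<in>free_part F (Suc i) j. kdiff vec_scale (c + c') {} = lin_ext (col F (Suc i)) v \<and> red v = w + w'"
    by (intro bexI[of _ "v + v'"])
      (auto simp: Vmod.kdiff_add lin_ext_add red_add intro: Vmod.gmod_add[OF gmod_free_part])
next
  fix r c w
  assume "\<exists>v\<in>free_part F (Suc i) j. kdiff vec_scale c {} = lin_ext (col F (Suc i)) v \<and> red v = w"
  then obtain v where "v \<in> free_part F (Suc i) j" "kdiff vec_scale c {} = lin_ext (col F (Suc i)) v" "red v = w" by blast
  then show "\<exists>v\<in>free_part F (Suc i) j. kdiff vec_scale (chain_scale vec_scale r c) {} = lin_ext (col F (Suc i)) v \<and> red v = vec_scale r w"
    by (intro bexI[of _ "vec_scale (single 0 r) v"])
      (auto simp: Vmod.kdiff_chain_mult chain_scale_empty lin_ext_scale red_const_scale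
        intro: Vmod.gmod_sm[OF gmod_free_part homog_part_const])
next
  fix c :: "'n set \<Rightarrow> (nat \<Rightarrow>\<^sub>0 ('n, 'k) mpoly)"
  assume "c \<in> koszul_cycles vec_scale (free_part F i) (syz i) 1 j"
  then have "kdiff vec_scale c \<in> kchains (syz i) 0 j" by (simp add: koszul_cycles_def)
  then have "kdiff vec_scale c {} \<in> syz i j" unfolding kchains_0_iff by blast
  then obtain v where v: "v \<in> free_part F (Suc i) j" "kdiff vec_scale c {} = lin_ext (col F (Suc i)) v"
    using diff_onto by blast
  have "red_diff F (Suc i) (red v) = 0" unfolding red_diff_Suc v(2)[symmetric] by (rule red_kdiff)
  then show "\<exists>w\<in>tor_cycles (Suc i) j. \<exists>v\<in>free_part F (Suc i) j. kdiff vec_scale c {} = lin_ext (col F (Suc i)) v \<and> red v = w"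
    using v red_in[OF v(1)] by blast
next
  fix w assume w: "w \<in> tor_cycles (Suc i) j"
  define v :: "nat \<Rightarrow>\<^sub>0 ('n, 'k) mpoly" where "v = unred w"
  have v: "v \<in> free_part F (Suc i) j" "red v = w" using w by (auto simp: v_def unred_in)
  have "red (lin_ext (col F (Suc i)) v) = 0" unfolding red_diff_Suc[symmetric] using w v by simp
  then obtain c where c: "c \<in> kchains (free_part F i) 1 j" "lin_ext (col F (Suc i)) v = kdiff vec_scale c {}"
    using red_eq_0[OF diff_part[OF v(1)]] by blast
  have "kdiff vec_scale c \<in> kchains (free_part F i) 0 j" using Vmod.kdiff_chain[OF gmod_free_part c(1)] by simp
  then have "kdiff vec_scale c \<in> kchains (syz i) 0 j"
    using diff_in[OF v(1)] c(2) by (simp add: kchains_0_iff)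
  then have "c \<in> koszul_cycles vec_scale (free_part F i) (syz i) 1 j" using c(1) by (simp add: koszul_cycles_def)
  then show "\<exists>c\<in>koszul_cycles vec_scale (free_part F i) (syz i) 1 j. \<exists>v\<in>free_part F (Suc i) j.
      kdiff vec_scale c {} = lin_ext (col F (Suc i)) v \<and> red v = w"
    using c(2)[symmetric] v by blast
next
  fix c :: "'n set \<Rightarrow> (nat \<Rightarrow>\<^sub>0 ('n, 'k) mpoly)" and w
  assume cz: "c \<in> koszul_cycles vec_scale (free_part F i) (syz i) 1 j" and "w \<in> tor_cycles (Suc i) j"
    and "\<exists>v\<in>free_part F (Suc i) j. kdiff vec_scale c {} = lin_ext (col F (Suc i)) v \<and> red v = w"
  then obtain v where v: "v \<in> free_part F (Suc i) j" "kdiff vec_scale c {} = lin_ext (col F (Suc i)) v" "red v = w" by blast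
  show "c \<in> koszul_boundaries vec_scale (free_part F i) (syz i) 1 j \<longleftrightarrow> w \<in> tor_boundaries (Suc i) j"
  proof
    assume "c \<in> koszul_boundaries vec_scale (free_part F i) (syz i) 1 j"
    then obtain e where e: "e \<in> kchains (free_part F i) (1 + 1) j" "c - kdiff vec_scale e \<in> kchains (syz i) 1 j"
      unfolding koszul_boundaries_def by blast
    \<comment> \<open>The syzygy-valued remainder of c lifts to a chain b in F (i + 1). Then v and
      \<open>kdiff vec_scale b {}\<close> differ by a syzygy, and the latter reduces to 0.\<close>
    have "\<exists>b\<in>kchains (free_part F (Suc i)) 1 j. \<forall>S. (c - kdiff vec_scale e) S = lin_ext (col F (Suc i)) (b S)"
    proof (rule kchains_lift[where A = "syz i" and c = "c - kdiff vec_scale e" and G = "\<lambda>z v. z = lin_ext (col F (Suc i)) v"])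
      show "\<exists>v\<in>free_part F (Suc i) d. z = lin_ext (col F (Suc i)) v" if "z \<in> syz i d" for d z
        by (rule diff_onto[OF that])
    qed (use e(2) in simp_all)
    then obtain b where b: "b \<in> kchains (free_part F (Suc i)) 1 j"
      "c - kdiff vec_scale e = (\<lambda>S. lin_ext (col F (Suc i)) (b S))" by (auto simp: fun_eq_iff)
    have "kdiff vec_scale c {} = kdiff vec_scale (c - kdiff vec_scale e) {}"
      by (simp add: Vmod.kdiff_diff Vmod.kdiff_kdiff)
    also have "\<dots> = lin_ext (col F (Suc i)) (kdiff vec_scale b {})" unfolding b(2) lin_ext_kdiff ..
    finally have "lin_ext (col F (Suc i)) (v - kdiff vec_scale b {}) = 0"
      using v(2) by (simp add: lin_ext_diff)
    moreover have "kdiff vec_scale b {} \<in> free_part F (Suc i) j"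
      using Vmod.kdiff_chain[OF gmod_free_part b(1)] by (simp add: kchains_0_iff)
    ultimately have "v - kdiff vec_scale b {} \<in> syz (Suc i) j"
      using Vmod.gmod_diff[OF gmod_free_part v(1)] by (simp add: syz_def)
    then obtain u where u: "u \<in> free_part F (Suc (Suc i)) j" "v - kdiff vec_scale b {} = lin_ext (col F (Suc (Suc i))) u"
      using diff_onto by blast
    have "w = red (v - kdiff vec_scale b {})" using v(3) by (simp add: red_diff_eq red_kdiff)
    then show "w \<in> tor_boundaries (Suc i) j" unfolding u(2) using red_boundary[OF u(1)] by simp
  next
    assume "w \<in> tor_boundaries (Suc i) j"
    then obtain u where u: "u \<in> free_part F (Suc (Suc i)) j" "w = red (lin_ext (col F (Suc (Suc i))) u)"
      using lift_boundary by blast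
    have uz: "lin_ext (col F (Suc (Suc i))) u \<in> syz (Suc i) j" by (rule diff_in[OF u(1)])
    have "v - lin_ext (col F (Suc (Suc i))) u \<in> free_part F (Suc i) j"
      using v(1) uz syz_subset by (intro Vmod.gmod_diff[OF gmod_free_part]) auto
    moreover have "red (v - lin_ext (col F (Suc (Suc i))) u) = 0" using v(3) u(2) by (simp add: red_diff_eq)
    ultimately obtain b where b: "b \<in> kchains (free_part F (Suc i)) 1 j"
      "v - lin_ext (col F (Suc (Suc i))) u = kdiff vec_scale b {}" using red_eq_0 by blast
    \<comment> \<open>Correcting c by this chain of syzygies makes its differential vanish in F i
      itself, so that exactness in Koszul degree 1 applies.\<close>
    define z where "z S = lin_ext (col F (Suc i)) (b S)" for S
    have z: "z \<in> kchains (syz i) 1 j"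
      using b(1) diff_in unfolding kchains_def z_def by (auto split: if_splits)
    have "kdiff vec_scale z {} = lin_ext (col F (Suc i)) (kdiff vec_scale b {})"
      unfolding lin_ext_kdiff z_def[abs_def] ..
    also have "\<dots> = lin_ext (col F (Suc i)) v"
      unfolding b(2)[symmetric] lin_ext_diff using uz by (simp add: syz_def)
    finally have zc: "kdiff vec_scale (c - z) {} = 0" using v(2) by (simp add: Vmod.kdiff_diff)
    have cc: "c \<in> kchains (free_part F i) 1 j" using cz by (simp add: koszul_cycles_def)
    have cz': "c - z \<in> kchains (free_part F i) 1 j"
      using cc Vmod.kchains_mono[OF syz_subset z] by (rule Vmod.kchains_diff[OF gmod_free_part])
    have "kdiff vec_scale (c - z) \<in> kchains (free_part F i) 0 j"
      using Vmod.kdiff_chain[OF gmod_free_part cz'] by simp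
    then have "kdiff vec_scale (c - z) S = 0" for S
      using zc unfolding kchains_0_iff by (cases "S = {}") auto
    then have "kdiff vec_scale (c - z) = 0" by auto
    moreover have "(c - z) {} = 0" by (rule kchains_empty[OF cz']) simp
    ultimately obtain e where e: "e \<in> kchains (free_part F i) (1 + 1) j" "c - z = kdiff vec_scale e"
      using free_koszul_exact[OF cz'] by auto
    have "c - kdiff vec_scale e = z" using e(2)[symmetric] by simp
    then show "c \<in> koszul_boundaries vec_scale (free_part F i) (syz i) 1 j"
      using cc e(1) z unfolding koszul_boundaries_def by auto
  qed
qed

text \<open>Both sides are the degree j part of F 0 modulo the syzygies and the vectors with all
  entries in the ideal of the variables.\<close>

lemma qdim_tor_0:
  assumes h: "koszul_dim vec_scale (free_part F 0) (syz 0) 0 j h"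
  shows "qdim vec_scale (tor_cycles 0 j) (tor_boundaries 0 j) h"
proof (rule vector_space_pair.qdim_transfer[OF pair, where G = "\<lambda>c w. red (c {}) = w",
      OF _ _ _ _ _ Vmod.koszul_cycles_subspace[OF gmod_free_part gmod_syz] tor_cycles_subspace h])
  fix c :: "'n set \<Rightarrow> (nat \<Rightarrow>\<^sub>0 ('n, 'k) mpoly)"
  assume "c \<in> koszul_cycles vec_scale (free_part F 0) (syz 0) 0 j"
  then have "c {} \<in> free_part F 0 j" unfolding koszul_cycles_def kchains_0_iff by blast
  then show "\<exists>w\<in>tor_cycles 0 j. red (c {}) = w" using red_in by (auto simp: red_diff_def)
next
  fix w assume w: "w \<in> tor_cycles 0 j"
  define c :: "'n set \<Rightarrow> (nat \<Rightarrow>\<^sub>0 ('n, 'k) mpoly)" where "c S = (if S = {} then unred w else 0)" for S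
  have "kdiff vec_scale c = 0" by (rule ext) (simp add: kdiff_def c_def)
  then have "c \<in> koszul_cycles vec_scale (free_part F 0) (syz 0) 0 j"
    using w unred_in Vmod.kchains_0[OF gmod_syz, of 0 "- 1" j] unfolding koszul_cycles_def by (auto simp: c_def kchains_def)
  then show "\<exists>c\<in>koszul_cycles vec_scale (free_part F 0) (syz 0) 0 j. red (c {}) = w"
    by (intro bexI[of _ c]) (auto simp: c_def)
next
  fix c :: "'n set \<Rightarrow> (nat \<Rightarrow>\<^sub>0 ('n, 'k) mpoly)" and w
  assume "c \<in> koszul_cycles vec_scale (free_part F 0) (syz 0) 0 j" and "w \<in> tor_cycles 0 j" and w: "red (c {}) = w"
  then have cc: "c \<in> kchains (free_part F 0) 0 j" by (simp add: koszul_cycles_def)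
  then have ce: "c {} \<in> free_part F 0 j" unfolding kchains_0_iff by blast
  show "c \<in> koszul_boundaries vec_scale (free_part F 0) (syz 0) 0 j \<longleftrightarrow> w \<in> tor_boundaries 0 j"
  proof
    assume "c \<in> koszul_boundaries vec_scale (free_part F 0) (syz 0) 0 j"
    then obtain e where "c - kdiff vec_scale e \<in> kchains (syz 0) 0 j" unfolding koszul_boundaries_def by blast
    then have "(c - kdiff vec_scale e) {} \<in> syz 0 j" unfolding kchains_0_iff by blast
    then obtain u where u: "u \<in> free_part F (Suc 0) j" "(c - kdiff vec_scale e) {} = lin_ext (col F (Suc 0)) u"
      using diff_onto by blast
    have "w = red ((c - kdiff vec_scale e) {})" using w by (simp add: red_diff_eq red_kdiff)
    then show "w \<in> tor_boundaries 0 j" unfolding u(2) using red_boundary[OF u(1)] by simp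
  next
    assume "w \<in> tor_boundaries 0 j"
    then obtain u where u: "u \<in> free_part F (Suc 0) j" "w = red (lin_ext (col F (Suc 0)) u)"
      using lift_boundary by blast
    have uz: "lin_ext (col F (Suc 0)) u \<in> syz 0 j" by (rule diff_in[OF u(1)])
    have "c {} - lin_ext (col F (Suc 0)) u \<in> free_part F 0 j"
      using ce uz syz_subset by (intro Vmod.gmod_diff[OF gmod_free_part]) auto
    moreover have "red (c {} - lin_ext (col F (Suc 0)) u) = 0" using w u(2) by (simp add: red_diff_eq)
    ultimately obtain e where e: "e \<in> kchains (free_part F 0) 1 j" "c {} - lin_ext (col F (Suc 0)) u = kdiff vec_scale e {}"
      using red_eq_0 by blast
    have "c - kdiff vec_scale e \<in> kchains (free_part F 0) 0 j"
      using Vmod.kdiff_chain[OF gmod_free_part e(1)] by (intro Vmod.kchains_diff[OF gmod_free_part] cc) simp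
    moreover have "(c - kdiff vec_scale e) {} \<in> syz 0 j" using uz by (simp flip: e(2))
    ultimately have "c - kdiff vec_scale e \<in> kchains (syz 0) 0 j" unfolding kchains_0_iff by blast
    then show "c \<in> koszul_boundaries vec_scale (free_part F 0) (syz 0) 0 j" using cc e(1) unfolding koszul_boundaries_def by auto
  qed
qed (auto simp: red_add chain_scale_empty red_const_scale)

theorem tor_dim_koszul:
  assumes h: "koszul_dim (*) homog_part (ipart I) (int i) j h"
  shows "tor_dim F i j = h"
proof -
  have q: "qdim vec_scale (tor_cycles i j) (tor_boundaries i j) h"
  proof (cases i)
    case 0
    then show ?thesis using qdim_tor_0 koszul_dim_augmentation[OF h] by simp
  next
    case (Suc i')
    \<comment> \<open>Each step trades one Koszul degree for one syzygy module, down to Koszul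
      degree 1.\<close>
    have "koszul_dim vec_scale (free_part F k) (syz k) (int (i - k)) j h" if "k \<le> i'" for k
      using that
    proof (induction k)
      case 0
      then show ?case using koszul_dim_augmentation[OF h] by simp
    next
      case (Suc k)
      then have k: "int (i - k) = int (i - Suc k) + 1" "1 \<le> int (i - Suc k)" using \<open>i = Suc i'\<close> by auto
      have "koszul_dim vec_scale (free_part F k) (syz k) (int (i - k)) j h" using Suc by simp
      then show ?case unfolding k(1) by (rule koszul_dim_syzygy[OF k(2)])
    qed
    from this[of i'] show ?thesis using qdim_tor_Suc[of i' j h] Suc by simp
  qed
  \<comment> \<open>Finitely many generators in degree j make the spaces finite-dimensional, so that
    the difference in \<open>tor_dim\<close> is a relative dimension.\<close>
  have "red_part F i j \<subseteq> kvec.span ((\<lambda>b. single b 1) ` {b \<in> gens F i. gdeg F i b = j})"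
  proof
    fix w assume w: "w \<in> red_part F i j"
    have "w = (\<Sum>b\<in>keys w. vec_scale (lookup w b) (single b 1))"
    proof (rule poly_mapping_eqI)
      fix b
      have "lookup (\<Sum>b\<in>keys w. vec_scale (lookup w b) (single b 1)) b =
        (\<Sum>b'\<in>keys w. if b' = b then lookup w b else 0)"
        unfolding lookup_sum by (intro sum.cong) (auto simp: lookup_single when_def)
      then show "lookup w b = lookup (\<Sum>b\<in>keys w. vec_scale (lookup w b) (single b 1)) b"
        by (auto simp: in_keys_iff)
    qed
    also have "\<dots> \<in> kvec.span ((\<lambda>b. single b 1) ` {b \<in> gens F i. gdeg F i b = j})"
      using w by (intro kvec.span_sum kvec.span_scale kvec.span_base) (auto simp: red_part_def)
    finally show "w \<in> kvec.span ((\<lambda>b. single b 1) ` {b \<in> gens F i. gdeg F i b = j})" .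
  qed
  then have "qdim vec_scale (tor_cycles i j) (tor_boundaries i j) (kvec.dim (tor_cycles i j) - kvec.dim (tor_boundaries i j))"
    using finite_gens
    by (intro kvec.qdim_dim[OF tor_cycles_subspace tor_boundaries_subspace tor_boundaries_subset,
          of "(\<lambda>b. single b 1) ` {b \<in> gens F i. gdeg F i b = j}"]) auto
  from kvec.qdim_unique[OF tor_boundaries_subspace q this] show ?thesis unfolding tor_dim_def by simp
qed

end

section \<open>Existence of graded free resolutions\<close>

lemma finite_monomials: "finite {m :: 'n::finite \<Rightarrow>\<^sub>0 nat. monom_deg m = e}"
proof -
  have le: "lookup m x \<le> monom_deg m" for m :: "'n \<Rightarrow>\<^sub>0 nat" and x
    unfolding monom_deg_def by (rule member_le_sum) auto
  have "finite {f :: 'n \<Rightarrow> nat. \<forall>x. (x \<in> UNIV \<longrightarrow> f x \<in> {..e}) \<and> (x \<notin> UNIV \<longrightarrow> f x = 0)}"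
    by (rule finite_set_of_finite_funs) auto
  then have "finite (lookup ` {m :: 'n \<Rightarrow>\<^sub>0 nat. monom_deg m = e})"
    by (rule rev_finite_subset) (use le in auto)
  then show ?thesis by (rule finite_imageD) (rule inj_onI, rule poly_mapping_eqI, simp)
qed

lemma sum_single_lookup: "v = (\<Sum>b\<in>keys v. single b (lookup v b))"
proof (rule poly_mapping_eqI)
  fix k
  have "lookup (\<Sum>b\<in>keys v. single b (lookup v b)) k =
      (\<Sum>b\<in>keys v. if b = k then lookup v k else 0)"
    unfolding lookup_sum by (intro sum.cong) (auto simp: lookup_single when_def)
  then show "lookup v k = lookup (\<Sum>b\<in>keys v. single b (lookup v b)) k"
    by (auto simp: in_keys_iff)
qed

lemma homog_part_finite_dim:
  "\<exists>T. finite T \<and> homog_part d \<subseteq> Qmod.kspace.span (T :: ('n::finite, 'k::field) mpoly set)"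
proof -
  let ?T = "(\<lambda>m. single m 1 :: ('n, 'k) mpoly) ` {m. monom_deg m = nat d}"
  have "p \<in> Qmod.kspace.span ?T" if p: "p \<in> homog_part d" for p
  proof -
    have "(\<Sum>m\<in>keys p. single 0 (lookup p m) * single m 1) \<in> Qmod.kspace.span ?T"
      using p by (intro Qmod.kspace.span_sum Qmod.kspace.span_scale Qmod.kspace.span_base) (auto simp: homog_part_def)
    also have "(\<Sum>m\<in>keys p. single 0 (lookup p m) * single m 1) = p"
      by (subst (3) sum_single_lookup) (simp add: mult_single)
    finally show ?thesis .
  qed
  moreover have "finite ?T" using finite_monomials by blast
  ultimately show ?thesis by blast
qed

lemma vec_scale_single: "vec_scale c (single b x) = single b (c * x)"
  by (rule poly_mapping_eqI) (simp add: lookup_single when_def)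

lemma lin_ext_single: "lin_ext D (single b c) = vec_scale (c :: 'r::comm_ring_1) (D b)"
  by (subst lin_ext_eq[of "{b}"]) auto

text \<open>Only generators of degree between 0 and d contribute, and the lower bound makes them
  finitely many.\<close>

lemma free_part_finite_dim:
  fixes F :: "('n::finite, 'k::field) free_complex"
  assumes fin: "\<And>e. finite {b \<in> gens F i. gdeg F i b = e}" and nonneg: "\<And>b. b \<in> gens F i \<Longrightarrow> 0 \<le> gdeg F i b"
  shows "\<exists>T. finite T \<and> free_part F i d \<subseteq> Vmod.kspace.span T"
proof -
  define B where "B = (\<Union>e\<in>{0..d}. {b \<in> gens F i. gdeg F i b = e})"
  have B: "finite B" unfolding B_def using fin by blast
  obtain T where T: "\<And>d. finite (T d)" "\<And>d. homog_part d \<subseteq> Qmod.kspace.span (T d :: ('n, 'k) mpoly set)"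
    using homog_part_finite_dim by metis
  define U where "U = (\<Union>b\<in>B. single b ` T (d - gdeg F i b))"
  have U: "finite U" using B T(1) by (simp add: U_def)
  have single_span: "single b p \<in> Vmod.kspace.span U" if b: "b \<in> B" and p: "p \<in> Qmod.kspace.span (T (d - gdeg F i b))" for b p
    using p
  proof (induction rule: Qmod.kspace.span_induct_alt)
    case base
    then show ?case by (simp add: Vmod.kspace.span_zero)
  next
    case (step c x y)
    have "single b (single 0 c * x + y) =
        vec_scale (single 0 c) (single b x) + single b y"
      by (simp add: vec_scale_single single_add)
    moreover have "single b x \<in> U" using step b by (auto simp: U_def)
    ultimately show ?case
      using step by (metis Vmod.kspace.span_add Vmod.kspace.span_scale Vmod.kspace.span_base)
  qed
  have "v \<in> Vmod.kspace.span U" if v: "v \<in> free_part F i d" for v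
  proof -
    have "(\<Sum>b\<in>keys v. single b (lookup v b)) \<in> Vmod.kspace.span U"
    proof (intro Vmod.kspace.span_sum)
      fix b assume b: "b \<in> keys v"
      have h: "lookup v b \<in> homog_part (d - gdeg F i b)" using v by (simp add: free_part_def)
      have "\<not> d - gdeg F i b < 0" using h b by (auto simp: in_keys_iff homog_part_neg)
      moreover have "b \<in> gens F i" using v b by (auto simp: free_part_def free_mod_def)
      ultimately have "b \<in> B" using nonneg[of b] by (auto simp: B_def)
      then show "single b (lookup v b) \<in> Vmod.kspace.span U"
        using h T(2) by (intro single_span) auto
    qed
    then show ?thesis by (subst sum_single_lookup)
  qed
  then show ?thesis using U by blast
qed

text \<open>A stage of the construction consists of the generators, their degrees and their images,
  together with the family \<open>Z\<close> of graded pieces of the next syzygy module. It is wrapped into a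
  constant complex in order to reuse \<open>free_part\<close>.\<close>

type_synonym ('n, 'k) stage = "(nat set \<times> (nat \<Rightarrow> int) \<times> (nat \<Rightarrow> (nat \<Rightarrow>\<^sub>0 ('n, 'k) mpoly))) \<times> (int \<Rightarrow> (nat \<Rightarrow>\<^sub>0 ('n, 'k) mpoly) set)"

definition const_complex :: "('n, 'k::field) stage \<Rightarrow> ('n, 'k) free_complex" where
  "const_complex st = \<lparr>gens = \<lambda>_. fst (fst st), gdeg = \<lambda>_. fst (snd (fst st)), col = \<lambda>_. snd (snd (fst st))\<rparr>"

abbreviation stage_part :: "('n::finite, 'k::field) stage \<Rightarrow> int \<Rightarrow> (nat \<Rightarrow>\<^sub>0 ('n, 'k) mpoly) set" where
  "stage_part st \<equiv> free_part (const_complex st) 0"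

definition good_stage :: "('n::finite, 'k::field) stage \<Rightarrow> bool" where
  "good_stage st \<longleftrightarrow> (\<forall>e. finite {b \<in> fst (fst st). fst (snd (fst st)) b = e}) \<and>
     (\<forall>b\<in>fst (fst st). 0 \<le> fst (snd (fst st)) b) \<and> Vmod.gmod (snd st) \<and> (\<forall>d. snd st d \<subseteq> stage_part st d)"

definition next_stage :: "('n::finite, 'k::field) stage \<Rightarrow> ('n, 'k) stage \<Rightarrow> bool" where
  "next_stage st st' \<longleftrightarrow>
     (\<forall>b\<in>fst (fst st'). snd (snd (fst st')) b \<in> snd st (fst (snd (fst st')) b)) \<and>
     (\<forall>d. \<forall>z\<in>snd st d. \<exists>v\<in>stage_part st' d. z = lin_ext (snd (snd (fst st'))) v) \<and>
     (\<forall>d. snd st' d = {v \<in> stage_part st' d. lin_ext (snd (snd (fst st'))) v = 0})"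

text \<open>A basis of every graded piece of the syzygies serves as the new set of generators. This
  is infinite in all and far from minimal, but finite in each degree.\<close>

lemma next_stage_exists:
  fixes st :: "('n::finite, 'k::field) stage"
  assumes good: "good_stage st"
  shows "\<exists>st'. good_stage st' \<and> next_stage st st'"
proof -
  let ?Z = "snd st"
  have Zg: "Vmod.gmod ?Z" and Zs: "?Z d \<subseteq> stage_part st d" for d using good by (auto simp: good_stage_def)
  have nonneg: "0 \<le> fst (snd (fst st)) b" if "b \<in> fst (fst st)" for b using good that by (auto simp: good_stage_def)
  have "\<exists>B. finite B \<and> B \<subseteq> ?Z d \<and> ?Z d \<subseteq> Vmod.kspace.span B" for d
  proof -
    obtain T where T: "finite T" "stage_part st d \<subseteq> Vmod.kspace.span T"
      using free_part_finite_dim[of "const_complex st" 0 d] good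
      by (auto simp: good_stage_def const_complex_def)
    obtain B where B: "B \<subseteq> ?Z d" "Vmod.kspace.independent B" "?Z d \<subseteq> Vmod.kspace.span B"
      using Vmod.kspace.maximal_independent_subset[of "?Z d"] by blast
    have "B \<subseteq> Vmod.kspace.span T" using B(1) Zs T(2) by blast
    then have "finite B" using Vmod.kspace.independent_span_bound[OF T(1) B(2)] by blast
    then show ?thesis using B by blast
  qed
  then obtain B where B: "\<And>d. finite (B d)" "\<And>d. B d \<subseteq> ?Z d" "\<And>d. ?Z d \<subseteq> Vmod.kspace.span (B d)" by metis
  have "\<exists>N g. B d = g ` {i::nat. i < N} \<and> inj_on g {i. i < N}" for d
    using finite_imp_nat_seg_image_inj_on[OF B(1)[of d]] by blast
  then obtain N g where g: "\<And>d. B d = g d ` {i::nat. i < N d}" "\<And>d. inj_on (g d) {i. i < N d}" by metis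
  \<comment> \<open>A generator is coded as the pair of its degree and its index in the basis of
    that piece. Natural degrees suffice because the pieces of negative degree vanish.\<close>
  define G where "G = {x :: nat. snd (prod_decode x) < N (int (fst (prod_decode x)))}"
  define \<delta> where "\<delta> x = int (fst (prod_decode x))" for x :: nat
  define C where "C x = g (\<delta> x) (snd (prod_decode x))" for x
  define st1 where "st1 = (G, \<delta>, C)"
  \<comment> \<open>The new syzygies live in the free module of the stage being built.
    \<open>const_complex\<close> reads only the generators, so a placeholder stands for the
    component under definition.\<close>
  define Z' where "Z' d = {v \<in> free_part (const_complex (st1, undefined) :: ('n, 'k) free_complex) 0 d. lin_ext C v = 0}" for d
  define st' where "st' = (st1, Z')"
  have cst': "const_complex st' = const_complex (st1, undefined)"
    by (simp add: const_complex_def st'_def)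
  have Zeq: "Z' d = {v \<in> stage_part st' d. lin_ext C v = 0}" for d
    unfolding Z'_def cst' ..
  have CZ: "C b \<in> ?Z (\<delta> b)" if "b \<in> G" for b
  proof -
    have "C b \<in> B (\<delta> b)" using that unfolding g(1) C_def G_def \<delta>_def by auto
    then show ?thesis using B(2) by blast
  qed
  have onto: "\<exists>v\<in>stage_part st' d. z = lin_ext C v" if z: "z \<in> ?Z d" for z d
  proof (cases "d < 0")
    case True
    have "z = 0"
    proof (rule poly_mapping_eqI)
      fix b
      have zf: "z \<in> stage_part st d" using z Zs by blast
      show "lookup z b = lookup 0 b"
      proof (cases "b \<in> keys z")
        case b: True
        have "lookup z b \<in> homog_part (d - fst (snd (fst st)) b)"
          using zf by (simp add: free_part_def const_complex_def)
        moreover have "b \<in> fst (fst st)" using zf b by (auto simp: free_part_def free_mod_def const_complex_def)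
        ultimately show ?thesis using nonneg[of b] True by (simp add: homog_part_neg)
      qed (simp add: in_keys_iff)
    qed
    then show ?thesis by (intro bexI[of _ 0]) (simp_all add: Vmod.gmod_0[OF gmod_free_part])
  next
    case False
    obtain r where "z = (\<Sum>x\<in>B d. vec_scale (single 0 (r x)) x)"
      using z B(3)[of d] Vmod.kspace.span_finite[OF B(1)[of d]] by auto
    also have "\<dots> = (\<Sum>i | i < N d. vec_scale (single 0 (r (g d i))) (g d i))"
      unfolding g(1) by (subst sum.reindex[OF g(2)]) simp
    finally have z: "z = (\<Sum>i | i < N d. vec_scale (single 0 (r (g d i))) (g d i))" .
    define x where "x i = prod_encode (nat d, i)" for i :: nat
    have x: "\<delta> (x i) = d" "snd (prod_decode (x i)) = i" for i
      using False by (simp_all add: x_def \<delta>_def)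
    define v where "v = (\<Sum>i | i < N d. single (x i) (single 0 (r (g d i)) :: ('n, 'k) mpoly))"
    have "single (x i) (single 0 (r (g d i))) \<in> stage_part st' d" if "i < N d" for i
    proof -
      have "x i \<in> G" using that x(2)[of i] x(1)[of i] by (simp add: G_def \<delta>_def)
      then show ?thesis using x(1)[of i]
        by (auto simp: free_part_def free_mod_def const_complex_def st'_def st1_def lookup_single when_def)
    qed
    then have "v \<in> stage_part st' d" unfolding v_def by (intro Vmod.gmod_sum[OF gmod_free_part]) auto
    moreover have "z = lin_ext C v"
      unfolding z v_def lin_ext_sum lin_ext_single C_def x ..
    ultimately show ?thesis by blast
  qed
  have "good_stage st'"
    unfolding good_stage_def
  proof (intro conjI allI ballI)
    fix e
    have "{b \<in> G. \<delta> b = e} \<subseteq> (\<lambda>i. prod_encode (nat e, i)) ` {..<N e}"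
    proof
      fix b assume "b \<in> {b \<in> G. \<delta> b = e}"
      then have "nat e = fst (prod_decode b)" "snd (prod_decode b) < N e" by (auto simp: G_def \<delta>_def)
      then show "b \<in> (\<lambda>i. prod_encode (nat e, i)) ` {..<N e}"
        by (intro image_eqI[of _ _ "snd (prod_decode b)"]) simp_all
    qed
    then have "finite {b \<in> G. \<delta> b = e}" by (rule finite_subset) simp
    then show "finite {b \<in> fst (fst st'). fst (snd (fst st')) b = e}" by (simp add: st'_def st1_def)
  next
    show "Vmod.gmod (snd st')"
      using gmod_free_part[of "const_complex (st1, undefined) :: ('n, 'k) free_complex" 0]
      unfolding Vmod.gmod_def st'_def snd_conv Z'_def by (simp add: lin_ext_add lin_ext_scale)
    show "snd st' d \<subseteq> stage_part st' d" for d
      using Zeq[of d] by (auto simp: st'_def)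
  qed (simp add: st'_def st1_def \<delta>_def)
  moreover have "next_stage st st'"
    unfolding next_stage_def using CZ onto Zeq by (simp add: st'_def st1_def)
  ultimately show ?thesis by blast
qed

text \<open>Assembles exactness of whole modules from the graded pieces, as every element is a
  finite sum of components. It serves both the kernel of the augmentation and the kernels of the
  differentials.\<close>

lemma image_lin_ext_eq:
  fixes F :: "('n::finite, 'k::field) free_complex"
  assumes W0: "0 \<in> W" and Wadd: "\<And>u v. u \<in> W \<Longrightarrow> v \<in> W \<Longrightarrow> u + v \<in> W"
    and Wsc: "\<And>p v. v \<in> W \<Longrightarrow> vec_scale p v \<in> W"
    and WZ: "\<And>v e. v \<in> W \<Longrightarrow> vcomp (gdeg F i) e v \<in> Z e" and ZW: "\<And>e. Z e \<subseteq> W"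
    and col: "\<And>b. b \<in> gens F (Suc i) \<Longrightarrow> col F (Suc i) b \<in> Z (gdeg F (Suc i) b)"
    and onto: "\<And>e z. z \<in> Z e \<Longrightarrow> \<exists>v\<in>free_part F (Suc i) e. z = lin_ext (col F (Suc i)) v"
  shows "W = lin_ext (col F (Suc i)) ` free_mod F (Suc i)"
proof (intro subset_antisym subsetI)
  fix w assume w: "w \<in> W"
  obtain D where D: "finite D" "w = (\<Sum>e\<in>D. vcomp (gdeg F i) e w)" by (rule vcomp_decomp)
  obtain u where u: "\<And>e. u e \<in> free_part F (Suc i) e" "\<And>e. vcomp (gdeg F i) e w = lin_ext (col F (Suc i)) (u e)"
    using onto[OF WZ[OF w]] by metis
  have "w = lin_ext (col F (Suc i)) (\<Sum>e\<in>D. u e)" by (subst D(2)) (simp add: lin_ext_sum u(2))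
  moreover have "(\<Sum>e\<in>E. u e) \<in> free_mod F (Suc i)" for E
  proof (induction E rule: infinite_finite_induct)
    case (insert e E)
    then show ?case using keys_add[of "u e" "\<Sum>e\<in>E. u e"] free_part_mod[OF u(1)[of e]]
      by (auto simp: free_mod_def)
  qed (simp_all add: free_mod_def)
  ultimately show "w \<in> lin_ext (col F (Suc i)) ` free_mod F (Suc i)" by blast
next
  fix w assume "w \<in> lin_ext (col F (Suc i)) ` free_mod F (Suc i)"
  then obtain u where u: "u \<in> free_mod F (Suc i)" "w = lin_ext (col F (Suc i)) u" by blast
  have "(\<Sum>b\<in>S. vec_scale (lookup u b) (col F (Suc i) b)) \<in> W" if "S \<subseteq> keys u" for S
    using that
  proof (induction S rule: infinite_finite_induct)
    case (insert b S)
    then have "b \<in> gens F (Suc i)" using u(1) by (auto simp: free_mod_def)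
    then have "col F (Suc i) b \<in> W" using col ZW by blast
    then show ?case using insert by (auto intro: Wadd Wsc)
  qed (simp_all add: W0)
  then show "w \<in> W" unfolding u(2) lin_ext_def by blast
qed

lemma resolution_exists:
  fixes I :: "('n::finite, 'k::field) mpoly set"
  assumes I: "ideal I mpoly_ring" and hI: "\<And>p d. p \<in> I \<Longrightarrow> hcomp d p \<in> I"
  shows "\<exists>F \<epsilon>. graded_free_resolution (quot_module I) (quot_part I) F \<epsilon>"
proof -
  \<comment> \<open>F 0 is the polynomial ring, with basis index 0 in degree 0, and its syzygies are
    the pieces of I.\<close>
  define cc where "cc = (const_complex (({0}, \<lambda>_. 0, \<lambda>_. 0), undefined) :: ('n, 'k) free_complex)"
  define st0 :: "('n, 'k) stage" where "st0 = (({0}, \<lambda>_. 0, \<lambda>_. 0), \<lambda>d. {v \<in> free_part cc 0 d. lookup v 0 \<in> I})"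
  have cst0: "const_complex st0 = cc" by (simp add: const_complex_def st0_def cc_def)
  have good0: "good_stage st0"
    unfolding good_stage_def cst0
  proof (intro conjI allI ballI)
    show "Vmod.gmod (snd st0)"
      using gmod_free_part[of cc 0]
      unfolding Vmod.gmod_def st0_def snd_conv
      by (simp add: lookup_add ideal_mpoly_0[OF I] ideal_mpoly_add[OF I] ideal_mpoly_mult[OF I])
  qed (auto simp: st0_def)
  obtain s :: "nat \<Rightarrow> ('n, 'k) stage" where s: "\<And>n. good_stage (s n) \<and> (n = 0 \<longrightarrow> s n = st0)" "\<And>n. next_stage (s n) (s (Suc n))"
    using dependent_nat_choice[of "\<lambda>n st. good_stage st \<and> (n = 0 \<longrightarrow> st = st0)" "\<lambda>_. next_stage"]
      good0 next_stage_exists by blast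
  define F :: "('n, 'k) free_complex" where
    "F = \<lparr>gens = \<lambda>i. fst (fst (s i)), gdeg = \<lambda>i. fst (snd (fst (s i))), col = \<lambda>i. snd (snd (fst (s i)))\<rparr>"
  have F: "gens F i = fst (fst (s i))" "gdeg F i = fst (snd (fst (s i)))" "col F i = snd (snd (fst (s i)))" for i
    by (simp_all add: F_def)
  have fp: "free_part F i = stage_part (s i)" for i
    by (rule ext) (simp add: free_part_def free_mod_def F const_complex_def)
  define Z where "Z i = snd (s i)" for i
  have Zs: "Z i d \<subseteq> free_part F i d" for i d using s(1)[of i] by (simp add: Z_def fp good_stage_def)
  have colZ: "col F (Suc i) b \<in> Z i (gdeg F (Suc i) b)" if "b \<in> gens F (Suc i)" for i b
    using s(2)[of i] that by (simp add: next_stage_def F Z_def)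
  have colp: "col F (Suc i) b \<in> free_part F i (gdeg F (Suc i) b)" if "b \<in> gens F (Suc i)" for i b
    using colZ[OF that] Zs by blast
  have onto: "\<exists>v\<in>free_part F (Suc i) e. z = lin_ext (col F (Suc i)) v" if "z \<in> Z i e" for z i e
    using s(2)[of i] that by (simp add: next_stage_def F Z_def fp)
  have ZSuc: "Z (Suc i) d = {v \<in> free_part F (Suc i) d. lin_ext (col F (Suc i)) v = 0}" for i d
    using s(2)[of i] by (simp add: next_stage_def F Z_def fp)
  have Z0: "Z 0 d = {v \<in> free_part F 0 d. lookup v 0 \<in> I}" for d
    unfolding fp Z_def using s(1)[of 0] cst0 by (simp add: st0_def)
  have F0: "gens F 0 = {0}" "gdeg F 0 = (\<lambda>_. 0)" using s(1)[of 0] by (simp_all add: F st0_def)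
  define \<epsilon> where "\<epsilon> v = I +>\<^bsub>mpoly_ring\<^esub> lookup v 0" for v :: "nat \<Rightarrow>\<^sub>0 ('n, 'k) mpoly"
  have eps0: "\<epsilon> v = I \<longleftrightarrow> lookup v 0 \<in> I" for v
    using coset_eq_iff[OF I, of "lookup v 0" 0] by (simp add: \<epsilon>_def coset_0[OF I])
  have mod_add: "u + v \<in> free_mod F i" if "u \<in> free_mod F i" "v \<in> free_mod F i" for u v i
    using that keys_add[of u v] by (auto simp: free_mod_def)
  have mod_sc: "vec_scale p v \<in> free_mod F i" if "v \<in> free_mod F i" for p :: "('n, 'k) mpoly" and v i
  proof -
    have "keys (vec_scale p v) \<subseteq> keys v" by (auto simp: in_keys_iff)
    then show ?thesis using that by (auto simp: free_mod_def)
  qed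
  have "graded_free_resolution (quot_module I) (quot_part I) F \<epsilon>"
    unfolding graded_free_resolution_def quot_module_zero[OF I]
  proof (intro conjI allI ballI)
    show "finite {b \<in> gens F i. gdeg F i b = j}" for i j
      using s(1)[of i] by (simp add: good_stage_def F)
    show "col F (Suc i) b \<in> free_part F i (gdeg F (Suc i) b)" if "b \<in> gens F (Suc i)" for i b
      by (rule colp[OF that])
    show "\<epsilon> (u + v) = \<epsilon> u \<oplus>\<^bsub>quot_module I\<^esub> \<epsilon> v" for u v
      by (simp add: \<epsilon>_def quot_module_add[OF I] lookup_add)
    show "\<epsilon> (vec_scale q v) = q \<odot>\<^bsub>quot_module I\<^esub> \<epsilon> v" for q v
      by (simp add: \<epsilon>_def quot_module_smult[OF I])
    show "\<epsilon> ` free_part F 0 j \<subseteq> quot_part I j" for j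
      by (auto simp: \<epsilon>_def quot_part_def free_part_def F0)
    show "\<epsilon> ` free_mod F 0 = carrier (quot_module I)"
    proof -
      have "I +>\<^bsub>mpoly_ring\<^esub> p = \<epsilon> (single 0 p)" for p by (simp add: \<epsilon>_def)
      moreover have "single 0 p \<in> free_mod F 0" for p by (simp add: free_mod_def F0)
      ultimately have "I +>\<^bsub>mpoly_ring\<^esub> p \<in> \<epsilon> ` free_mod F 0" for p by (rule image_eqI)
      then show ?thesis unfolding quot_module_carrier[OF I] by (auto simp: \<epsilon>_def)
    qed
    show "{v \<in> free_mod F 0. \<epsilon> v = I} = lin_ext (col F 1) ` free_mod F 1"
      unfolding One_nat_def eps0
    proof (rule image_lin_ext_eq[where Z = "Z 0"])
      show "vcomp (gdeg F 0) e v \<in> Z 0 e" if "v \<in> {v \<in> free_mod F 0. lookup v 0 \<in> I}" for v e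
        using that vcomp_in[of v F 0 e] by (auto simp: Z0 lookup_vcomp hI)
      show "Z 0 e \<subseteq> {v \<in> free_mod F 0. lookup v 0 \<in> I}" for e
        by (auto simp: Z0 intro: free_part_mod)
    qed (auto simp: mod_add mod_sc lookup_add ideal_mpoly_0[OF I] ideal_mpoly_add[OF I] ideal_mpoly_mult[OF I]
        colZ onto, simp_all add: free_mod_def)
    show "{v \<in> free_mod F (Suc i). lin_ext (col F (Suc i)) v = 0} =
          lin_ext (col F (Suc (Suc i))) ` free_mod F (Suc (Suc i))" for i
    proof (rule image_lin_ext_eq[where Z = "Z (Suc i)"])
      show "vcomp (gdeg F (Suc i)) e v \<in> Z (Suc i) e"
        if "v \<in> {v \<in> free_mod F (Suc i). lin_ext (col F (Suc i)) v = 0}" for v e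
      proof -
        have "lin_ext (col F (Suc i)) (vcomp (gdeg F (Suc i)) e v) = vcomp (gdeg F i) e (lin_ext (col F (Suc i)) v)"
          using that by (intro vcomp_lin_ext[OF colp, symmetric]) auto
        also have "\<dots> = 0" using that by (auto intro!: poly_mapping_eqI simp: lookup_vcomp)
        finally show ?thesis using that vcomp_in[of v F "Suc i" e] by (simp add: ZSuc)
      qed
      show "Z (Suc i) e \<subseteq> {v \<in> free_mod F (Suc i). lin_ext (col F (Suc i)) v = 0}" for e
        by (auto simp: ZSuc intro: free_part_mod)
    qed (auto simp: mod_add mod_sc lin_ext_add lin_ext_scale colZ onto intro: poly_mapping_eqI, simp_all add: free_mod_def)
  qed
  then show ?thesis by blast
qed

text \<open>Since some resolution exists, \<open>SOME\<close> returns one, and the comparison with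
  Koszul homology holds for whichever it is.\<close>

theorem betti_quot_koszul:
  fixes I :: "('n::finite, 'k::field) mpoly set"
  assumes I: "ideal I mpoly_ring" and hI: "\<And>p d. p \<in> I \<Longrightarrow> hcomp d p \<in> I"
    and h: "koszul_dim (*) homog_part (ipart I) (int i) j h"
  shows "betti_quot I i j = h"
proof -
  obtain \<epsilon> where "graded_free_resolution (quot_module I) (quot_part I)
      (SOME F. \<exists>\<epsilon>. graded_free_resolution (quot_module I) (quot_part I) F \<epsilon>) \<epsilon>"
    using someI_ex[OF resolution_exists[OF I hI]] by blast
  then interpret quot_resolution I "SOME F. \<exists>\<epsilon>. graded_free_resolution (quot_module I) (quot_part I) F \<epsilon>" \<epsilon>
    using I hI by (intro quot_resolution.intro)
  show ?thesis unfolding betti_def by (rule tor_dim_koszul[OF h])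
qed

section \<open>Homogeneous ideals\<close>

lemma Idl_ideal: "ideal (Idl\<^bsub>mpoly_ring\<^esub> S) (mpoly_ring :: ('n::finite, 'k::field) mpoly ring)"
  by (rule MR.genideal_ideal) simp

lemma Idl_superset: "S \<subseteq> Idl\<^bsub>mpoly_ring\<^esub> (S :: ('n::finite, 'k::field) mpoly set)"
  by (rule MR.genideal_self) simp

lemma Idl_minimal: "ideal I mpoly_ring \<Longrightarrow> S \<subseteq> I \<Longrightarrow> Idl\<^bsub>mpoly_ring\<^esub> S \<subseteq> (I :: ('n::finite, 'k::field) mpoly set)"
  by (rule MR.genideal_minimal)

lemma Idl_empty: "Idl\<^bsub>mpoly_ring\<^esub> {} = {0 :: ('n::finite, 'k::field) mpoly}"
proof (rule subset_antisym)
  show "Idl\<^bsub>mpoly_ring\<^esub> {} \<subseteq> {0 :: ('n, 'k) mpoly}"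
    by (rule Idl_minimal) (auto simp: ideal_mpoly_iff)
  show "{0 :: ('n, 'k) mpoly} \<subseteq> Idl\<^bsub>mpoly_ring\<^esub> {}"
    using ideal_mpoly_0[OF Idl_ideal] by blast
qed

lemma Idl_insert:
  fixes f :: "('n::finite, 'k::field) mpoly"
  shows "Idl\<^bsub>mpoly_ring\<^esub> (insert f S) = {a + q * f | a q. a \<in> Idl\<^bsub>mpoly_ring\<^esub> S}" (is "?L = ?R")
proof (rule subset_antisym)
  note S = Idl_ideal[of S]
  have "ideal ?R mpoly_ring"
    unfolding ideal_mpoly_iff
  proof (intro conjI ballI allI)
    have "(0 :: ('n, 'k) mpoly) = 0 + 0 * f" by simp
    then show "0 \<in> ?R" using ideal_mpoly_0[OF S] by blast
  next
    fix x y assume "x \<in> ?R" "y \<in> ?R"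
    then obtain a q b r where "x = a + q * f" "a \<in> Idl\<^bsub>mpoly_ring\<^esub> S" "y = b + r * f" "b \<in> Idl\<^bsub>mpoly_ring\<^esub> S" by blast
    moreover from this have "x + y = (a + b) + (q + r) * f" by (simp add: distrib_right add_ac)
    ultimately show "x + y \<in> ?R" using ideal_mpoly_add[OF S] by blast
  next
    fix x and p :: "('n, 'k) mpoly" assume "x \<in> ?R"
    then obtain a q where "x = a + q * f" "a \<in> Idl\<^bsub>mpoly_ring\<^esub> S" by blast
    moreover from this have "p * x = p * a + (p * q) * f" by (simp only: distrib_left mult.assoc)
    ultimately show "p * x \<in> ?R" using ideal_mpoly_mult[OF S] by blast
  qed
  moreover have "insert f S \<subseteq> ?R"
  proof
    fix x assume "x \<in> insert f S"
    then consider "x = f" | "x \<in> Idl\<^bsub>mpoly_ring\<^esub> S" using Idl_superset by blast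
    then show "x \<in> ?R"
    proof cases
      case 1
      then have "x = 0 + 1 * f" by simp
      then show ?thesis using ideal_mpoly_0[OF S] by blast
    next
      case 2
      moreover have "x = x + 0 * f" by simp
      ultimately show ?thesis by blast
    qed
  qed
  ultimately show "?L \<subseteq> ?R" by (rule Idl_minimal)
next
  note L = Idl_ideal[of "insert f S"]
  have "Idl\<^bsub>mpoly_ring\<^esub> S \<subseteq> ?L" by (rule Idl_minimal[OF L]) (use Idl_superset in blast)
  moreover have "f \<in> ?L" using Idl_superset by blast
  ultimately show "?R \<subseteq> ?L"
    using ideal_mpoly_add[OF L] ideal_mpoly_mult[OF L] by blast
qed

text \<open>The polynomials with all components in the ideal form an ideal themselves, and it
  contains the homogeneous generators.\<close>

lemma hcomp_Idl:
  fixes p :: "('n::finite, 'k::field) mpoly"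
  assumes S: "\<And>s. s \<in> S \<Longrightarrow> \<exists>e. s \<in> homog_part e" and p: "p \<in> Idl\<^bsub>mpoly_ring\<^esub> S"
  shows "hcomp d p \<in> Idl\<^bsub>mpoly_ring\<^esub> S"
proof -
  note I = Idl_ideal[of S]
  let ?K = "{p. \<forall>d. hcomp d p \<in> Idl\<^bsub>mpoly_ring\<^esub> S}"
  have "ideal ?K mpoly_ring"
    unfolding ideal_mpoly_iff
  proof (intro conjI ballI allI)
    show "0 \<in> ?K" using ideal_mpoly_0[OF I] by simp
    show "a + b \<in> ?K" if "a \<in> ?K" "b \<in> ?K" for a b
      using that ideal_mpoly_add[OF I] by (simp add: hcomp_add)
    show "q * a \<in> ?K" if a: "a \<in> ?K" for q a
    proof (intro CollectI allI)
      fix d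
      let ?D = "(\<lambda>m. int (monom_deg m)) ` keys q"
      have "q * a = (\<Sum>e\<in>?D. a * hcomp e q)"
        by (subst hcomp_decomp[of ?D q]) (auto simp: sum_distrib_right sum_distrib_left mult.commute)
      then have "hcomp d (q * a) = (\<Sum>e\<in>?D. hcomp e q * hcomp (d - e) a)"
        by (simp add: hcomp_sum hcomp_mult_homog[OF hcomp_in] mult.commute)
      moreover have "(\<Sum>e\<in>E. hcomp e q * hcomp (d - e) a) \<in> Idl\<^bsub>mpoly_ring\<^esub> S" for E
        using a by (induction E rule: infinite_finite_induct)
          (auto intro: ideal_mpoly_0[OF I] ideal_mpoly_add[OF I] ideal_mpoly_mult[OF I])
      ultimately show "hcomp d (q * a) \<in> Idl\<^bsub>mpoly_ring\<^esub> S" by simp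
    qed
  qed
  moreover have "S \<subseteq> ?K"
  proof (intro subsetI CollectI allI)
    fix s d assume s: "s \<in> S"
    obtain e where "s \<in> homog_part e" using S[OF s] by blast
    then show "hcomp d s \<in> Idl\<^bsub>mpoly_ring\<^esub> S"
      using s Idl_superset[of S] ideal_mpoly_0[OF I] by (auto simp: hcomp_homog)
  qed
  ultimately have "Idl\<^bsub>mpoly_ring\<^esub> S \<subseteq> ?K" by (rule Idl_minimal)
  then show ?thesis using p by blast
qed

text \<open>In a representation a + q f of a form of degree d, a and q may be replaced by their
  components of degrees d and d - e.\<close>

lemma ipart_Idl_insert:
  fixes f :: "('n::finite, 'k::field) mpoly"
  assumes S: "\<And>s. s \<in> S \<Longrightarrow> \<exists>e. s \<in> homog_part e" and f: "f \<in> homog_part e"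
  shows "ipart (Idl\<^bsub>mpoly_ring\<^esub> (insert f S)) = Qmod.add_form homog_part (ipart (Idl\<^bsub>mpoly_ring\<^esub> S)) e f"
proof (intro ext subset_antisym subsetI)
  fix d p assume "p \<in> ipart (Idl\<^bsub>mpoly_ring\<^esub> (insert f S)) d"
  then obtain a q where p: "p \<in> homog_part d" "p = a + q * f" "a \<in> Idl\<^bsub>mpoly_ring\<^esub> S"
    by (auto simp: ipart_def Idl_insert)
  have "p = hcomp d p" using hcomp_homog[OF p(1)] by simp
  also have "\<dots> = hcomp d a + f * hcomp (d - e) q"
    unfolding p(2) hcomp_add hcomp_mult_homog[OF f] by (simp add: mult.commute)
  finally show "p \<in> Qmod.add_form homog_part (ipart (Idl\<^bsub>mpoly_ring\<^esub> S)) e f d"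
    unfolding Qmod.add_form_def ipart_def using hcomp_Idl[OF S p(3)] hcomp_in by blast
next
  fix d p assume "p \<in> Qmod.add_form homog_part (ipart (Idl\<^bsub>mpoly_ring\<^esub> S)) e f d"
  then obtain a b where p: "p = b + f * a" "a \<in> homog_part (d - e)" "b \<in> Idl\<^bsub>mpoly_ring\<^esub> S" "b \<in> homog_part d"
    by (auto simp: Qmod.add_form_def ipart_def)
  have "f * a \<in> homog_part d" using homog_part_mult[OF f p(2)] by simp
  then have "p \<in> homog_part d" using p by (simp add: homog_part_add)
  moreover have "p \<in> Idl\<^bsub>mpoly_ring\<^esub> (insert f S)" using p by (auto simp: Idl_insert mult.commute)
  ultimately show "p \<in> ipart (Idl\<^bsub>mpoly_ring\<^esub> (insert f S)) d" by (simp add: ipart_def)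
qed

lemma lookup_0_homog_part:
  assumes "p \<in> homog_part e" "e \<noteq> 0"
  shows "lookup p 0 = 0"
proof (rule ccontr)
  assume "lookup p 0 \<noteq> 0"
  then have "0 \<in> keys p" by (simp add: in_keys_iff)
  then have "int (monom_deg (0 :: 'a \<Rightarrow>\<^sub>0 nat)) = e" using assms(1) unfolding homog_part_def by blast
  then show False using assms(2) by simp
qed

text \<open>Exactness in Koszul degree 0: f has no constant term, so it is the differential of its
  contraction, whose entries are the y.\<close>

lemma homog_part_var_decomp:
  fixes f :: "('n::finite, 'k::field) mpoly"
  assumes f: "f \<in> homog_part e" and e: "e \<noteq> 0"
  shows "\<exists>y. (\<forall>s. y s \<in> homog_part (e - 1)) \<and> f = (\<Sum>s\<in>UNIV. y s * var s)"
proof -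
  define c where "c S = (if S = {} then f else 0)" for S :: "'n set"
  have c: "c \<in> kchains homog_part 0 e" using f by (auto simp: c_def kchains_def)
  have "kdiff (*) c = 0" by (rule ext) (simp add: kdiff_def c_def)
  moreover have "lookup (c {}) 0 = 0"
    using lookup_0_homog_part[OF f e] by (simp add: c_def)
  ultimately have "f = kdiff (*) (contraction c) {}" using koszul_exact[OF c] by (simp add: c_def)
  then have "f = (\<Sum>s\<in>UNIV. contraction c {s} * var s)"
    by (simp add: kdiff_def ksgn_def mult.commute)
  moreover have "contraction c {s} \<in> homog_part (e - 1)" for s
    using contraction_chain[OF c] unfolding kchains_def by (auto dest: spec[of _ "{s}"])
  ultimately show ?thesis by (intro exI[of _ "\<lambda>s. contraction c {s}"]) simp
qed

section \<open>Koszul homology of complete intersections of quadrics\<close>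

text \<open>The Betti numbers of a complete intersection of r quadrics, as given by the Koszul
  complex on the quadrics themselves.\<close>

definition ci_betti :: "nat \<Rightarrow> int \<Rightarrow> int \<Rightarrow> nat" where
  "ci_betti r a j = (if 0 \<le> a \<and> j = 2 * a then r choose (nat a) else 0)"

lemma ci_betti_Suc: "ci_betti r a j + ci_betti r (a - 1) (j - 2) = ci_betti (Suc r) a j"
proof -
  consider "a < 0" | "a = 0" | "a > 0" by linarith
  then show ?thesis
  proof cases
    case 3
    then obtain b where "a = int (Suc b)" by (metis gr0_implies_Suc zero_less_imp_eq_int)
    then show ?thesis by (auto simp: ci_betti_def nat_add_distrib)
  qed (auto simp: ci_betti_def)
qed

lemma koszul_dim_eq_0:
  assumes "koszul_cycles sm A B a j \<subseteq> koszul_boundaries sm A B a j"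
  shows "koszul_dim sm A B a j 0"
  using assms by (auto simp: qdim_def)

text \<open>Outside bidegree (0, 0) exactness applies. In bidegree (0, 0) the class of 1 survives,
  because 1-chains would need coefficients of degree -1.\<close>

lemma koszul_dim_polynomial_ring:
  "koszul_dim (*) (homog_part :: int \<Rightarrow> ('n::finite, 'k::field) mpoly set) (\<lambda>_. {0}) a j (ci_betti 0 a j)"
proof (cases "a = 0 \<and> j = 0")
  case False
  have "koszul_cycles (*) (homog_part :: int \<Rightarrow> ('n, 'k) mpoly set) (\<lambda>_. {0}) a j \<subseteq> koszul_boundaries (*) homog_part (\<lambda>_. {0}) a j"
  proof
    fix c :: "'n set \<Rightarrow> ('n, 'k) mpoly" assume "c \<in> koszul_cycles (*) homog_part (\<lambda>_. {0}) a j"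
    then have c: "c \<in> kchains homog_part a j" "kdiff (*) c = 0" by (auto simp: koszul_cycles_def kchains_zero)
    have "lookup (c {}) 0 = 0"
    proof (cases "a = 0")
      case True
      then have "c {} \<in> homog_part j" using c(1) by (simp add: kchains_0_iff)
      then show ?thesis using True False by (intro lookup_0_homog_part) auto
    next
      case a: False
      then show ?thesis using kchains_empty[OF c(1)] by simp
    qed
    then have "kdiff (*) (contraction c) = c" by (rule koszul_exact[OF c])
    then show "c \<in> koszul_boundaries (*) homog_part (\<lambda>_. {0}) a j"
      using c contraction_chain[OF c(1)] by (auto simp: koszul_boundaries_def kchains_zero intro!: bexI[of _ "contraction c"])
  qed
  moreover have "ci_betti 0 a j = 0" using False by (auto simp: ci_betti_def)
  ultimately show ?thesis using koszul_dim_eq_0 by metis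
next
  case True
  define g where "g S = (if S = {} then 1 else 0 :: ('n, 'k) mpoly)" for S :: "'n set"
  have gk: "g \<in> koszul_cycles (*) homog_part (\<lambda>_. {0}) 0 0"
  proof -
    have "kdiff (*) g = 0" by (rule ext) (simp add: kdiff_def g_def)
    moreover have "g \<in> kchains homog_part 0 0" by (auto simp: kchains_def g_def)
    ultimately show ?thesis by (simp add: koszul_cycles_def kchains_zero)
  qed
  have kb0: "koszul_boundaries (*) (homog_part :: int \<Rightarrow> ('n, 'k) mpoly set) (\<lambda>_. {0}) 0 0 = {0}"
  proof (intro subset_antisym subsetI)
    fix c :: "'n set \<Rightarrow> ('n, 'k) mpoly" assume "c \<in> koszul_boundaries (*) homog_part (\<lambda>_. {0}) 0 0"
    then obtain b :: "'n set \<Rightarrow> ('n, 'k) mpoly" where b: "b \<in> kchains homog_part 1 0" "c = kdiff (*) b"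
      by (auto simp: koszul_boundaries_def kchains_zero)
    have "b S = 0" for S
    proof -
      have "if int (card S) = 1 then b S \<in> homog_part (0 - 1) else b S = 0"
        using b(1) unfolding kchains_def by blast
      then show ?thesis by (auto simp: homog_part_neg split: if_splits)
    qed
    then have "b = 0" by auto
    then show "c \<in> {0}" using b(2) by simp
  next
    fix c :: "'n set \<Rightarrow> ('n, 'k) mpoly" assume "c \<in> {0}"
    then show "c \<in> koszul_boundaries (*) homog_part (\<lambda>_. {0}) 0 0"
      using Qmod.chain_space.subspace_0[OF Qmod.koszul_boundaries_subspace[OF gmod_homog_part Qmod.gmod_zero]] by auto
  qed
  have "qdim (chain_scale (*)) (koszul_cycles (*) (homog_part :: int \<Rightarrow> ('n, 'k) mpoly set) (\<lambda>_. {0}) 0 0) {0} 1"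
  proof (rule Qmod.chain_space.qdimI[of "{()}" _ "\<lambda>_. g"])
    fix c :: "'n set \<Rightarrow> ('n, 'k) mpoly" assume "c \<in> koszul_cycles (*) homog_part (\<lambda>_. {0}) 0 0"
    then have c: "c {} \<in> homog_part 0" "\<And>S. S \<noteq> {} \<Longrightarrow> c S = 0" by (auto simp: koszul_cycles_def kchains_0_iff)
    have "c {} = single 0 (lookup (c {}) 0)"
    proof (rule poly_mapping_eqI)
      fix m
      show "lookup (c {}) m = lookup (single 0 (lookup (c {}) 0)) m"
        using c(1) unfolding homog_part_def
        by (cases "m = 0") (auto simp: lookup_single when_def in_keys_iff monom_deg_eq_0_iff)
    qed
    then have "c = chain_scale (*) (lookup (c {}) 0) g"
      using c(2) by (auto simp: fun_eq_iff chain_mult_def g_def)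
    then show "\<exists>r. c - (\<Sum>i\<in>{()}. chain_scale (*) (r i) g) \<in> {0}"
      by (intro exI[of _ "\<lambda>_. lookup (c {}) 0"]) simp
  next
    fix r :: "unit \<Rightarrow> 'k" and i assume "(\<Sum>i\<in>{()}. chain_scale (*) (r i) g) \<in> {0}" "i \<in> {()}"
    then have "chain_scale (*) (r i) g = 0" by simp
    then have "chain_scale (*) (r i) g {} = (0 :: 'n set \<Rightarrow> ('n, 'k) mpoly) {}" by (rule fun_cong)
    then have "single (0 :: 'n \<Rightarrow>\<^sub>0 nat) (r i) = 0" by (simp add: chain_mult_def g_def)
    then show "r i = 0" by (metis lookup_single_eq lookup_zero)
  qed (use gk in auto)
  moreover have "ci_betti 0 a j = 1" using True by (simp add: ci_betti_def)
  ultimately show ?thesis using True kb0 by simp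
qed

text \<open>For forms of degree 2 the bound in \<open>koszul_dim_add_form\<close> becomes j \<le> a
  + D, and adding the two Betti numbers is Pascal's rule.\<close>

lemma koszul_dim_add_quadric:
  fixes f :: "('n::finite, 'k::field) mpoly"
  assumes S: "\<And>s. s \<in> S \<Longrightarrow> s \<in> homog_part 2" and f: "f \<in> homog_part 2"
    and inj: "\<And>d a. d \<le> D \<Longrightarrow> a \<in> homog_part d \<Longrightarrow> f * a \<in> Idl\<^bsub>mpoly_ring\<^esub> S \<Longrightarrow> a \<in> Idl\<^bsub>mpoly_ring\<^esub> S"
    and h: "\<And>a j. koszul_dim (*) homog_part (ipart (Idl\<^bsub>mpoly_ring\<^esub> S)) a j (ci_betti r a j)"
    and j: "j \<le> a + D"
  shows "koszul_dim (*) homog_part (ipart (Idl\<^bsub>mpoly_ring\<^esub> (insert f S))) a j (ci_betti (Suc r) a j)"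
proof -
  obtain y where y: "\<And>s. y s \<in> homog_part (2 - 1)" "f = (\<Sum>s\<in>UNIV. y s * var s)"
    using homog_part_var_decomp[OF f] by auto
  have "koszul_dim (*) homog_part (Qmod.add_form homog_part (ipart (Idl\<^bsub>mpoly_ring\<^esub> S)) 2 f) a j
      (ci_betti r a j + ci_betti r (a - 1) (j - 2))"
  proof (rule Qmod.koszul_dim_add_form[OF gmod_homog_part gmod_ipart[OF Idl_ideal] _ y _ _ h h])
    show "ipart (Idl\<^bsub>mpoly_ring\<^esub> S) d \<subseteq> homog_part d" for d by (simp add: ipart_def)
    show "x \<in> ipart (Idl\<^bsub>mpoly_ring\<^esub> S) d"
      if "d \<le> D" "x \<in> homog_part d" "f * x \<in> ipart (Idl\<^bsub>mpoly_ring\<^esub> S) (d + 2)" for d x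
      using that inj by (auto simp: ipart_def)
    show "j \<le> a + D + 2 - 2" using j by simp
  qed
  moreover have "ipart (Idl\<^bsub>mpoly_ring\<^esub> (insert f S)) = Qmod.add_form homog_part (ipart (Idl\<^bsub>mpoly_ring\<^esub> S)) 2 f"
    by (rule ipart_Idl_insert) (use S f in auto)
  ultimately show ?thesis by (simp add: ci_betti_Suc)
qed

lemma koszul_dim_complete_intersection:
  fixes f :: "nat \<Rightarrow> ('n::finite, 'k::field) mpoly"
  assumes f: "\<And>i. i \<in> {1..n} \<Longrightarrow> f i \<in> homog_part 2" and reg: "regular_sequence f n" and r: "r \<le> n"
  shows "koszul_dim (*) homog_part (ipart (Idl\<^bsub>mpoly_ring\<^esub> (f ` {1..r}))) a j (ci_betti r a j)"
  using r
proof (induction r arbitrary: a j)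
  case 0
  have "ipart ({0} :: ('n, 'k) mpoly set) = (\<lambda>_. {0})" by (auto simp: ipart_def)
  then show ?case using koszul_dim_polynomial_ring by (simp add: Idl_empty)
next
  case (Suc r)
  have eq: "f ` {1..Suc r} = insert (f (Suc r)) (f ` {1..r})" by (simp add: atLeastAtMostSuc_conv)
  have "x \<in> Idl\<^bsub>mpoly_ring\<^esub> (f ` {1..r})" if "f (Suc r) * x \<in> Idl\<^bsub>mpoly_ring\<^esub> (f ` {1..r})" for x
  proof -
    have "{1..<Suc r} = {1..r}" by auto
    moreover have "Suc r \<in> {1..n}" using Suc.prems by simp
    ultimately show ?thesis using reg that unfolding regular_sequence_def by metis
  qed
  then show ?case unfolding eq
    \<comment> \<open>The next quadric is a nonzerodivisor in all degrees, so D may be adapted to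
      the bidegree; j - a is the least value allowed.\<close>
    by (intro koszul_dim_add_quadric[where D = "j - a"]) (use f Suc in auto)
qed

section \<open>Hilbert functions\<close>

abbreviation hilbert_dim :: "('n::finite, 'k::field) mpoly set \<Rightarrow> int \<Rightarrow> nat \<Rightarrow> bool" where
  "hilbert_dim I d \<equiv> qdim (\<lambda>c. (*) (single 0 c)) (homog_part d) (ipart I d)"

lemma hilbert_dim_exists:
  assumes "ideal I mpoly_ring"
  shows "\<exists>r. hilbert_dim I d r"
proof -
  obtain T :: "('a, 'b) mpoly set" where T: "finite T" "homog_part d \<subseteq> Qmod.kspace.span T"
    using homog_part_finite_dim by blast
  have "ipart I d \<subseteq> homog_part d" by (simp add: ipart_def)
  from Qmod.kspace.qdim_dim[OF Qmod.gmod_subspace[OF gmod_homog_part] Qmod.gmod_subspace[OF gmod_ipart[OF assms]] this T]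
  show ?thesis by blast
qed

lemma hilbert_dim_unique: "ideal I mpoly_ring \<Longrightarrow> hilbert_dim I d r \<Longrightarrow> hilbert_dim I d s \<Longrightarrow> r = s"
  using Qmod.kspace.qdim_unique[OF Qmod.gmod_subspace[OF gmod_ipart]] by blast

lemma hilbert_dim_neg:
  assumes "ideal I mpoly_ring" "d < 0" "hilbert_dim I d r"
  shows "r = 0"
proof (rule hilbert_dim_unique[OF assms(1,3)])
  have "homog_part d \<subseteq> ipart I d"
    using assms(2) ideal_mpoly_0[OF assms(1)] by (simp add: homog_part_neg ipart_def)
  then show "hilbert_dim I d 0" by (rule Qmod.kspace.qdim_0)
qed

text \<open>The Euler characteristic gives the Hilbert series times (1 - X)^n as (1 - X^2)^n, with n
  the number of variables; cancelling (1 - X)^n leaves (1 + X)^n.\<close>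

lemma hilbert_series_complete_intersection:
  fixes I :: "('n::finite, 'k::field) mpoly set"
  assumes I: "ideal I mpoly_ring" and p: "\<And>d. hilbert_dim I d (p d)"
    and h: "\<And>a j. koszul_dim (*) homog_part (ipart I) a j (ci_betti CARD('n) a j)"
  shows "p (int m) = CARD('n) choose m"
proof -
  let ?n = "CARD('n)"
  define A where "A = Abs_fps (\<lambda>m. int (p (int m)))"
  have "A * (1 - fps_X) ^ ?n = (1 - fps_X ^ 2) ^ ?n"
  proof (rule fps_ext)
    fix m
    have "fps_nth (A * (1 - fps_X) ^ ?n) m =
      (\<Sum>i\<le>?n. (-1) ^ i * int (?n choose i) * (if i \<le> m then fps_nth A (m - i) else 0))"
      by (rule fps_nth_mult_one_minus_X_power)
    also have "\<dots> = (\<Sum>i\<le>?n. (-1) ^ i * int (?n choose i) * int (p (int m - int i)))"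
    proof (intro sum.cong refl arg_cong2[where f = "(*)"])
      fix i
      show "(if i \<le> m then fps_nth A (m - i) else 0) = int (p (int m - int i))"
        using hilbert_dim_neg[OF I _ p, of "int m - int i"] by (auto simp: A_def of_nat_diff)
    qed
    also have "\<dots> = (\<Sum>i\<le>?n. (-1) ^ i * int (ci_betti ?n (int i) (int m)))"
      by (rule Qmod.euler_characteristic[OF gmod_homog_part gmod_ipart[OF I] _ p h, symmetric])
        (auto simp: ipart_def)
    also have "\<dots> = fps_nth ((1 - fps_X ^ 2) ^ ?n) m"
    proof (cases "even m")
      case True
      then obtain k where k: "m = 2 * k" by (elim evenE)
      have "(\<Sum>i\<le>?n. (-1) ^ i * int (ci_betti ?n (int i) (int m))) =
         (\<Sum>i\<le>?n. if i = k then (-1) ^ k * int (?n choose k) else 0)"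
        by (intro sum.cong) (auto simp: ci_betti_def k)
      then show ?thesis by (auto simp: fps_nth_one_minus_X2_power k binomial_eq_0)
    next
      case False
      then have "ci_betti ?n (int i) (int m) = 0" for i by (auto simp: ci_betti_def) presburger
      then show ?thesis using False by (simp add: fps_nth_one_minus_X2_power)
    qed
    finally show "fps_nth (A * (1 - fps_X) ^ ?n) m = fps_nth ((1 - fps_X ^ 2) ^ ?n) m" .
  qed
  also have "(1 - fps_X ^ 2 :: int fps) = (1 + fps_X) * (1 - fps_X)"
    by (simp add: algebra_simps power2_eq_square)
  finally have "A * (1 - fps_X) ^ ?n = (1 + fps_X) ^ ?n * (1 - fps_X) ^ ?n"
    by (simp add: power_mult_distrib)
  then have "A = (1 + fps_X) ^ ?n" by (rule one_minus_fps_X_cancel)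
  then have "fps_nth A m = int (?n choose m)" by (simp add: fps_nth_one_plus_X_power)
  then show ?thesis by (simp add: A_def)
qed

lemma max_rank_cases:
  fixes f :: "('n::finite, 'k::field) mpoly"
  assumes J: "ideal J mpoly_ring" and mr: "max_rank_element J e f"
  shows "(\<forall>a\<in>homog_part (int i). f * a \<in> J \<longrightarrow> a \<in> J) \<or>
    (\<forall>q\<in>homog_part (int i + int e). \<exists>a\<in>homog_part (int i). q - f * a \<in> J)"
proof -
  let ?c = "\<lambda>p. J +>\<^bsub>mpoly_ring\<^esub> p"
  let ?m = "\<lambda>X. X \<otimes>\<^bsub>mpoly_ring Quot J\<^esub> ?c f"
  have m: "?m (?c a) = ?c (f * a)" for a by (simp add: quot_mult[OF J] mult.commute)
  consider "inj_on ?m (quot_part J (int i))" | "?m ` quot_part J (int i) = quot_part J (int (i + e))"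
    using mr unfolding max_rank_element_def Let_def by blast
  then show ?thesis
  proof cases
    case 1
    have "a \<in> J" if a: "a \<in> homog_part (int i)" "f * a \<in> J" for a
    proof -
      have "?c (f * a) = ?c (f * 0)" using a by (simp add: coset_eq_iff[OF J])
      then have "?m (?c a) = ?m (?c 0)" by (simp only: m)
      moreover have "?c a \<in> quot_part J (int i)" "?c 0 \<in> quot_part J (int i)"
        unfolding quot_part_def using a by auto
      ultimately have "?c a = ?c 0" by (rule inj_onD[OF 1])
      then show ?thesis by (simp add: coset_eq_iff[OF J])
    qed
    then show ?thesis by blast
  next
    case 2
    have "\<exists>a\<in>homog_part (int i). q - f * a \<in> J" if "q \<in> homog_part (int i + int e)" for q
    proof -
      have "?c q \<in> quot_part J (int (i + e))" using that by (simp add: quot_part_def)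
      then have "?c q \<in> ?m ` quot_part J (int i)" unfolding 2 .
      then obtain a where a: "a \<in> homog_part (int i)" "?c q = ?m (?c a)"
        unfolding quot_part_def by blast
      then have "q - f * a \<in> J" unfolding m by (simp add: coset_eq_iff[OF J])
      then show ?thesis using a(1) by blast
    qed
    then show ?thesis by blast
  qed
qed

text \<open>Rank and nullity of multiplication by f from degree d to degree d + e of Q / J: q is the
  dimension of the kernel, m the rank, r the dimension of the cokernel.\<close>

lemma multiplication_rank:
  fixes f :: "('n::finite, 'k::field) mpoly"
  assumes J: "ideal J mpoly_ring" and J': "ideal J' mpoly_ring"
    and eq: "ipart J' = Qmod.add_form homog_part (ipart J) e f" and f: "f \<in> homog_part e"
    and p: "hilbert_dim J d p" and p': "hilbert_dim J (d + e) p'" and r: "hilbert_dim J' (d + e) r"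
  shows "\<exists>q m. p = q + m \<and> p' = m + r \<and>
    ((\<forall>a\<in>homog_part d. f * a \<in> J \<longrightarrow> a \<in> J) \<longleftrightarrow> q = 0) \<and>
    ((\<forall>q\<in>homog_part (d + e). \<exists>a\<in>homog_part d. q - f * a \<in> J) \<longrightarrow> r = 0)"
proof -
  define K where "K = {a \<in> homog_part d. f * a \<in> J}"
  have H: "Qmod.kspace.subspace (homog_part d' :: ('n, 'k) mpoly set)" for d'
    by (rule Qmod.gmod_subspace[OF gmod_homog_part])
  have I: "Qmod.kspace.subspace (ipart J d')" "Qmod.kspace.subspace (ipart J' d')" for d'
    by (intro Qmod.gmod_subspace gmod_ipart J J')+
  have L: "f * (c * x) \<in> J" if "f * x \<in> J" for c x
    using ideal_mpoly_mult[OF J that, of c] by (simp only: mult.left_commute)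
  have K: "Qmod.kspace.subspace K"
    unfolding Qmod.kspace.subspace_def K_def
    using H[of d] L ideal_mpoly_add[OF J] ideal_mpoly_0[OF J]
    by (auto simp: Qmod.kspace.subspace_def distrib_left)
  have IK: "ipart J d \<subseteq> K" "K \<subseteq> homog_part d" using ideal_mpoly_mult[OF J] by (auto simp: ipart_def K_def)
  obtain q m where qm: "qdim (\<lambda>c. (*) (single 0 c)) K (ipart J d) q"
    "qdim (\<lambda>c. (*) (single 0 c)) (homog_part d) K m"
    using Qmod.kspace.qdim_split[OF I(1) K IK p] by blast
  have 1: "p = q + m"
    by (rule hilbert_dim_unique[OF J p Qmod.kspace.qdim_add[OF I(1) K IK qm]])
  have pair: "vector_space_pair (\<lambda>c. (*) (single 0 c :: ('n, 'k) mpoly)) (\<lambda>c. (*) (single 0 c :: ('n, 'k) mpoly))"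
    by (intro vector_space_pair.intro Qmod.kspace.vector_space_axioms)
  have mem: "x \<in> ipart J' (d + e) \<longleftrightarrow> (\<exists>a\<in>homog_part d. x - f * a \<in> ipart J (d + e))" for x
  proof
    assume "x \<in> ipart J' (d + e)"
    then obtain a b where "x = b + f * a" "a \<in> homog_part d" "b \<in> ipart J (d + e)"
      by (auto simp: eq Qmod.add_form_def)
    then show "\<exists>a\<in>homog_part d. x - f * a \<in> ipart J (d + e)" by (intro bexI[of _ a]) simp_all
  next
    assume "\<exists>a\<in>homog_part d. x - f * a \<in> ipart J (d + e)"
    then obtain a where a: "a \<in> homog_part d" "x - f * a \<in> ipart J (d + e)" by blast
    moreover have "x = (x - f * a) + f * a" by simp
    ultimately show "x \<in> ipart J' (d + e)" unfolding eq Qmod.add_form_def by force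
  qed
  \<comment> \<open>The rank is also the dimension of J' / J in degree d + e, as a \<mapsto> f a
    identifies this quotient with the forms of degree d modulo the kernel K.\<close>
  have m: "qdim (\<lambda>c. (*) (single 0 c)) (ipart J' (d + e)) (ipart J (d + e)) m"
  proof (rule vector_space_pair.qdim_transfer[OF pair, where G = "\<lambda>a x. x - f * a \<in> ipart J (d + e)", OF _ _ _ _ _ H I(2) qm(2)])
    fix a b x y assume "x - f * a \<in> ipart J (d + e)" "y - f * b \<in> ipart J (d + e)"
    then have "(x - f * a) + (y - f * b) \<in> ipart J (d + e)" by (rule Qmod.kspace.subspace_add[OF I(1)])
    then show "x + y - f * (a + b) \<in> ipart J (d + e)" by (simp add: algebra_simps)
  next
    fix c a x assume "x - f * a \<in> ipart J (d + e)"
    then have "single 0 c * (x - f * a) \<in> ipart J (d + e)" by (rule Qmod.kspace.subspace_scale[OF I(1)])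
    then show "single 0 c * x - f * (single 0 c * a) \<in> ipart J (d + e)"
      by (simp only: right_diff_distrib mult.left_commute[of f])
  next
    fix a :: "('n, 'k) mpoly" assume a: "a \<in> homog_part d"
    have "f * a - f * a \<in> ipart J (d + e)" using Qmod.kspace.subspace_0[OF I(1)] by simp
    then show "\<exists>x\<in>ipart J' (d + e). x - f * a \<in> ipart J (d + e)" using mem a by blast
  next
    fix x assume "x \<in> ipart J' (d + e)"
    then show "\<exists>a\<in>homog_part d. x - f * a \<in> ipart J (d + e)" using mem by blast
  next
    fix a x assume a: "a \<in> homog_part d" and xa: "x - f * a \<in> ipart J (d + e)"
    have "f * a \<in> homog_part (d + e)" using homog_part_mult[OF f a] by (simp add: add.commute)
    then have "a \<in> K \<longleftrightarrow> f * a \<in> ipart J (d + e)" using a by (simp add: K_def ipart_def)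
    also have "\<dots> \<longleftrightarrow> x \<in> ipart J (d + e)"
      using Qmod.kspace.subspace_add[OF I(1) xa, of "f * a"] Qmod.kspace.subspace_diff[OF I(1) _ xa, of x] by auto
    finally show "a \<in> K \<longleftrightarrow> x \<in> ipart J (d + e)" .
  qed
  have "ipart J (d + e) \<subseteq> ipart J' (d + e)" using mem by (force intro: bexI[of _ 0])
  then have 2: "p' = m + r"
    using hilbert_dim_unique[OF J p' Qmod.kspace.qdim_add[OF I _ _ m r]] by (auto simp: ipart_def)
  have 3: "(\<forall>a\<in>homog_part d. f * a \<in> J \<longrightarrow> a \<in> J) \<longleftrightarrow> q = 0"
  proof
    assume "\<forall>a\<in>homog_part d. f * a \<in> J \<longrightarrow> a \<in> J"
    then have "K \<subseteq> ipart J d" by (auto simp: K_def ipart_def)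
    then show "q = 0" using Qmod.kspace.qdim_unique[OF I(1) qm(1) Qmod.kspace.qdim_0] by blast
  next
    assume "q = 0"
    then have "K \<subseteq> ipart J d" using qm(1) Qmod.kspace.qdim_0D by blast
    then show "\<forall>a\<in>homog_part d. f * a \<in> J \<longrightarrow> a \<in> J" by (auto simp: K_def ipart_def)
  qed
  have 4: "r = 0" if s: "\<forall>q\<in>homog_part (d + e). \<exists>a\<in>homog_part d. q - f * a \<in> J"
  proof -
    have "homog_part (d + e) \<subseteq> ipart J' (d + e)"
    proof
      fix x :: "('n, 'k) mpoly" assume x: "x \<in> homog_part (d + e)"
      then obtain a where a: "a \<in> homog_part d" "x - f * a \<in> J" using s by blast
      have "f * a \<in> homog_part (d + e)" using homog_part_mult[OF f a(1)] by (simp add: add.commute)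
      then have "x - f * a \<in> homog_part (d + e)" using x H[of "d + e"] Qmod.kspace.subspace_diff by blast
      then show "x \<in> ipart J' (d + e)" using a mem by (auto simp: ipart_def)
    qed
    then show ?thesis using hilbert_dim_unique[OF J' r Qmod.kspace.qdim_0] by blast
  qed
  show ?thesis using 1 2 3 4 by blast
qed


text \<open>For i < l both lower entries are at most n / 2, where binomials increase; at i = l they
  are mirror images.\<close>

lemma binomial_shift_le:
  assumes "n = 2 * l + 2" "i \<le> l"
  shows "n choose i \<le> n choose (i + 2)"
proof (cases "i = l")
  case True
  have "n - i = i + 2" using assms True by simp
  then show ?thesis using binomial_symmetric[of i n] assms by simp
next
  case False
  show ?thesis by (rule binomial_mono) (use assms False in auto)
qed

text \<open>For i > l both lower entries are at least n / 2, where binomials decrease; at i = l they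
  are mirror images.\<close>

lemma binomial_shift_ge:
  assumes "n = 2 * l + 2" "l \<le> i"
  shows "n choose (i + 2) \<le> n choose i"
proof (cases "i = l")
  case True
  have "n - i = i + 2" using assms True by simp
  then show ?thesis using binomial_symmetric[of i n] assms by simp
next
  case False
  show ?thesis
  proof (cases "i + 2 \<le> n")
    case True
    show ?thesis by (rule binomial_antimono) (use assms False True in auto)
  qed (simp add: binomial_eq_0)
qed

section \<open>Almost complete intersections of quadrics\<close>

text \<open>Homology is a subquotient of the chains modulo I, which are finite-dimensional in each
  bidegree.\<close>

lemma koszul_dim_exists:
  fixes I :: "('n::finite, 'k::field) mpoly set"
  assumes I: "ideal I mpoly_ring"
  shows "\<exists>h. koszul_dim (*) homog_part (ipart I) (int i) j h"
proof -
  let ?B = "kchains (ipart I) (int i) j :: ('n set \<Rightarrow> ('n, 'k) mpoly) set"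
  note g = gmod_homog_part gmod_ipart[OF I]
  note sub = Qmod.kchains_subspace[OF g(2)] Qmod.koszul_cycles_subspace[OF g] Qmod.koszul_boundaries_subspace[OF g]
  have B: "?B \<subseteq> koszul_boundaries (*) homog_part (ipart I) (int i) j"
    by (rule Qmod.kchains_subset_koszul_boundaries[OF g]) (simp add: ipart_def)
  have bz: "koszul_boundaries (*) homog_part (ipart I) (int i) j \<subseteq> koszul_cycles (*) homog_part (ipart I) (int i) j"
    by (rule Qmod.koszul_boundaries_subset_koszul_cycles[OF g])
  have zA: "koszul_cycles (*) homog_part (ipart I) (int i) j \<subseteq> (kchains homog_part (int i) j :: ('n set \<Rightarrow> ('n, 'k) mpoly) set)"
    by (auto simp: koszul_cycles_def)
  obtain r where "hilbert_dim I (j - int i) r" using hilbert_dim_exists[OF I] by blast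
  from Qmod.qdim_kchains[OF g this]
  obtain z where "qdim (chain_scale (*)) (koszul_cycles (*) homog_part (ipart I) (int i) j) ?B z"
    using Qmod.chain_space.qdim_split[OF sub(1,2) order_trans[OF B bz] zA] by blast
  from Qmod.chain_space.qdim_split[OF sub(1,3) B bz this] show ?thesis by blast
qed

locale max_rank_quadrics =
  fixes f :: "nat \<Rightarrow> ('n::finite, 'k::field) mpoly" and n :: nat
  assumes card: "CARD('n) = n" and n2: "n \<ge> 2" and even_n: "even n"
    and quadric: "\<And>i. i \<in> {1..n+1} \<Longrightarrow> f i \<in> homog_part 2"
    and reg: "regular_sequence f n"
    and max_rank: "max_rank_element (Idl\<^bsub>mpoly_ring\<^esub> (f ` {1..n})) 2 (f (n+1))"
begin

abbreviation "J \<equiv> Idl\<^bsub>mpoly_ring\<^esub> (f ` {1..n})"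
abbreviation "I \<equiv> Idl\<^bsub>mpoly_ring\<^esub> (f ` {1..n+1})"

lemma n_ell: "n = 2 * ell n + 2"
  using n2 even_n by (auto simp: ell_def elim!: evenE)

lemma I_insert: "f ` {1..n+1} = insert (f (n+1)) (f ` {1..n})"
  by (simp add: atLeastAtMostSuc_conv)

lemma gens_J: "s \<in> f ` {1..n} \<Longrightarrow> s \<in> homog_part 2" and gens_I: "s \<in> f ` {1..n+1} \<Longrightarrow> s \<in> homog_part 2"
  using quadric by auto

lemma homogeneous_gens: "s \<in> f ` {1..n} \<Longrightarrow> \<exists>e. s \<in> homog_part e" "s \<in> f ` {1..n+1} \<Longrightarrow> \<exists>e. s \<in> homog_part e"
  using gens_J gens_I by blast+

lemma quadric_last: "f (n+1) \<in> homog_part 2"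
  by (rule quadric) simp

lemma ipart_I: "ipart I = Qmod.add_form homog_part (ipart J) 2 (f (n+1))"
  unfolding I_insert by (rule ipart_Idl_insert[OF homogeneous_gens(1) quadric_last])

lemma koszul_dim_J: "koszul_dim (*) homog_part (ipart J) a j (ci_betti n a j)"
  by (rule koszul_dim_complete_intersection[OF quadric reg]) auto

lemma hilbert_J: "hilbert_dim J (int m) (n choose m)"
proof -
  obtain p where p: "\<And>d. hilbert_dim J d (p d)" using hilbert_dim_exists[OF Idl_ideal] by metis
  have "p (int m) = CARD('n) choose m"
    by (rule hilbert_series_complete_intersection[OF Idl_ideal p], unfold card, rule koszul_dim_J)
  then show ?thesis using p[of "int m"] by (simp add: card)
qed

text \<open>Maximal rank makes the kernel or the cokernel vanish, and comparing C(n, i) with C(n, i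
  + 2) decides which. At i = ell n they are equal and both vanish.\<close>

lemma multiplication_rank_J:
  assumes r: "hilbert_dim I (int i + 2) r"
  shows "if i \<le> ell n then (\<forall>a\<in>homog_part (int i). f (n+1) * a \<in> J \<longrightarrow> a \<in> J) \<and>
      int r = int (n choose (i + 2)) - int (n choose i) else r = 0"
proof -
  have p': "hilbert_dim J (int i + 2) (n choose (i + 2))" using hilbert_J[of "i + 2"] by (simp add: add.commute)
  obtain q m where *: "n choose i = q + m" "n choose (i + 2) = m + r"
    "(\<forall>a\<in>homog_part (int i). f (n+1) * a \<in> J \<longrightarrow> a \<in> J) \<longleftrightarrow> q = 0"
    "(\<forall>q\<in>homog_part (int i + 2). \<exists>a\<in>homog_part (int i). q - f (n+1) * a \<in> J) \<longrightarrow> r = 0"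
    using multiplication_rank[OF Idl_ideal Idl_ideal ipart_I quadric_last hilbert_J p' r] by blast
  have qr: "q = 0 \<or> r = 0" using max_rank_cases[OF Idl_ideal max_rank, of i] *(3,4) by auto
  show ?thesis
  proof (cases "i \<le> ell n")
    case True
    then have "q = 0" using binomial_shift_le[OF n_ell True] * qr by auto
    then show ?thesis using True * by auto
  next
    case False
    then have "n choose (i + 2) \<le> n choose i" by (intro binomial_shift_ge[OF n_ell]) auto
    then show ?thesis using False * qr by auto
  qed
qed

lemma hilbert_I: "hilbert_dim I d r \<Longrightarrow> int r = hilbZ n d"
proof -
  assume r: "hilbert_dim I d r"
  consider "d < 0" | "0 \<le> d" "d < 2" | i where "d = int i + 2"
    by (metis add.commute diff_add_cancel diff_ge_0_iff_ge int_nat_eq not_le)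
  then show ?thesis
  proof cases
    case 1
    then show ?thesis using hilbert_dim_neg[OF Idl_ideal 1 r] by (simp add: hilbZ_def)
  next
    case 2
    \<comment> \<open>In degrees 0 and 1 the last quadric contributes nothing.\<close>
    have "ipart I d = ipart J d"
      unfolding ipart_I Qmod.add_form_def using 2 by (auto simp: homog_part_neg)
    then have "hilbert_dim J d r" using r by simp
    moreover have "hilbert_dim J d (n choose nat d)" using hilbert_J[of "nat d"] 2 by simp
    ultimately have "r = n choose nat d" by (rule hilbert_dim_unique[OF Idl_ideal])
    then show ?thesis using 2 by (simp add: hilbZ_def hilb_def nat_less_iff)
  next
    case 3
    \<comment> \<open>Makes the Hilbert function vanish already in degree ell n + 2, although
      multiplication from degree ell n falls under the injective case.\<close>
    have z: "(n choose (ell n + 2)) = (n choose ell n)"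
    proof -
      have "n - ell n = ell n + 2" using n_ell by linarith
      then show ?thesis using binomial_symmetric[of "ell n" n] n_ell by simp
    qed
    have e: "nat d = i + 2" "0 \<le> d" using 3 by simp_all
    have d: "hilbZ n d = hilb n (i + 2)" unfolding hilbZ_def e(1) using e(2) by simp
    have r': "hilbert_dim I (int i + 2) r" using r unfolding 3 .
    show ?thesis
    proof (cases "i < ell n")
      case True
      then have "int r = int (n choose (i + 2)) - int (n choose i)" using multiplication_rank_J[OF r'] by simp
      then show ?thesis using True unfolding d hilb_def by simp
    next
      case False
      then have "r = 0" using multiplication_rank_J[OF r'] z by (cases "i = ell n") (simp_all split: if_splits)
      then show ?thesis using False unfolding d hilb_def by simp
    qed
  qed
qed

text \<open>Below the strand only multiplication in degrees up to ell n is involved, and there the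
  last quadric is injective modulo J.\<close>

lemma koszul_dim_I_low:
  assumes "j \<le> a + int (ell n)"
  shows "koszul_dim (*) homog_part (ipart I) a j (ci_betti (n + 1) a j)"
proof -
  have inj: "x \<in> J" if "d \<le> int (ell n)" "x \<in> homog_part d" "f (n+1) * x \<in> J" for d x
  proof (cases "d < 0")
    case True
    then show ?thesis using that(2) ideal_mpoly_0[OF Idl_ideal] by (auto simp: homog_part_neg)
  next
    case False
    then obtain i where i: "d = int i" by (metis int_nat_eq not_less)
    obtain r where "hilbert_dim I (int i + 2) r" using hilbert_dim_exists[OF Idl_ideal] by blast
    from multiplication_rank_J[OF this] show ?thesis using that i by auto
  qed
  have "koszul_dim (*) homog_part (ipart (Idl\<^bsub>mpoly_ring\<^esub> (insert (f (n+1)) (f ` {1..n})))) a j (ci_betti (Suc n) a j)"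
    by (rule koszul_dim_add_quadric[OF gens_J quadric_last inj koszul_dim_J assms])
  then show ?thesis unfolding I_insert by simp
qed

text \<open>The coefficients have degree j - a > ell n + 1, in which I contains every form.\<close>

lemma koszul_dim_I_high:
  assumes "j > a + int (ell n) + 1"
  shows "koszul_dim (*) homog_part (ipart I) a j 0"
proof (rule koszul_dim_eq_0)
  obtain r where r: "hilbert_dim I (j - a) r" using hilbert_dim_exists[OF Idl_ideal] by blast
  have "\<not> nat (j - a) \<le> ell n + 1" using assms by linarith
  then have "r = 0" using hilbert_I[OF r] by (simp add: hilbZ_def hilb_def split: if_splits)
  then have "homog_part (j - a) \<subseteq> ipart I (j - a)" using r Qmod.kspace.qdim_0D by blast
  then have "koszul_cycles (*) homog_part (ipart I) a j \<subseteq> kchains (ipart I) a j"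
    unfolding koszul_cycles_def kchains_def by (auto split: if_splits)
  also have "\<dots> \<subseteq> koszul_boundaries (*) homog_part (ipart I) a j"
    by (rule Qmod.kchains_subset_koszul_boundaries[OF gmod_homog_part gmod_ipart[OF Idl_ideal]]) (simp add: ipart_def)
  finally show "koszul_cycles (*) homog_part (ipart I) a j \<subseteq> koszul_boundaries (*) homog_part (ipart I) a j" .
qed

text \<open>Take the Euler characteristic in internal degree m = i + ell n + 1. Homological degrees
  below i lie above the strand and contribute 0, those above i lie below it and are known, so h is
  the only unknown.\<close>

lemma koszul_dim_I_middle:
  assumes h: "koszul_dim (*) homog_part (ipart I) (int i) (int i + int (ell n) + 1) h"
  shows "int h = rho n i"
proof (cases "i \<le> n")
  case False
  have "(kchains homog_part (int i) (int i + int (ell n) + 1) :: ('n set \<Rightarrow> ('n, 'k) mpoly) set) \<subseteq> {0}"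
    by (rule Qmod.kchains_eq_0) (use False card in simp)
  then have "koszul_cycles (*) homog_part (ipart I) (int i) (int i + int (ell n) + 1) \<subseteq> {0}"
    unfolding koszul_cycles_def by auto
  also have "{0} \<subseteq> koszul_boundaries (*) homog_part (ipart I) (int i) (int i + int (ell n) + 1)"
    using Qmod.chain_space.subspace_0[OF Qmod.koszul_boundaries_subspace[OF gmod_homog_part gmod_ipart[OF Idl_ideal]]] by blast
  finally have "koszul_dim (*) homog_part (ipart I) (int i) (int i + int (ell n) + 1) 0" by (rule koszul_dim_eq_0)
  then have "h = 0"
    by (rule Qmod.chain_space.qdim_unique[OF Qmod.koszul_boundaries_subspace[OF gmod_homog_part gmod_ipart[OF Idl_ideal]] h])
  then show ?thesis using rho_eq_0[OF n2 even_n] False by simp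
next
  case True
  define m where "m = i + ell n + 1"
  have m: "int m = int i + int (ell n) + 1" by (simp add: m_def)
  obtain r where r: "\<And>d. hilbert_dim I d (r d)" using hilbert_dim_exists[OF Idl_ideal] by metis
  define g where "g k = (if k = i then h else if k < i then 0 else ci_betti (n + 1) (int k) (int m))" for k
  have g: "koszul_dim (*) homog_part (ipart I) (int k) (int m) (g k)" for k
  proof -
    consider "k = i" | "k < i" | "i < k" by linarith
    then show ?thesis
    proof cases
      case 1
      then show ?thesis using h by (simp add: g_def m)
    next
      case 2
      then show ?thesis using koszul_dim_I_high[of "int k" "int m"] by (simp add: g_def m)
    next
      case 3
      then show ?thesis using koszul_dim_I_low[of "int m" "int k"] by (simp add: g_def m)
    qed
  qed
  have "(\<Sum>k\<le>n. (-1) ^ k * int (g k)) = (\<Sum>k\<le>n. (-1) ^ k * int (n choose k) * int (r (int m - int k)))"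
    using Qmod.euler_characteristic[OF gmod_homog_part gmod_ipart[OF Idl_ideal] _ r g]
    by (simp add: card ipart_def)
  also have "\<dots> = fps_nth (K_poly n) m"
    unfolding K_poly_nth[OF n2 even_n] by (intro sum.cong refl) (simp add: hilbert_I[OF r])
  also have "\<dots> = betti_linear n m + (-1) ^ i * rho n i"
    by (simp add: fps_nth_K_poly m_def)
  finally have eu: "(\<Sum>k\<le>n. (-1) ^ k * int (g k)) = betti_linear n m + (-1) ^ i * rho n i" .
  have "(\<Sum>k\<le>n. (-1) ^ k * int (g k)) = (\<Sum>k\<le>n. (if k = i then (-1) ^ i * int h else 0) +
      (if i < k then (-1) ^ k * int (ci_betti (n + 1) (int k) (int m)) else 0))"
    by (intro sum.cong) (auto simp: g_def)
  also have "\<dots> = (-1) ^ i * int h + (\<Sum>k\<le>n. if i < k then (-1) ^ k * int (ci_betti (n + 1) (int k) (int m)) else 0)"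
    using True by (simp add: sum.distrib)
  \<comment> \<open>For m = 2 k the condition i < k means k \<le> ell n, so the known contributions
    are exactly the part of the strand j = 2 i in degree m.\<close>
  also have "(\<Sum>k\<le>n. if i < k then (-1) ^ k * int (ci_betti (n + 1) (int k) (int m)) else 0) = betti_linear n m"
  proof (cases "even m \<and> m div 2 \<le> ell n")
    case e: True
    then obtain k0 where k0: "m = 2 * k0" by (elim conjE evenE)
    have k0': "k0 \<le> ell n" "i < k0" "k0 \<le> n" using e k0 n_ell by (auto simp: m_def)
    have "(\<Sum>k\<le>n. if i < k then (-1) ^ k * int (ci_betti (n + 1) (int k) (int m)) else 0) =
        (\<Sum>k\<le>n. if k = k0 then (-1) ^ k0 * int ((n + 1) choose k0) else 0)"
      using k0' by (intro sum.cong) (auto simp: ci_betti_def k0)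
    then show ?thesis using k0' by (simp add: betti_linear_def k0)
  next
    case e: False
    have "(if i < k then (-1) ^ k * int (ci_betti (n + 1) (int k) (int m)) else 0) = 0" for k
    proof (cases "i < k \<and> m = 2 * k")
      case True
      then have "k \<le> ell n" by (simp add: m_def)
      then show ?thesis using e True by auto
    next
      case False
      then have "i < k \<Longrightarrow> ci_betti (n + 1) (int k) (int m) = 0" by (auto simp: ci_betti_def)
      then show ?thesis by simp
    qed
    moreover have "betti_linear n m = 0" unfolding betti_linear_def by (rule if_not_P[OF e])
    ultimately show ?thesis by (simp only: sum.neutral_const)
  qed
  finally have "(-1) ^ i * int h = (-1) ^ i * rho n i" using eu by simp
  then show ?thesis by simp
qed

text \<open>The two strands do not overlap: 2 i = i + ell n + 1 forces i = ell n + 1, beyond the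
  range of the first.\<close>

theorem betti_I:
  "int (betti_quot I i j) =
     (if j = 2 * int i \<and> i \<le> ell n then int ((n + 1) choose i)
      else if j = int i + int (ell n) + 1 then rho n i
      else 0)"
proof -
  have b: "betti_quot I i j = h" if "koszul_dim (*) homog_part (ipart I) (int i) j h" for h
  proof (rule betti_quot_koszul[OF Idl_ideal _ that])
    show "hcomp d p \<in> I" if "p \<in> I" for p d by (rule hcomp_Idl[OF homogeneous_gens(2) that])
  qed
  consider "j \<le> int i + int (ell n)" | "j = int i + int (ell n) + 1" | "j > int i + int (ell n) + 1" by linarith
  then show ?thesis
  proof cases
    case 1
    then show ?thesis using b[OF koszul_dim_I_low[OF 1]] by (auto simp: ci_betti_def)
  next
    case 2
    obtain h where h: "koszul_dim (*) homog_part (ipart I) (int i) j h" using koszul_dim_exists[OF Idl_ideal] by blast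
    then show ?thesis using b[OF h] koszul_dim_I_middle[of i h] 2 by auto
  next
    case 3
    then show ?thesis using b[OF koszul_dim_I_high[OF 3]] by auto
  qed
qed

end

section \<open>The Betti table and the properties of \<open>rho\<close>\<close>

theorem proposition3p10:
  fixes n :: nat
  assumes "CARD('n::finite) = n" and "n \<ge> 2" and "even n"
  shows
    "(\<forall>f :: nat \<Rightarrow> ('n, 'k::field) mpoly.
        (\<forall>i\<in>{1..n+1}. f i \<in> homog_part 2) \<and>
        regular_sequence f n \<and>
        f (n+1) \<notin> Idl\<^bsub>mpoly_ring\<^esub> (f ` {1..n}) \<and>
        max_rank_element (Idl\<^bsub>mpoly_ring\<^esub> (f ` {1..n})) 2 (f (n+1))
        \<longrightarrow>
        (let I = Idl\<^bsub>mpoly_ring\<^esub> (f ` {1..n+1}) in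
          (\<forall>i j. int (betti_quot I i j) =
             (if j = 2 * int i \<and> i \<le> ell n then int ((n + 1) choose i)
              else if j = int i + int (ell n) + 1 then rho n i
              else 0)) \<and>
          (n \<ge> 6 \<longrightarrow>
            (\<forall>i. int (betti_quot I i (int i + int (ell n) + 1)) =
               (if 2 \<le> i \<and> i \<le> ell n + 3 then rho n i
                else if ell n + 4 \<le> i \<and> i \<le> n then rho n (n + 2 - i)
                else 0))))) \<and>
     (n \<ge> 4 \<longrightarrow> rho n 1 = 0) \<and> (\<forall>k>n. rho n k = 0) \<and>
     (\<forall>k\<le>ell n. rho n k = rho n (n - k + 2)) \<and>
     of_int (rho n n) = catalan (ell n + 2) \<and>
     (n \<ge> 6 \<longrightarrow> of_int (rho n 2) = catalan (ell n + 2)) \<and>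
     rho n (ell n + 1) = rho n (ell n + 3) + int ((n + 1) choose (ell n + 1))"
proof -
  have n: "2 * ell n + 2 = n" using assms by (auto simp: ell_def elim!: evenE)
  note sym = rho_sym[OF assms(2,3)] and van = rho_eq_0[OF assms(2,3)]
  \<comment> \<open>From n = 4 on, 1 \<le> ell n, and the symmetric partner has index n + 1, past
    the end of the strand.\<close>
  have rho_1: "rho n 1 = 0" if "n \<ge> 4"
    using sym[of 1] van[of "n + 2 - 1"] that n by simp
  \<comment> \<open>From n = 6 on, 2 \<le> ell n, and the symmetric partner is
    \<open>rho n n\<close>.\<close>
  have rho_2: "of_int (rho n 2) = catalan (ell n + 2)" if "n \<ge> 6"
    using sym[of 2] rho_n_catalan[OF assms(2,3)] that n by simp
  have strand: "rho n i = (if 2 \<le> i \<and> i \<le> ell n + 3 then rho n i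
      else if ell n + 4 \<le> i \<and> i \<le> n then rho n (n + 2 - i) else 0)" if "n \<ge> 6" for i
  proof -
    consider "i = 0" | "i = 1" | "2 \<le> i" "i \<le> ell n + 3" | "ell n + 4 \<le> i" "i \<le> n" | "i > n"
      using n that by linarith
    then show ?thesis
    proof cases
      case 4
      then have "n + 2 - i \<le> ell n" "n + 2 - (n + 2 - i) = i" using n by linarith+
      then show ?thesis using sym[of "n + 2 - i"] 4 by simp
    next
      case 5
      then show ?thesis using van n that by simp
    qed (use rho_1 rho_0 that in simp_all)
  qed
  have betti: "int (betti_quot (Idl\<^bsub>mpoly_ring\<^esub> (f ` {1..n+1})) i j) =
     (if j = 2 * int i \<and> i \<le> ell n then int ((n + 1) choose i)
      else if j = int i + int (ell n) + 1 then rho n i else 0)"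
    if "\<forall>i\<in>{1..n+1}. f i \<in> homog_part 2" "regular_sequence f n"
      "max_rank_element (Idl\<^bsub>mpoly_ring\<^esub> (f ` {1..n})) 2 (f (n+1))"
    for f :: "nat \<Rightarrow> ('n, 'k) mpoly" and i j
  proof -
    interpret max_rank_quadrics f n
      by (rule max_rank_quadrics.intro) (use assms that in auto)
    show ?thesis by (rule betti_I)
  qed
  have sym': "rho n k = rho n (n - k + 2)" if "k \<le> ell n" for k
  proof -
    have "n - k + 2 = n + 2 - k" using that n by linarith
    then show ?thesis using sym[OF that] by simp
  qed
  show ?thesis
    unfolding Let_def
  proof (intro conjI allI impI)
    fix f :: "nat \<Rightarrow> ('n, 'k) mpoly" and i
    assume "(\<forall>i\<in>{1..n+1}. f i \<in> homog_part 2) \<and> regular_sequence f n \<and>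
        f (n+1) \<notin> Idl\<^bsub>mpoly_ring\<^esub> (f ` {1..n}) \<and>
        max_rank_element (Idl\<^bsub>mpoly_ring\<^esub> (f ` {1..n})) 2 (f (n+1))"
    then have f: "\<forall>i\<in>{1..n+1}. f i \<in> homog_part 2" "regular_sequence f n"
        "max_rank_element (Idl\<^bsub>mpoly_ring\<^esub> (f ` {1..n})) 2 (f (n+1))" by blast+
    show "int (betti_quot (Idl\<^bsub>mpoly_ring\<^esub> (f ` {1..n+1})) i j) =
       (if j = 2 * int i \<and> i \<le> ell n then int ((n + 1) choose i)
        else if j = int i + int (ell n) + 1 then rho n i else 0)" for j
      by (rule betti[OF f])
    assume "6 \<le> n"
    have "int (betti_quot (Idl\<^bsub>mpoly_ring\<^esub> (f ` {1..n+1})) i (int i + int (ell n) + 1)) = rho n i"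
      unfolding betti[OF f] by simp
    also have "\<dots> = (if 2 \<le> i \<and> i \<le> ell n + 3 then rho n i
                else if ell n + 4 \<le> i \<and> i \<le> n then rho n (n + 2 - i) else 0)"
      by (rule strand[OF \<open>6 \<le> n\<close>])
    finally show "int (betti_quot (Idl\<^bsub>mpoly_ring\<^esub> (f ` {1..n+1})) i (int i + int (ell n) + 1)) =
       (if 2 \<le> i \<and> i \<le> ell n + 3 then rho n i
                else if ell n + 4 \<le> i \<and> i \<le> n then rho n (n + 2 - i) else 0)" .
  qed (use rho_1 rho_2 van sym' rho_n_catalan[OF assms(2,3)] rho_middle[OF assms(2,3)] in auto)
qed

end
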